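(* Let $a(t)=t^3+a_2t^2+a_1t+1$ and $b(t)=t^3+b_2t^2+b_1t+1$ be polynomials in $\mathbb{Z}[t]$ such that $a_2\ne a_1$, $b_2\neq b_1$, $(a_2,a_1)\neq(b_2,b_1)$ and $(b_2,b_1)\ne(a_1,a_2)$. Put $\bar a(t)=t^3+a_1t^2+a_2t+1$ and $\bar b(t)=t^3+b_1t^2+b_2t+1$. Then: (1) all linear isomorphisms between the eight surfaces $$S_{a,b},\ S_{\bar a,b},\ S_{a,\bar b},\ S_{\bar a,\bar b},\ S_{b,a},\ S_{\bar b,a},\ S_{b,\bar a},\ S_{\bar b,\bar a}$$ are (besides the identity maps) given by $\tau:(x,y,z)\mapsto(y,x,z)$, $\tau: S_{a',b'}\cong S_{b',a'}$; and (2) $\mathrm{Aut}_{\mathbb{Z}}(S_{a,b})=\mathrm{Aut}_{\mathbb{C}}(S_{a,b})$ is infinite cyclic, generated by the composition $$\sigma_{a,b}:\ S_{a,b}\stackrel{\sigma_y}{\longrightarrow}S_{\bar a,b}\stackrel{\sigma_x}{\longrightarrow}S_{\bar a,\bar b}\stackrel{\sigma_y}{\longrightarrow}S_{a,\bar b}\stackrel{\sigma_x}{\longrightarrow}S_{a,b}.$$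
   Context: For monic cubic polynomials $a,b\in\mathbb{Z}[t]$ with constant term $1$, $S_{a,b}:=\bigl(xyz=a(x)+b(y)-1\bigr)\subset\mathbb{A}^3$, a scheme over $\mathbb{Z}$ (and over $\mathbb{C}$ by base change). $\mathrm{Aut}_{\mathbb{Z}}=\mathrm{Aut}_{\mathbb{C}}$ means that every automorphism over $\mathbb{C}$ comes from one over $\mathbb{Z}$. For $a=t^3+a_2t^2+a_1t+1$ and $b=t^3+b_2t^2+b_1t+1$, the isomorphism $\sigma_y:S_{a,b}\to S_{\bar a,b}$ is $$(x,y,z)\mapsto\bigl(yz-(x^2+a_2x+a_1),\ y,\ yz^2-z(x^2+a_2x+a_1)-(x+a_2)(y^2+b_2y+b_1)\bigr),$$ and $\sigma_x:S_{a,b}\to S_{a,\bar b}$ is $$(x,y,z)\mapsto\bigl(x,\ xz-(y^2+b_2y+b_1),\ xz^2-z(y^2+b_2y+b_1)-(y+b_2)(x^2+a_2x+a_1)\bigr).$$ The same formulas, with the corresponding coefficients, define $\sigma_x,\sigma_y$ on the other surfaces. A linear isomorphism is one of the form $(x,y,z)\mapsto(\lambda_xx,\lambda_yy,\lambda_zz)$ or $(\lambda_yy,\lambda_xx,\lambda_zz)$ with invertible constants $\lambda_x,\lambda_y,\lambda_z$. *)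

theory Defs
  imports Complex_Main "HOL-Computational_Algebra.Polynomial" "HOL-Algebra.Algebra"
    "HOL-Algebra.Algebraic_Closure_Type"
begin

section \<open>Affine hypersurfaces in three-space\<close>

text \<open>
  The polynomial ring \<open>R[x,y,z]\<close> is the type \<open>'r poly poly poly\<close>, read as \<open>R[x][y][z]\<close>, where \<open>R\<close>
  is the base ring \<open>'r\<close>.  A hypersurface \<open>V(f)\<close> in affine three-space over \<open>R\<close> is represented by
  its equation \<open>f\<close>, and its coordinate ring is \<open>R[x,y,z]/(f)\<close>.
\<close>

type_synonym 'r poly3 = "'r poly poly poly"

definition const3 :: "'r::comm_ring_1 \<Rightarrow> 'r poly3" where
  "const3 c = [:[:[:c:]:]:]"

definition vx :: "'r::comm_ring_1 poly3" where "vx = [:[:[:0, 1:]:]:]"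
definition vy :: "'r::comm_ring_1 poly3" where "vy = [:[:0, 1:]:]"
definition vz :: "'r::comm_ring_1 poly3" where "vz = [:0, 1:]"

abbreviation poly3_ring :: "'r::comm_ring_1 poly3 ring" where
  "poly3_ring \<equiv> ring_of_type_algebra"

definition coord_ring :: "'r::comm_ring_1 poly3 \<Rightarrow> 'r poly3 set ring" where
  "coord_ring f = poly3_ring Quot (PIdl\<^bsub>poly3_ring\<^esub> f)"

definition cls :: "'r::comm_ring_1 poly3 \<Rightarrow> 'r poly3 \<Rightarrow> 'r poly3 set" where
  "cls f p = PIdl\<^bsub>poly3_ring\<^esub> f +>\<^bsub>poly3_ring\<^esub> p"

text \<open>
  A morphism \<open>V(f) \<rightarrow> V(g)\<close> of schemes over \<open>R\<close> is represented by its comorphism, an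
  \<open>R\<close>-algebra homomorphism from the coordinate ring of \<open>g\<close> to that of \<open>f\<close>.  Comorphisms are
  extensional, so that equality of functions is equality of morphisms.
\<close>

definition mor :: "'r::comm_ring_1 poly3 \<Rightarrow> 'r poly3 \<Rightarrow> ('r poly3 set \<Rightarrow> 'r poly3 set) set" where
  "mor f g = {\<phi> \<in> ring_hom (coord_ring g) (coord_ring f).
     \<phi> \<in> extensional (carrier (coord_ring g)) \<and>
     (\<forall>c. \<phi> (cls g (const3 c)) = cls f (const3 c))}"

definition isos :: "'r::comm_ring_1 poly3 \<Rightarrow> 'r poly3 \<Rightarrow> ('r poly3 set \<Rightarrow> 'r poly3 set) set" where
  "isos f g = mor f g \<inter> ring_iso (coord_ring g) (coord_ring f)"

definition id_mor :: "'r::comm_ring_1 poly3 \<Rightarrow> 'r poly3 set \<Rightarrow> 'r poly3 set" where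
  "id_mor f = (\<lambda>u \<in> carrier (coord_ring f). u)"

text \<open>
  \<open>mor_comp h \<psi> \<phi>\<close> is the composite of \<open>\<phi> : V(f) \<rightarrow> V(g)\<close> followed by \<open>\<psi> : V(g) \<rightarrow> V(h)\<close>;
  comorphisms compose in the opposite order.
\<close>

definition mor_comp :: "'r::comm_ring_1 poly3 \<Rightarrow> ('r poly3 set \<Rightarrow> 'r poly3 set) \<Rightarrow>
    ('r poly3 set \<Rightarrow> 'r poly3 set) \<Rightarrow> 'r poly3 set \<Rightarrow> 'r poly3 set" where
  "mor_comp h \<psi> \<phi> = compose (carrier (coord_ring h)) \<phi> \<psi>"

definition Aut :: "'r::comm_ring_1 poly3 \<Rightarrow> ('r poly3 set \<Rightarrow> 'r poly3 set) monoid" where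
  "Aut f = \<lparr>carrier = isos f f, monoid.mult = mor_comp f, one = id_mor f\<rparr>"

text \<open>\<open>given_by f g \<phi> P Q T\<close>: the morphism \<open>\<phi> : V(f) \<rightarrow> V(g)\<close> is \<open>(x,y,z) \<mapsto> (P,Q,T)\<close>.\<close>

definition given_by :: "'r::comm_ring_1 poly3 \<Rightarrow> 'r poly3 \<Rightarrow> ('r poly3 set \<Rightarrow> 'r poly3 set) \<Rightarrow>
    'r poly3 \<Rightarrow> 'r poly3 \<Rightarrow> 'r poly3 \<Rightarrow> bool" where
  "given_by f g \<phi> P Q T \<longleftrightarrow>
     \<phi> (cls g vx) = cls f P \<and> \<phi> (cls g vy) = cls f Q \<and> \<phi> (cls g vz) = cls f T"

definition mor_of :: "'r::comm_ring_1 poly3 \<Rightarrow> 'r poly3 \<Rightarrow> 'r poly3 \<Rightarrow> 'r poly3 \<Rightarrow> 'r poly3 \<Rightarrow>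
    'r poly3 set \<Rightarrow> 'r poly3 set" where
  "mor_of f g P Q T = (THE \<phi>. \<phi> \<in> mor f g \<and> given_by f g \<phi> P Q T)"

definition linear_isos ::
    "'r::comm_ring_1 poly3 \<Rightarrow> 'r poly3 \<Rightarrow> ('r poly3 set \<Rightarrow> 'r poly3 set) set" where
  "linear_isos f g = {\<phi> \<in> isos f g. \<exists>l m n. l dvd 1 \<and> m dvd 1 \<and> n dvd 1 \<and>
     (given_by f g \<phi> (const3 l * vx) (const3 m * vy) (const3 n * vz) \<or>
      given_by f g \<phi> (const3 m * vy) (const3 l * vx) (const3 n * vz))}"

definition tau :: "'r::comm_ring_1 poly3 \<Rightarrow> 'r poly3 \<Rightarrow> 'r poly3 set \<Rightarrow> 'r poly3 set" where
  "tau f g = mor_of f g vy vx vz"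

subsection \<open>Base change from the integers to the complex numbers\<close>

definition cx :: "int poly3 \<Rightarrow> complex poly3" where
  "cx = map_poly (map_poly (map_poly of_int))"

text \<open>\<open>\<psi> : V(cx f) \<rightarrow> V(cx g)\<close> is the base change of \<open>\<phi> : V(f) \<rightarrow> V(g)\<close>.\<close>

definition is_base_change :: "int poly3 \<Rightarrow> int poly3 \<Rightarrow> (int poly3 set \<Rightarrow> int poly3 set) \<Rightarrow>
    (complex poly3 set \<Rightarrow> complex poly3 set) \<Rightarrow> bool" where
  "is_base_change f g \<phi> \<psi> \<longleftrightarrow>
     (\<forall>p q. \<phi> (cls g p) = cls f q \<longrightarrow> \<psi> (cls (cx g) (cx p)) = cls (cx f) (cx q))"

definition infinite_cyclic_gen :: "('a, 'b) monoid_scheme \<Rightarrow> 'a \<Rightarrow> bool" where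
  "infinite_cyclic_gen G g \<longleftrightarrow>
     group G \<and> g \<in> carrier G \<and> carrier (subgroup_generated G {g}) = carrier G \<and>
     infinite (carrier G)"

section \<open>The surfaces and their isomorphisms\<close>

definition surf :: "int poly \<Rightarrow> int poly \<Rightarrow> int poly3" where
  "surf a b = vx * vy * vz - (poly (map_poly of_int a) vx + poly (map_poly of_int b) vy - 1)"

definition bar :: "int poly \<Rightarrow> int poly" where
  "bar a = [:1, poly.coeff a 2, poly.coeff a 1, 1:]"

definition quad :: "int poly \<Rightarrow> int poly3 \<Rightarrow> int poly3" where
  "quad a u = u^2 + of_int (poly.coeff a 2) * u + of_int (poly.coeff a 1)"

definition sigma_y :: "int poly \<Rightarrow> int poly \<Rightarrow> int poly3 set \<Rightarrow> int poly3 set" where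
  "sigma_y a b = mor_of (surf a b) (surf (bar a) b)
     (vy * vz - quad a vx)
     vy
     (vy * vz^2 - vz * quad a vx - (vx + of_int (poly.coeff a 2)) * quad b vy)"

definition sigma_x :: "int poly \<Rightarrow> int poly \<Rightarrow> int poly3 set \<Rightarrow> int poly3 set" where
  "sigma_x a b = mor_of (surf a b) (surf a (bar b))
     vx
     (vx * vz - quad b vy)
     (vx * vz^2 - vz * quad b vy - (vy + of_int (poly.coeff b 2)) * quad a vx)"

definition sigma :: "int poly \<Rightarrow> int poly \<Rightarrow> int poly3 set \<Rightarrow> int poly3 set" where
  "sigma a b =
     mor_comp (surf a b) (sigma_x a (bar b))
       (mor_comp (surf a (bar b)) (sigma_y (bar a) (bar b))
         (mor_comp (surf (bar a) (bar b)) (sigma_x (bar a) b) (sigma_y a b)))"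

end

theory Submission
  imports Defs "HOL-Library.Poly_Mapping"
begin

text \<open>
  Eliminating \<open>z\<close> embeds the coordinate ring \<open>A\<close> of the surface into the Laurent polynomials in \<open>x\<close> and
  \<open>y\<close>, on which a pair of rationally independent weights of \<open>x\<close> and \<open>y\<close> defines a valuation \<open>v\<close>.  An
  automorphism sends \<open>(x, y, z)\<close> to a triple \<open>(U, V, W)\<close> whose logarithmic Jacobian \<open>{U, V} / (U V)\<close>
  lies in \<open>A\<close> and has value at most \<open>0\<close>, hence is a nonzero constant.  Therefore the leading exponents of
  \<open>U\<close> and \<open>V\<close> are linearly independent, and \<open>v\<close> is a monomial valuation in \<open>U\<close> and \<open>V\<close> too.  Passing from
  \<open>U\<close> to \<open>b(V) / U\<close>, or from \<open>V\<close> to \<open>a(U) / V\<close>, which is what \<open>\<sigma>\<^sub>y\<close> and \<open>\<sigma>\<^sub>x\<close> do, replaces \<open>v(U)\<close> by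
  \<open>3 v(V) - v(U)\<close>, or \<open>v(V)\<close> by \<open>3 v(U) - v(V)\<close>, and the descent stops when \<open>v(U) / v(V)\<close> lies between
  \<open>2 / 3\<close> and \<open>3 / 2\<close>.  In that range the two smallest values of nonconstant regular functions are
  \<open>v(U)\<close> and \<open>v(V)\<close>.  As these can be read off from \<open>A\<close>, the reduced triple is \<open>(x, y, z)\<close> up to a linear
  change of coordinates, which the coefficients force to be trivial.  So every automorphism is a word in
  the two involutions, and the ones that return to the surface we started from are the powers of
  \<open>\<sigma>\<close>.  The argument is uniform in the base ring, and so it covers \<open>\<int>\<close> and \<open>\<complex>\<close> at once.
\<close>


section \<open>Evaluation of polynomials in three variables\<close>

text \<open>Two facts about regular functions carry the argument. If such a function has degree
  \<open>d >= 1\<close> in \<open>x, y, z\<close>, its support contains an exponent of total degree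
  \<open>d\<close> whose x-part is at least \<open>1 - d\<close>, not merely \<open>- d\<close>. The
  gained unit comes from the node at infinity of xyz = x^3 + y^3. It turns the lower bound for
  values in degree at least 2 into 3 v(V) - v(U), the value of the mutated coordinate, when v(V) <
  v(U); this exceeds v(U) precisely in the reduced range, whereas without the unit a narrower range
  would result and the descent would leave a gap. Secondly, the values are real numbers, so a
  decreasing sequence of them need not stop by itself; it stops because only finitely many values of
  regular functions lie below a given bound. The logarithmic Jacobian is regular because
  \<open>U\<close> times its mutation is a cubic in \<open>V\<close>, whose bracket with
  \<open>V\<close> vanishes, and because the mutation does not divide zero modulo \<open>U\<close>.
  The integrality of the coefficients enters late, where scalings by cube roots of unity are
  excluded.\<close>

definition rhom :: "('a::comm_ring_1 \<Rightarrow> 'b::comm_ring_1) \<Rightarrow> bool" where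
  "rhom h \<longleftrightarrow> h 0 = 0 \<and> h 1 = 1 \<and> (\<forall>x y. h (x + y) = h x + h y) \<and> (\<forall>x y. h (x * y) = h x * h y)"

lemma rhomD:
  assumes "rhom h"
  shows "h 0 = 0" "h 1 = 1" "h (x + y) = h x + h y" "h (x * y) = h x * h y"
    "h (- x) = - h x" "h (x - y) = h x - h y" "h (x ^ n) = h x ^ n" "h (of_int k) = of_int k"
proof -
  show 1: "h 0 = 0" "h 1 = 1" "\<And>x y. h (x + y) = h x + h y" "\<And>x y. h (x * y) = h x * h y"
    using assms unfolding rhom_def by auto
  show 2: "h (- x) = - h x" for x
    using 1(3)[of x "- x"] 1(1) by (simp add: eq_neg_iff_add_eq_0 add.commute)
  show 3: "h (x - y) = h x - h y" for x y
    using 1(3)[of x "- y"] 2 by simp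
  show "h (x ^ n) = h x ^ n"
    by (induction n) (auto simp: 1)
  have n: "h (of_nat n) = of_nat n" for n
    by (induction n) (auto simp: 1)
  show "h (of_int k) = of_int k"
    by (cases k rule: int_cases2) (auto simp: n 2)
qed

lemma rhom_id: "rhom (\<lambda>x. x)" by (simp add: rhom_def)
lemma rhom_comp: "rhom g \<Longrightarrow> rhom h \<Longrightarrow> rhom (\<lambda>x. g (h x))" by (simp add: rhom_def)
lemma rhom_of_int: "rhom of_int" by (simp add: rhom_def)

definition ev1 :: "('a::comm_ring_1 \<Rightarrow> 'b::comm_ring_1) \<Rightarrow> 'b \<Rightarrow> 'a poly \<Rightarrow> 'b" where
  "ev1 h u p = poly (map_poly h p) u"

lemma ev1_pCons: "rhom h \<Longrightarrow> ev1 h u (pCons a p) = h a + u * ev1 h u p"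
  unfolding ev1_def by (simp add: map_poly_pCons rhomD)

lemma ev1_0: "ev1 h u 0 = 0"
  unfolding ev1_def by simp

lemma ev1_const: "rhom h \<Longrightarrow> ev1 h u [:a:] = h a"
  by (simp add: ev1_pCons ev1_0)

lemma ev1_var: "rhom h \<Longrightarrow> ev1 h u [:0, 1:] = u"
  by (simp add: ev1_pCons ev1_0 rhomD)

lemma rhom_ev1:
  assumes h: "rhom h"
  shows "rhom (ev1 h u)"
proof -
  have add: "ev1 h u (p + q) = ev1 h u p + ev1 h u q" for p q
    by (induction p q rule: poly_induct2)
       (auto simp: ev1_pCons[OF h] ev1_0 rhomD[OF h] algebra_simps)
  have smult: "ev1 h u (smult a q) = h a * ev1 h u q" for a q
    by (induction q) (auto simp: ev1_pCons[OF h] ev1_0 rhomD[OF h] algebra_simps)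
  have mult: "ev1 h u (p * q) = ev1 h u p * ev1 h u q" for p q
    by (induction p) (auto simp: ev1_pCons[OF h] ev1_0 rhomD[OF h] add smult algebra_simps)
  show ?thesis
    unfolding rhom_def using add mult ev1_0[of h u] ev1_const[OF h, of u 1] rhomD(2)[OF h]
    by (auto simp: one_pCons)
qed

lemma ev1_unique:
  assumes g: "rhom g" and h: "rhom h"
    and "\<And>a. g [:a:] = h a" and "g [:0, 1:] = u"
  shows "g p = ev1 h u p"
proof (induction p)
  case 0
  then show ?case by (simp add: rhomD[OF g] ev1_0)
next
  case (pCons a p)
  have "g (pCons a p) = g ([:a:] + [:0, 1:] * p)" by simp
  then show ?case using pCons assms by (simp only: rhomD[OF g] ev1_pCons)
qed

definition ev2 :: "('a::comm_ring_1 \<Rightarrow> 'b::comm_ring_1) \<Rightarrow> 'b \<Rightarrow> 'b \<Rightarrow> 'a poly poly \<Rightarrow> 'b" where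
  "ev2 h u v = ev1 (ev1 h u) v"

text \<open>Coefficients pass through \<open>h\<close>. Two instances matter:
  \<open>h = const3\<close> substitutes polynomials and so lifts a comorphism,
  \<open>h = cst\<close> evaluates a function at a point with Laurent polynomial
  coordinates.\<close>

definition ev3 :: "('a::comm_ring_1 \<Rightarrow> 'b::comm_ring_1) \<Rightarrow> 'b \<Rightarrow> 'b \<Rightarrow> 'b \<Rightarrow> 'a poly3 \<Rightarrow> 'b" where
  "ev3 h u v w = ev1 (ev2 h u v) w"

lemma rhom_ev2: "rhom h \<Longrightarrow> rhom (ev2 h u v)"
  unfolding ev2_def by (intro rhom_ev1)

lemma rhom_ev3: "rhom h \<Longrightarrow> rhom (ev3 h u v w)"
  unfolding ev3_def by (intro rhom_ev1 rhom_ev2)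

lemma ev3_gens:
  assumes h: "rhom h"
  shows "ev3 h u v w vx = u" "ev3 h u v w vy = v" "ev3 h u v w vz = w"
    "ev3 h u v w (const3 c) = h c"
proof -
  note r = rhom_ev1[OF h, of u] rhom_ev2[OF h, of u v]
  note r' = r(2)[unfolded ev2_def]
  show "ev3 h u v w vx = u" "ev3 h u v w vy = v" "ev3 h u v w vz = w"
    "ev3 h u v w (const3 c) = h c"
    unfolding vx_def vy_def vz_def const3_def ev3_def ev2_def
    by (simp_all add: ev1_const[OF r'] ev1_const[OF r(1)] ev1_const[OF h]
        ev1_var[OF r'] ev1_var[OF r(1)] ev1_var[OF h])
qed

lemma rhom_const_poly: "rhom (\<lambda>c::'a::comm_ring_1. [:c:])"
  by (simp add: rhom_def one_pCons)

lemma rhom_const3: "rhom const3"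
  unfolding const3_def by (intro rhom_comp[OF rhom_const_poly] rhom_const_poly)

text \<open>The universal property of the polynomial ring, by one use of \<open>ev1_unique\<close>
  for each of the three layers of the type. Identities between substitutions are checked on
  generators through it.\<close>

lemma ev3_unique:
  assumes g: "rhom g"
  shows "g P = ev3 (\<lambda>c. g (const3 c)) (g vx) (g vy) (g vz) P"
proof -
  note cp = rhom_const_poly
  have 0: "rhom (\<lambda>c. g (const3 c))"
    by (intro rhom_comp[OF g] rhom_const3)
  have 1: "g [:[:p:]:] = ev1 (\<lambda>c. g (const3 c)) (g vx) p" for p
    by (rule ev1_unique)
       (use 0 in \<open>auto simp: const3_def vx_def intro!: rhom_comp[OF g] rhom_comp[OF cp] cp\<close>)
  have 2: "g [:p:] = ev2 (\<lambda>c. g (const3 c)) (g vx) (g vy) p" for p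
    unfolding ev2_def
    by (rule ev1_unique)
       (use 0 1 in \<open>auto simp: vy_def intro!: rhom_comp[OF g] cp rhom_ev1\<close>)
  show ?thesis
    unfolding ev3_def
    by (rule ev1_unique) (use 0 2 g in \<open>auto simp: vz_def intro!: rhom_ev2\<close>)
qed

lemma ev3_comp:
  assumes g: "rhom g" and h: "rhom h"
  shows "g (ev3 h u v w P) = ev3 (\<lambda>c. g (h c)) (g u) (g v) (g w) P"
  using ev3_unique[OF rhom_comp[OF g rhom_ev3[OF h]], of u v w P]
  by (simp add: ev3_gens[OF h])

lemma ev3_id: "ev3 const3 vx vy vz P = P"
  using ev3_unique[OF rhom_id, of P] by simp

lemma rhom_rep:
  assumes "rhom g" "\<And>c. g (const3 c) = h c" "g vx = u" "g vy = v" "g vz = w"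
  shows "g P = ev3 h u v w P"
  using ev3_unique[OF assms(1), of P] assms(2-) by simp

lemma ev3_dvd: "rhom h \<Longrightarrow> F dvd P \<Longrightarrow> ev3 h u v w F dvd ev3 h u v w P"
  by (auto simp: dvd_def rhomD[OF rhom_ev3])

lemma rhom_map_poly:
  assumes h: "rhom h"
  shows "rhom (map_poly h)"
proof -
  \<comment> \<open>Mapping coefficients is itself an evaluation, namely at the variable of the
    target polynomial ring, and so inherits the homomorphism property.\<close>
  have "map_poly h p = ev1 (\<lambda>c. [:h c:]) [:0, 1:] p" for p
  proof (induction p)
    case (pCons a p)
    then show ?case
      by (simp add: map_poly_pCons rhomD[OF h] ev1_pCons[OF rhom_comp[OF rhom_const_poly h]])
  qed (simp add: ev1_0)
  then show ?thesis
    using rhom_ev1[OF rhom_comp[OF rhom_const_poly h], of "[:0,1:]"]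
    by (metis (no_types, lifting) ext)
qed

lemma rhom_cx: "rhom cx"
  unfolding cx_def by (intro rhom_map_poly rhom_of_int)

lemma cx_gens: "cx vx = vx" "cx vy = vy" "cx vz = vz" "cx (const3 c) = const3 (of_int c)"
  unfolding cx_def vx_def vy_def vz_def const3_def
  by (simp_all add: map_poly_pCons one_pCons)

section \<open>Morphisms of affine hypersurfaces\<close>

lemma poly3_ring_simps [simp]:
  "carrier poly3_ring = UNIV" "x \<otimes>\<^bsub>poly3_ring\<^esub> y = x * y" "x \<oplus>\<^bsub>poly3_ring\<^esub> y = x + y"
  "\<one>\<^bsub>poly3_ring\<^esub> = 1" "\<zero>\<^bsub>poly3_ring\<^esub> = 0"
  by (simp_all add: ring_of_type_algebra_def)

lemma ideal_PIdl: "ideal (PIdl\<^bsub>poly3_ring\<^esub> f) (poly3_ring :: 'r::comm_ring_1 poly3 ring)"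
  by (rule cring.cgenideal_ideal) (auto intro: cring_from_type_algebra)

lemma PIdl_eq: "PIdl\<^bsub>poly3_ring\<^esub> f = {p. f dvd p}"
  unfolding cgenideal_def by (auto simp: dvd_def mult.commute)

lemma cls_alt: "cls f p = {q. f dvd q - p}"
  unfolding cls_def PIdl_eq a_r_coset_def' by (auto simp: algebra_simps)

lemma cls_eq_iff: "cls f p = cls f q \<longleftrightarrow> f dvd p - q"
proof
  assume "cls f p = cls f q"
  moreover have "p \<in> cls f p" by (simp add: cls_alt)
  ultimately show "f dvd p - q" by (simp add: cls_alt)
next
  assume *: "f dvd p - q"
  have "f dvd r - p \<longleftrightarrow> f dvd r - q" for r
    using dvd_add_right_iff[OF *, of "r - p"] by (simp add: add.commute algebra_simps)
  then show "cls f p = cls f q" by (simp add: cls_alt)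
qed

abbreviation coords :: "'r::comm_ring_1 poly3 \<Rightarrow> 'r poly3 set set" where
  "coords f \<equiv> carrier (coord_ring f)"

lemma carrier_coord: "coords f = range (cls f)"
  unfolding coord_ring_def FactRing_def A_RCOSETS_def' cls_def by auto

lemma cls_in [simp]: "cls f p \<in> coords f"
  by (simp add: carrier_coord)

lemma coord_ops:
  "cls f p \<otimes>\<^bsub>coord_ring f\<^esub> cls f q = cls f (p * q)"
  "cls f p \<oplus>\<^bsub>coord_ring f\<^esub> cls f q = cls f (p + q)"
  "\<one>\<^bsub>coord_ring f\<^esub> = cls f 1"
proof -
  interpret ideal "PIdl\<^bsub>poly3_ring\<^esub> f" "poly3_ring :: 'a poly3 ring"
    by (rule ideal_PIdl)
  show "cls f p \<otimes>\<^bsub>coord_ring f\<^esub> cls f q = cls f (p * q)"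
    using rcoset_mult_add[of p q] by (simp add: coord_ring_def FactRing_def cls_def)
  show "cls f p \<oplus>\<^bsub>coord_ring f\<^esub> cls f q = cls f (p + q)"
    using a_rcos_sum[of p q] by (simp add: coord_ring_def FactRing_def cls_def)
  show "\<one>\<^bsub>coord_ring f\<^esub> = cls f 1"
    by (simp add: coord_ring_def FactRing_def cls_def)
qed

lemma cls_exists: "u \<in> coords f \<Longrightarrow> \<exists>p. u = cls f p"
  by (auto simp: carrier_coord)

text \<open>\<open>given_by\<close> speaks of the three coordinates only. \<open>rep\<close> records
  a polynomial lift of the whole comorphism, so that composition and uniqueness become statements
  about substitution.\<close>

definition rep :: "'r::comm_ring_1 poly3 \<Rightarrow> 'r poly3 \<Rightarrow> ('r poly3 set \<Rightarrow> 'r poly3 set) \<Rightarrow>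
    'r poly3 \<Rightarrow> 'r poly3 \<Rightarrow> 'r poly3 \<Rightarrow> bool" where
  "rep f g \<phi> P Q T \<longleftrightarrow> \<phi> \<in> extensional (coords g) \<and>
     (\<forall>p. \<phi> (cls g p) = cls f (ev3 const3 P Q T p))"

lemma rep_imp_dvd:
  assumes "rep f g \<phi> P Q T"
  shows "f dvd ev3 const3 P Q T g"
proof -
  have "cls g g = cls g 0" by (simp add: cls_eq_iff)
  then have "cls f (ev3 const3 P Q T g) = cls f (ev3 const3 P Q T 0)"
    using assms unfolding rep_def by metis
  then show ?thesis by (simp add: cls_eq_iff rhomD[OF rhom_ev3[OF rhom_const3]])
qed

lemma rep_mor:
  assumes "rep f g \<phi> P Q T"
  shows "\<phi> \<in> mor f g" and "given_by f g \<phi> P Q T"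
proof -
  note e = rhomD[OF rhom_ev3[OF rhom_const3]] ev3_gens[OF rhom_const3]
  show "\<phi> \<in> mor f g"
    using assms unfolding mor_def rep_def
    by (auto simp: carrier_coord coord_ops e intro!: ring_hom_memI)
  show "given_by f g \<phi> P Q T"
    using assms unfolding rep_def given_by_def by (simp add: e)
qed

text \<open>A comorphism is determined by constants and coordinates; the induction climbs from
  polynomials in \<open>x\<close> to those in \<open>x, y\<close> and then to all.\<close>

lemma mor_rep:
  assumes \<phi>: "\<phi> \<in> mor f g" and gb: "given_by f g \<phi> P Q T"
  shows "rep f g \<phi> P Q T"
proof -
  have hom: "\<phi> \<in> ring_hom (coord_ring g) (coord_ring f)" and ext: "\<phi> \<in> extensional (coords g)"
    and c: "\<And>c. \<phi> (cls g (const3 c)) = cls f (const3 c)"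
    using \<phi> by (auto simp: mor_def)
  have m: "\<phi> (cls g (p * q)) = \<phi> (cls g p) \<otimes>\<^bsub>coord_ring f\<^esub> \<phi> (cls g q)"
    "\<phi> (cls g (p + q)) = \<phi> (cls g p) \<oplus>\<^bsub>coord_ring f\<^esub> \<phi> (cls g q)" for p q
    using ring_hom_mult[OF hom, of "cls g p" "cls g q"] ring_hom_add[OF hom, of "cls g p" "cls g q"]
    by (simp_all add: coord_ops)
  define G where "G p \<longleftrightarrow> \<phi> (cls g p) = cls f (ev3 const3 P Q T p)" for p
  note e = rhomD[OF rhom_ev3[OF rhom_const3]] ev3_gens[OF rhom_const3]
  have Gm: "G p \<Longrightarrow> G q \<Longrightarrow> G (p * q)" and Ga: "G p \<Longrightarrow> G q \<Longrightarrow> G (p + q)" for p q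
    by (auto simp: G_def m coord_ops e)
  have Gv: "G vx" "G vy" "G vz" and Gc: "\<And>c. G (const3 c)"
    using gb c unfolding G_def given_by_def by (auto simp: e)
  have G1: "G [:[:p:]:]" for p
  proof (induction p)
    case 0
    show ?case using Gc[of 0] by (simp add: const3_def)
  next
    case (pCons a p)
    have "[:[:pCons a p:]:] = const3 a + vx * [:[:p:]:]"
      by (simp add: const3_def vx_def)
    then show ?case using Ga Gm Gc Gv pCons by metis
  qed
  have G2: "G [:p:]" for p
  proof (induction p)
    case 0
    show ?case using Gc[of 0] by (simp add: const3_def)
  next
    case (pCons a p)
    have "[:pCons a p:] = [:[:a:]:] + vy * [:p:]"
      by (simp add: vy_def)
    then show ?case using Ga Gm G1 Gv pCons by metis
  qed
  have "G p" for p
  proof (induction p)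
    case 0
    show ?case using Gc[of 0] by (simp add: const3_def)
  next
    case (pCons a p)
    have "pCons a p = [:a:] + vz * p"
      by (simp add: vz_def)
    then show ?case using Ga Gm G2 Gv pCons by metis
  qed
  then show ?thesis using ext by (simp add: rep_def G_def)
qed

lemma mor_rep_ex:
  assumes "\<phi> \<in> mor f g"
  shows "\<exists>P Q T. rep f g \<phi> P Q T"
proof -
  have hom: "\<phi> \<in> ring_hom (coord_ring g) (coord_ring f)"
    using assms by (auto simp: mor_def)
  have "\<exists>P. \<phi> (cls g p) = cls f P" for p
    using cls_exists ring_hom_closed[OF hom cls_in] by blast
  then obtain P Q T where "given_by f g \<phi> P Q T"
    unfolding given_by_def by meson
  then show ?thesis using mor_rep[OF assms] by blast
qed

lemma rep_unique:
  assumes "rep f g \<phi> P Q T" "rep f g \<psi> P' Q' T'"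
    and "cls f P = cls f P'" "cls f Q = cls f Q'" "cls f T = cls f T'"
  shows "\<phi> = \<psi>"
proof -
  have "given_by f g \<psi> P Q T"
    using rep_mor(2)[OF assms(2)] assms(3-5) by (simp add: given_by_def)
  then have r: "rep f g \<psi> P Q T" using mor_rep rep_mor(1)[OF assms(2)] by blast
  show ?thesis
  proof (rule extensionalityI)
    show "\<phi> \<in> extensional (coords g)" "\<psi> \<in> extensional (coords g)"
      using assms(1,2) by (auto simp: rep_def)
    show "\<phi> u = \<psi> u" if "u \<in> coords g" for u
      using cls_exists[OF that] assms(1) r by (auto simp: rep_def)
  qed
qed

lemma rep_change:
  assumes "rep f g \<phi> P Q T" "cls f P = cls f P'" "cls f Q = cls f Q'" "cls f T = cls f T'"
  shows "rep f g \<phi> P' Q' T'"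
  using mor_rep[OF rep_mor(1)[OF assms(1)]] rep_mor(2)[OF assms(1)] assms(2-4)
  by (simp add: given_by_def)

text \<open>The hypothesis says that the substitution maps the ideal of \<open>g\<close> into that
  of \<open>f\<close>, so the choice of a representative of a class does not matter.\<close>

lemma rep_exists:
  assumes "f dvd ev3 const3 P Q T g"
  shows "\<exists>\<phi>. rep f g \<phi> P Q T"
proof -
  define \<phi> where "\<phi> = (\<lambda>u\<in>coords g. cls f (ev3 const3 P Q T (SOME p. u = cls g p)))"
  have "\<phi> (cls g p) = cls f (ev3 const3 P Q T p)" for p
  proof -
    define q where "q = (SOME q. cls g p = cls g q)"
    have "cls g p = cls g q" unfolding q_def by (rule someI) (rule refl)
    then have "g dvd q - p" by (metis cls_eq_iff)
    then have "ev3 const3 P Q T g dvd ev3 const3 P Q T (q - p)" by (intro ev3_dvd rhom_const3)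
    then have "f dvd ev3 const3 P Q T q - ev3 const3 P Q T p"
      using assms dvd_trans by (auto simp: rhomD[OF rhom_ev3[OF rhom_const3]])
    then show ?thesis by (simp add: \<phi>_def flip: q_def) (simp add: cls_eq_iff)
  qed
  then have "rep f g \<phi> P Q T" by (simp add: rep_def \<phi>_def)
  then show ?thesis by blast
qed

text \<open>The definite description in \<open>mor_of\<close> has a meaning only if a morphism with
  these coordinates exists and is unique; the divisibility supplies the existence.\<close>

lemma mor_of_rep:
  assumes "f dvd ev3 const3 P Q T g"
  shows "rep f g (mor_of f g P Q T) P Q T"
proof -
  obtain \<phi> where \<phi>: "rep f g \<phi> P Q T" using rep_exists[OF assms] by blast
  have "mor_of f g P Q T = \<phi>"
    unfolding mor_of_def
  proof (rule the_equality)
    show "\<phi> \<in> mor f g \<and> given_by f g \<phi> P Q T" using rep_mor[OF \<phi>] by simp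
    show "\<psi> = \<phi>" if "\<psi> \<in> mor f g \<and> given_by f g \<psi> P Q T" for \<psi>
      using that mor_rep rep_unique[OF _ \<phi>] by blast
  qed
  then show ?thesis using \<phi> by simp
qed

lemma rep_comp:
  assumes \<phi>: "rep f g \<phi> P Q T" and \<psi>: "rep g h \<psi> P' Q' T'"
  shows "rep f h (mor_comp h \<psi> \<phi>)
    (ev3 const3 P Q T P') (ev3 const3 P Q T Q') (ev3 const3 P Q T T')"
proof -
  have "mor_comp h \<psi> \<phi> (cls h p) = cls f (ev3 const3 (ev3 const3 P Q T P')
      (ev3 const3 P Q T Q') (ev3 const3 P Q T T') p)" for p
    using \<phi> \<psi> ev3_comp[OF rhom_ev3[OF rhom_const3] rhom_const3, of P Q T P' Q' T' p]
    by (simp add: rep_def mor_comp_def compose_def ev3_gens[OF rhom_const3])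
  then show ?thesis by (simp add: rep_def mor_comp_def compose_def)
qed

lemma rep_id: "rep f f (id_mor f) vx vy vz"
  by (simp add: rep_def id_mor_def ev3_id)

lemma isosI:
  assumes \<phi>: "\<phi> \<in> mor f g" and \<psi>: "\<psi> \<in> mor g f"
    and 1: "mor_comp g \<phi> \<psi> = id_mor g" and 2: "mor_comp f \<psi> \<phi> = id_mor f"
  shows "\<phi> \<in> isos f g"
proof -
  have "\<psi> (\<phi> u) = u" if "u \<in> coords g" for u
    using that fun_cong[OF 1, of u] by (simp add: mor_comp_def compose_def id_mor_def)
  moreover have "\<phi> (\<psi> u) = u" if "u \<in> coords f" for u
    using that fun_cong[OF 2, of u] by (simp add: mor_comp_def compose_def id_mor_def)
  moreover have "\<phi> \<in> coords g \<rightarrow> coords f"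
    "\<psi> \<in> coords f \<rightarrow> coords g"
    using \<phi> \<psi> by (auto simp: mor_def ring_hom_def)
  ultimately have "bij_betw \<phi> (coords g) (coords f)"
    by (intro bij_betwI[where g = \<psi>]) auto
  then show ?thesis using \<phi> by (simp add: isos_def mor_def ring_iso_def)
qed

lemma isos_comp:
  assumes "\<phi> \<in> isos f g" "\<psi> \<in> isos g h"
  shows "mor_comp h \<psi> \<phi> \<in> isos f h"
proof -
  have m: "\<phi> \<in> mor f g" "\<psi> \<in> mor g h" using assms by (auto simp: isos_def)
  then obtain P Q T P' Q' T' where r: "rep f g \<phi> P Q T" "rep g h \<psi> P' Q' T'"
    using mor_rep_ex by meson
  then have "mor_comp h \<psi> \<phi> \<in> mor f h"
    using rep_mor(1)[OF rep_comp] by blast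
  moreover have "bij_betw (compose (coords h) \<phi> \<psi>) (coords h) (coords f)"
    using assms by (intro bij_betw_compose[of \<psi> _ "coords g"]) (auto simp: isos_def ring_iso_def)
  ultimately show ?thesis by (simp add: isos_def mor_def ring_iso_def mor_comp_def)
qed

lemma isos_id: "id_mor f \<in> isos f f"
proof -
  have "mor_comp f (id_mor f) (id_mor f) = id_mor f"
    by (auto simp: mor_comp_def compose_def id_mor_def fun_eq_iff)
  then show ?thesis by (intro isosI[OF rep_mor(1)[OF rep_id] rep_mor(1)[OF rep_id]])
qed

text \<open>Bijectivity yields an inverse function, but a member of \<open>isos\<close> must also
  respect constants and be extensional. The inverse is therefore rebuilt from polynomial preimages
  \<open>s\<close> of the three coordinates.\<close>

lemma isos_inverse:
  assumes "\<phi> \<in> isos f g"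
  shows "\<exists>\<psi>\<in>isos g f. mor_comp g \<phi> \<psi> = id_mor g \<and> mor_comp f \<psi> \<phi> = id_mor f"
proof -
  have m: "\<phi> \<in> mor f g" and bij: "bij_betw \<phi> (coords g) (coords f)"
    using assms by (auto simp: isos_def ring_iso_def)
  obtain P Q T where r: "rep f g \<phi> P Q T" using mor_rep_ex[OF m] by blast
  define s where "s p = (SOME q. \<phi> (cls g q) = cls f p)" for p
  have s: "\<phi> (cls g (s p)) = cls f p" for p
  proof -
    have "cls f p \<in> \<phi> ` coords g"
      using bij by (simp add: bij_betw_def)
    then have "\<exists>q. \<phi> (cls g q) = cls f p" by (auto simp: carrier_coord)
    then show ?thesis unfolding s_def by (rule someI_ex)
  qed
  define e where "e = ev3 const3 P Q T"
  have e: "rhom e" unfolding e_def by (intro rhom_ev3 rhom_const3)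
  have es: "cls f (e (s p)) = cls f p" for p
    using s[of p] r by (simp add: rep_def e_def)
  define S where "S = ev3 const3 (s vx) (s vy) (s vz)"
  have S: "rhom S" unfolding S_def by (intro rhom_ev3 rhom_const3)
  have eS: "e (S p) = ev3 const3 (e (s vx)) (e (s vy)) (e (s vz)) p" for p
    unfolding S_def using ev3_comp[OF e rhom_const3, of "s vx" "s vy" "s vz" p]
    by (simp add: e_def ev3_gens[OF rhom_const3])
  have eS2: "cls f (e (S p)) = cls f p" for p
    using rep_change[OF rep_id, of f "e (s vx)" "e (s vy)" "e (s vz)"] es
    unfolding eS by (simp add: rep_def) (metis cls_in id_mor_def restrict_apply')
  have inj: "g dvd p" if "f dvd e p" for p
  proof -
    have "\<phi> (cls g p) = \<phi> (cls g 0)"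
      using that r by (simp add: rep_def cls_eq_iff flip: e_def) (simp add: rhomD[OF e])
    then have "cls g p = cls g 0" using bij by (auto simp: bij_betw_def inj_on_def)
    then show ?thesis by (simp add: cls_eq_iff)
  qed
  \<comment> \<open>That \<open>S\<close> descends to the quotient is seen after applying
    \<open>e\<close>, which is injective modulo the equations by \<open>inj\<close>.\<close>
  have "f dvd e (S f)" using eS2[of f] cls_eq_iff[of f "e (S f)" f]
    by (metis dvd_add_right_iff dvd_refl diff_add_cancel)
  then have "g dvd S f" by (rule inj)
  then obtain \<psi> where \<psi>: "rep g f \<psi> (s vx) (s vy) (s vz)"
    using rep_exists unfolding S_def by blast
  have Sp: "\<psi> (cls f p) = cls g (S p)" for p
    using \<psi> by (simp add: rep_def S_def)
  have ep: "\<phi> (cls g p) = cls f (e p)" for p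
    using r by (simp add: rep_def e_def)
  have "\<phi> (\<psi> (cls f p)) = cls f p" for p
    by (simp add: Sp ep eS2)
  then have 2: "mor_comp f \<psi> \<phi> = id_mor f"
    by (auto simp: mor_comp_def compose_def id_mor_def carrier_coord fun_eq_iff)
  have "cls g (S (e p)) = cls g p" for p
  proof -
    have "f dvd e (S (e p)) - e p" using eS2[of "e p"] by (simp add: cls_eq_iff)
    then have "f dvd e (S (e p) - p)" by (simp add: rhomD[OF e])
    then show ?thesis using inj by (simp add: cls_eq_iff)
  qed
  then have 1: "mor_comp g \<phi> \<psi> = id_mor g"
    by (auto simp: mor_comp_def compose_def id_mor_def carrier_coord Sp ep fun_eq_iff)
  have "\<psi> \<in> isos g f" by (rule isosI[OF rep_mor(1)[OF \<psi>] m 2 1])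
  then show ?thesis using 1 2 by blast
qed

lemma Aut_simps [simp]:
  "carrier (Aut f) = isos f f" "x \<otimes>\<^bsub>Aut f\<^esub> y = mor_comp f x y" "\<one>\<^bsub>Aut f\<^esub> = id_mor f"
  by (simp_all add: Aut_def)

lemma mor_comp_id:
  assumes "\<phi> \<in> mor f g"
  shows "mor_comp g (id_mor g) \<phi> = \<phi>" "mor_comp g \<phi> (id_mor f) = \<phi>"
proof -
  have "\<phi> \<in> coords g \<rightarrow> coords f"
    and "\<phi> \<in> extensional (coords g)"
    using assms by (auto simp: mor_def ring_hom_def)
  then show "mor_comp g (id_mor g) \<phi> = \<phi>" "mor_comp g \<phi> (id_mor f) = \<phi>"
    by (auto simp: mor_comp_def compose_def id_mor_def fun_eq_iff extensional_def)
qed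

lemma group_Aut: "group (Aut f)"
proof (rule groupI)
  fix x y z assume xyz: "x \<in> carrier (Aut f)" "y \<in> carrier (Aut f)" "z \<in> carrier (Aut f)"
  have "z \<in> coords f \<rightarrow> coords f"
    "y \<in> coords f \<rightarrow> coords f"
    "x \<in> coords f \<rightarrow> coords f"
    using xyz by (auto simp: isos_def mor_def ring_hom_def)
  then show "x \<otimes>\<^bsub>Aut f\<^esub> y \<otimes>\<^bsub>Aut f\<^esub> z = x \<otimes>\<^bsub>Aut f\<^esub> (y \<otimes>\<^bsub>Aut f\<^esub> z)"
    by (auto simp: mor_comp_def compose_def fun_eq_iff Pi_def)
next
  fix x assume "x \<in> carrier (Aut f)"
  then show "\<one>\<^bsub>Aut f\<^esub> \<otimes>\<^bsub>Aut f\<^esub> x = x"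
    using mor_comp_id[of x f f] by (simp add: isos_def)
  show "\<exists>y\<in>carrier (Aut f). y \<otimes>\<^bsub>Aut f\<^esub> x = \<one>\<^bsub>Aut f\<^esub>"
    using isos_inverse[of x f f] \<open>x \<in> carrier (Aut f)\<close> by (simp) blast
qed (auto intro: isos_comp isos_id)



section \<open>Laurent polynomials in two variables\<close>

text \<open>The exponent of the prime 5 is odd on the left and even on the right; this is the
  irrationality of sqrt 5 / 2.\<close>

lemma five_squares: "5 * i\<^sup>2 = 4 * j\<^sup>2 \<Longrightarrow> i = 0" for i j :: int
proof (rule ccontr)
  assume eq: "5 * i\<^sup>2 = 4 * j\<^sup>2" and i: "i \<noteq> 0"
  then have j: "j \<noteq> 0" by auto
  have p: "prime_elem (5::int)" by simp
  have "multiplicity 5 (5 * i\<^sup>2) = 1 + 2 * multiplicity 5 i"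
    using i p by (simp add: prime_elem_multiplicity_mult_distrib prime_elem_multiplicity_power_distrib)
  moreover have "multiplicity 5 (4 * j\<^sup>2) = 2 * multiplicity 5 j"
    using j p by (simp add: prime_elem_multiplicity_mult_distrib prime_elem_multiplicity_power_distrib
        not_dvd_imp_multiplicity_0)
  ultimately have "1 + 2 * multiplicity 5 i = 2 * multiplicity 5 j" using eq by simp
  then show False by presburger
qed

text \<open>Exponent vectors form a type of their own so that they can carry the linear group order
  induced by the weight.\<close>

datatype zz = ZZ (fx: int) (fy: int)

text \<open>The slope \<open>sqrt 5 / 2\<close> is irrational, so that the weight is injective, and it lies strictly
  between \<open>1\<close> and \<open>4 / 3\<close>.\<close>

definition wt :: "zz \<Rightarrow> real" where
  "wt e = of_int (fx e) * sqrt 5 + 2 * of_int (fy e)"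

lemma wt_inj: "wt e = wt e' \<longleftrightarrow> e = e'"
proof
  assume "wt e = wt e'"
  then have "of_int (fx e - fx e') * sqrt 5 = 2 * of_int (fy e' - fy e)"
    by (simp add: wt_def algebra_simps)
  then have "(of_int (fx e - fx e') * sqrt 5)\<^sup>2 = (2 * of_int (fy e' - fy e))\<^sup>2" by simp
  then have "5 * (of_int (fx e - fx e'))\<^sup>2 = (4 * (of_int (fy e' - fy e))\<^sup>2 :: real)"
    by (simp add: power_mult_distrib del: of_int_diff)
  then have "real_of_int (5 * (fx e - fx e')\<^sup>2) = real_of_int (4 * (fy e' - fy e)\<^sup>2)" by simp
  then have "5 * (fx e - fx e')\<^sup>2 = 4 * (fy e' - fy e)\<^sup>2" by (simp only: of_int_eq_iff)
  moreover from five_squares[OF this] have "fx e = fx e'" by simp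
  ultimately show "e = e'" by (simp add: zz.expand)
qed simp

instantiation zz :: linordered_ab_group_add
begin

definition "0 = ZZ 0 0"
definition "e + e' = ZZ (fx e + fx e') (fy e + fy e')"
definition "e - e' = ZZ (fx e - fx e') (fy e - fy e')"
definition "- e = ZZ (- fx e) (- fy e)"
definition "e \<le> e' \<longleftrightarrow> wt e \<le> wt e'"
definition "e < e' \<longleftrightarrow> wt e < wt e'"

instance
proof
  show "e \<le> e' \<Longrightarrow> e' \<le> e \<Longrightarrow> e = e'" for e e' :: zz
    using wt_inj by (simp add: less_eq_zz_def)
qed (auto simp: zero_zz_def plus_zz_def minus_zz_def uminus_zz_def less_eq_zz_def less_zz_def
    wt_def algebra_simps)

end

lemma zz_simps [simp]:
  "fx 0 = 0" "fy 0 = 0" "fx (e + e') = fx e + fx e'" "fy (e + e') = fy e + fy e'"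
  "fx (e - e') = fx e - fx e'" "fy (e - e') = fy e - fy e'" "fx (- e) = - fx e" "fy (- e) = - fy e"
  by (simp_all add: zero_zz_def plus_zz_def minus_zz_def uminus_zz_def)

lemma wt_simps: "wt 0 = 0" "wt (e + e') = wt e + wt e'"
  by (simp_all add: wt_def algebra_simps)

lemma zz_eq_iff: "e = e' \<longleftrightarrow> fx e = fx e' \<and> fy e = fy e'"
  by (auto simp: zz.expand)

type_synonym 'r lau = "zz \<Rightarrow>\<^sub>0 'r"

abbreviation lookup :: "'r::zero lau \<Rightarrow> zz \<Rightarrow> 'r" where "lookup \<equiv> Poly_Mapping.lookup"
abbreviation keys :: "'r::zero lau \<Rightarrow> zz set" where "keys \<equiv> Poly_Mapping.keys"
abbreviation mono :: "zz \<Rightarrow> 'r::zero \<Rightarrow> 'r lau" where "mono \<equiv> Poly_Mapping.single"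
abbreviation cst :: "'r::zero \<Rightarrow> 'r lau" where "cst \<equiv> Poly_Mapping.single 0"

lemma rhom_cst: "rhom (cst :: 'r::comm_ring_1 \<Rightarrow> 'r lau)"
  by (simp add: rhom_def single_add mult_single)

lemma lookup_mono_mult: "lookup (mono a c * g) e = c * lookup g (e - a)"
  for g :: "'r::comm_ring_1 lau"
proof -
  have "(e = a + q) = (e - a = q)" for q by (auto simp: algebra_simps)
  then show ?thesis
    by (simp add: lookup_mult lookup_single when_mult)
qed

lemma lau_induct [case_names 0 add]:
  assumes "P 0" "\<And>a c f. P f \<Longrightarrow> P (mono a c + f)"
  shows "P (f :: 'r::comm_ring_1 lau)"
proof (induction "card (keys f)" arbitrary: f rule: less_induct)
  case less
  show ?case
  proof (cases "f = 0")
    case False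
    then obtain a where a: "a \<in> keys f" by (metis keys_eq_empty all_not_in_conv)
    define g where "g = f - mono a (lookup f a)"
    have "keys g = keys f - {a}"
      by (auto simp: g_def in_keys_iff lookup_minus lookup_single when_def split: if_splits)
    then have "card (keys g) < card (keys f)"
      using card_Diff1_less[OF finite_keys a] by simp
    then have "P (mono a (lookup f a) + g)" using less assms(2) by blast
    then show ?thesis by (simp add: g_def)
  qed (use assms in simp)
qed

lemma keys_multE:
  assumes "e \<in> keys (f * g)"
  obtains a b where "a \<in> keys f" "b \<in> keys g" "e = a + b"
  using subsetD[OF keys_mult assms] that by auto

section \<open>Leading exponents and largest weights\<close>

definition lexp :: "'r::zero lau \<Rightarrow> zz" where "lexp f = Max (keys f)"
text \<open>The largest weight is taken, so this is a degree function, the negative of a valuation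
  in the usual sense: sums are bounded from above and nonzero constants have value 0.\<close>

definition val :: "'r::zero lau \<Rightarrow> real" where "val f = wt (lexp f)"

lemma lexp_in: "f \<noteq> 0 \<Longrightarrow> lexp f \<in> keys f"
  unfolding lexp_def by (intro Max_in) auto

lemma lexp_ge: "e \<in> keys f \<Longrightarrow> e \<le> lexp f"
  unfolding lexp_def by simp

lemma val_ge: "e \<in> keys f \<Longrightarrow> wt e \<le> val f"
  using lexp_ge unfolding val_def less_eq_zz_def .

lemma lexpI: "e \<in> keys f \<Longrightarrow> (\<And>e'. e' \<in> keys f \<Longrightarrow> e' \<le> e) \<Longrightarrow> lexp f = e"
  unfolding lexp_def by (intro Max_eqI) auto

text \<open>\<open>p\<close> and \<open>q\<close> merely bound the supports, and the coefficients
  there may vanish. The bracket calls for this form because a derivation can kill a leading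
  term.\<close>

lemma lookup_mult_max:
  fixes f g :: "'r::comm_ring_1 lau"
  assumes f: "\<And>e. e \<in> keys f \<Longrightarrow> e \<le> p" and g: "\<And>e. e \<in> keys g \<Longrightarrow> e \<le> q"
  shows "lookup (f * g) (p + q) = lookup f p * lookup g q"
proof -
  define f' where "f' = f - mono p (lookup f p)"
  have "e < p" if "e \<in> keys f'" for e
    using that f[of e] unfolding f'_def
    by (auto simp: in_keys_iff lookup_minus lookup_single when_def order_less_le split: if_splits)
  then have "a + b < p + q" if "a \<in> keys f'" "b \<in> keys g" for a b
    using that g by (intro add_less_le_mono) auto
  then have "p + q \<notin> keys (f' * g)"
    by (metis keys_multE less_irrefl)
  then have "lookup (f' * g) (p + q) = 0" by (simp add: in_keys_iff)
  moreover have "f * g = mono p (lookup f p) * g + f' * g" by (simp add: f'_def algebra_simps)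
  ultimately show ?thesis by (simp add: lookup_add lookup_mono_mult)
qed

lemma keys_mult_le:
  fixes f g :: "'r::comm_ring_1 lau"
  assumes "\<And>e. e \<in> keys f \<Longrightarrow> e \<le> p" "\<And>e. e \<in> keys g \<Longrightarrow> e \<le> q" "e \<in> keys (f * g)"
  shows "e \<le> p + q"
proof -
  obtain a b where "a \<in> keys f" "b \<in> keys g" "e = a + b"
    using keys_multE[OF assms(3)] .
  then show ?thesis using assms(1,2) add_mono by blast
qed

lemma lexp_mult:
  fixes f g :: "'r::idom lau"
  assumes "f \<noteq> 0" "g \<noteq> 0"
  shows "lexp (f * g) = lexp f + lexp g"
proof (rule lexpI)
  show "lexp f + lexp g \<in> keys (f * g)"
    using lookup_mult_max[of f "lexp f" g "lexp g"] lexp_ge[of _ f] lexp_ge[of _ g]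
      lexp_in[OF assms(1)] lexp_in[OF assms(2)] by (simp add: in_keys_iff)
  show "e \<le> lexp f + lexp g" if "e \<in> keys (f * g)" for e
    using keys_mult_le[OF lexp_ge lexp_ge that] .
qed

lemma val_mult: "f \<noteq> 0 \<Longrightarrow> g \<noteq> 0 \<Longrightarrow> val (f * g) = val f + val g" for f g :: "'r::idom lau"
  by (simp add: val_def lexp_mult wt_simps)

lemma lexp_mono: "c \<noteq> 0 \<Longrightarrow> lexp (mono e c) = e"
  by (rule lexpI) auto

lemma val_mono: "c \<noteq> 0 \<Longrightarrow> val (mono e c) = wt e"
  by (simp add: val_def lexp_mono)

lemma val_cst: "c \<noteq> 0 \<Longrightarrow> val (cst c) = 0"
  by (simp add: val_mono wt_simps)

lemma val_1 [simp]: "val (1 :: 'r::zero_neq_one lau) = 0"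
  using val_cst[of "1 :: 'r"] by simp

lemma val_power: "f \<noteq> 0 \<Longrightarrow> val (f ^ n) = n * val f" for f :: "'r::idom lau"
  by (induction n) (simp_all add: val_mult algebra_simps)

text \<open>The value of \<open>0\<close> is a junk value, hence the disjunctions below.\<close>

lemma lexp_add:
  fixes f g :: "'r::comm_ring_1 lau"
  assumes "f \<noteq> 0" "g = 0 \<or> val g < val f"
  shows "f + g \<noteq> 0" "lexp (f + g) = lexp f"
proof -
  have k: "e \<in> keys g \<Longrightarrow> e < lexp f" for e
    using assms(2) lexp_ge[of e g] by (auto simp: val_def less_zz_def less_eq_zz_def)
  then have "lexp f \<notin> keys g" by blast
  then have in_k: "lexp f \<in> keys (f + g)"
    using lexp_in[OF assms(1)] by (simp add: in_keys_iff lookup_add)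
  then show "f + g \<noteq> 0" by auto
  show "lexp (f + g) = lexp f"
  proof (rule lexpI[OF in_k])
    show "e \<le> lexp f" if "e \<in> keys (f + g)" for e
      using that keys_add[of f g] k lexp_ge[of e f] by (auto intro: less_imp_le)
  qed
qed

lemma val_add:
  fixes f g :: "'r::comm_ring_1 lau"
  assumes "f \<noteq> 0" "g = 0 \<or> val g < val f"
  shows "f + g \<noteq> 0" "val (f + g) = val f"
  using lexp_add[OF assms] by (simp_all add: val_def)

lemma val_add_le:
  fixes f g :: "'r::comm_ring_1 lau"
  assumes "f = 0 \<or> val f \<le> B" "g = 0 \<or> val g \<le> B"
  shows "f + g = 0 \<or> val (f + g) \<le> B"
proof (cases "f + g = 0")
  case False
  then have "lexp (f + g) \<in> keys f \<union> keys g"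
    using lexp_in[OF False] keys_add[of f g] by (rule_tac subsetD)
  then show ?thesis
  proof
    assume k: "lexp (f + g) \<in> keys f"
    then have "f \<noteq> 0" by auto
    then show ?thesis using val_ge[OF k] assms(1) by (simp add: val_def)
  next
    assume k: "lexp (f + g) \<in> keys g"
    then have "g \<noteq> 0" by auto
    then show ?thesis using val_ge[OF k] assms(2) by (simp add: val_def)
  qed
qed simp

text \<open>Terms of pairwise different value cannot cancel, so the term of largest value
  survives.\<close>

lemma val_sum_distinct:
  fixes g :: "'i \<Rightarrow> 'r::comm_ring_1 lau"
  assumes "finite I" "I \<noteq> {}" "\<And>i. i \<in> I \<Longrightarrow> g i \<noteq> 0" "inj_on (\<lambda>i. val (g i)) I"
  shows "sum g I \<noteq> 0 \<and> val (sum g I) \<in> (\<lambda>i. val (g i)) ` I \<and> (\<forall>i\<in>I. val (g i) \<le> val (sum g I))"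
  using assms
proof (induction I rule: finite_ne_induct)
  case (insert i I)
  have "inj_on (\<lambda>i. val (g i)) I" using insert.prems(2) by (rule inj_on_subset) auto
  then have IH: "sum g I \<noteq> 0" "val (sum g I) \<in> (\<lambda>i. val (g i)) ` I" "\<forall>i\<in>I. val (g i) \<le> val (sum g I)"
    using insert.IH insert.prems(1) by auto
  have ne: "val (g i) \<noteq> val (sum g I)"
  proof
    assume "val (g i) = val (sum g I)"
    then obtain j where "j \<in> I" "val (g i) = val (g j)" using IH(2) by auto
    then show False using inj_onD[OF insert.prems(2), of i j] insert.hyps by simp
  qed
  show ?case
  proof (cases "val (g i) < val (sum g I)")
    case True
    note v = val_add[OF IH(1) disjI2[OF True]]
    have "sum g (insert i I) = sum g I + g i" using insert.hyps by (simp add: add.commute)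
    then show ?thesis using v IH(2,3) True by auto
  next
    case False
    then have lt: "val (sum g I) < val (g i)" using ne by simp
    have gi: "g i \<noteq> 0" using insert.prems by simp
    note v = val_add[OF gi disjI2[OF lt]]
    have "val (g j) \<le> val (g i)" if "j \<in> I" for j
      using IH(3) that lt by (meson less_imp_le order_trans)
    then show ?thesis using v insert.hyps by simp
  qed
qed simp

section \<open>Polynomials in two elements with independent leading exponents\<close>

definition indep :: "zz \<Rightarrow> zz \<Rightarrow> bool" where
  "indep p q \<longleftrightarrow> fx p * fy q \<noteq> fy p * fx q"

text \<open>As \<open>wt\<close> is injective, equal weights mean equal exponent vectors; Cramer's
  rule then separates the coefficients.\<close>

lemma indep_inj:
  assumes "indep p q" "of_int i * wt p + of_int j * wt q = of_int i' * wt p + of_int j' * wt q"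
  shows "i = i'" "j = j'"
proof -
  have w: "wt (ZZ (k * fx p + l * fx q) (k * fy p + l * fy q)) = of_int k * wt p + of_int l * wt q" for k l
    by (simp add: wt_def algebra_simps)
  have "ZZ (i * fx p + j * fx q) (i * fy p + j * fy q) = ZZ (i' * fx p + j' * fx q) (i' * fy p + j' * fy q)"
    using assms(2) unfolding w[symmetric] wt_inj .
  then have e: "(i - i') * fx p + (j - j') * fx q = 0" "(i - i') * fy p + (j - j') * fy q = 0"
    by (simp_all add: algebra_simps)
  have "(i - i') * (fx p * fy q - fy p * fx q) =
      ((i - i') * fx p + (j - j') * fx q) * fy q - ((i - i') * fy p + (j - j') * fy q) * fx q"
    "(j - j') * (fx p * fy q - fy p * fx q) =
      ((i - i') * fy p + (j - j') * fy q) * fx p - ((i - i') * fx p + (j - j') * fx q) * fy p"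
    by (simp_all add: algebra_simps)
  then show "i = i'" "j = j'" using assms(1) unfolding e by (simp_all add: indep_def)
qed

lemma ev1_sum:
  assumes h: "rhom h" and p: "Polynomial.degree p \<le> n"
  shows "ev1 h u p = (\<Sum>i\<le>n. h (poly.coeff p i) * u ^ i)"
proof -
  have c: "poly.coeff (map_poly h p) i = h (poly.coeff p i)" for i
    by (simp add: coeff_map_poly rhomD[OF h])
  then have "Polynomial.degree (map_poly h p) \<le> n"
    using p by (intro degree_le) (auto simp: coeff_eq_0 rhomD[OF h])
  then have "(\<Sum>i\<le>Polynomial.degree (map_poly h p). poly.coeff (map_poly h p) i * u ^ i) =
      (\<Sum>i\<le>n. poly.coeff (map_poly h p) i * u ^ i)"
    by (intro sum.mono_neutral_left) (auto simp: coeff_eq_0)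
  then show ?thesis
    unfolding ev1_def poly_altdef c .
qed

lemma ev2_sum:
  assumes h: "rhom h"
  shows "\<exists>n. {(i, j). poly.coeff (poly.coeff H j) i \<noteq> 0} \<subseteq> {..n} \<times> {..n} \<and>
    ev2 h u v H = (\<Sum>(i, j)\<in>{..n} \<times> {..n}. h (poly.coeff (poly.coeff H j) i) * u ^ i * v ^ j)"
proof -
  define n where "n = max (Polynomial.degree H) (Max ((\<lambda>j. Polynomial.degree (poly.coeff H j)) ` {..degree H}))"
  have n: "Polynomial.degree (poly.coeff H j) \<le> n" for j
  proof (cases "j \<le> Polynomial.degree H")
    case True
    then have "Polynomial.degree (poly.coeff H j) \<le> Max ((\<lambda>j. Polynomial.degree (poly.coeff H j)) ` {..degree H})" by simp
    then show ?thesis by (simp add: n_def)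
  qed (simp add: coeff_eq_0)
  have "Polynomial.degree H \<le> n" by (simp add: n_def)
  have in_n: "(i, j) \<in> {..n} \<times> {..n}" if "poly.coeff (poly.coeff H j) i \<noteq> 0" for i j
    using le_degree[OF that] n[of j] \<open>Polynomial.degree H \<le> n\<close> that le_degree[of H j] by fastforce
  have "ev2 h u v H = (\<Sum>j\<le>n. (\<Sum>i\<le>n. h (poly.coeff (poly.coeff H j) i) * u ^ i) * v ^ j)"
    unfolding ev2_def ev1_sum[OF rhom_ev1[OF h] \<open>Polynomial.degree H \<le> n\<close>] ev1_sum[OF h n] ..
  also have "\<dots> = (\<Sum>(i, j)\<in>{..n} \<times> {..n}. h (poly.coeff (poly.coeff H j) i) * u ^ i * v ^ j)"
    unfolding sum_distrib_right by (subst sum.swap) (simp add: sum.cartesian_product)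
  finally have *: "ev2 h u v H = \<dots>" .
  have "{(i, j). poly.coeff (poly.coeff H j) i \<noteq> 0} \<subseteq> {..n} \<times> {..n}"
    using in_n by (rule_tac subsetI) (clarify, blast)
  then show ?thesis using * by blast
qed

lemma ev2_supp:
  fixes H :: "'a::comm_ring_1 poly poly" and h :: "'a \<Rightarrow> 'b::comm_ring_1"
  assumes h: "rhom h"
  defines "S \<equiv> {(i, j). poly.coeff (poly.coeff H j) i \<noteq> 0}"
  shows "finite (S)" "ev2 h u v H = (\<Sum>(i, j)\<in>S. h (poly.coeff (poly.coeff H j) i) * u ^ i * v ^ j)"
proof -
  obtain n where n: "{(i, j). poly.coeff (poly.coeff H j) i \<noteq> 0} \<subseteq> {..n} \<times> {..n}"
    "ev2 h u v H = (\<Sum>(i, j)\<in>{..n} \<times> {..n}. h (poly.coeff (poly.coeff H j) i) * u ^ i * v ^ j)"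
    using ev2_sum[OF h, of H u v] by (elim exE conjE) (rule that)
  note * = n(1)[folded S_def] n(2)
  show "finite (S)" using finite_subset[OF *(1)] by simp
  show "ev2 h u v H = (\<Sum>(i, j)\<in>S. h (poly.coeff (poly.coeff H j) i) * u ^ i * v ^ j)"
    unfolding *(2) by (rule sum.mono_neutral_right[OF _ *(1)]) (auto simp: rhomD(1)[OF h] S_def)
qed

text \<open>By independence the monomials in \<open>U\<close> and \<open>V\<close> have pairwise
  different values, so nothing cancels. In particular \<open>U\<close> and \<open>V\<close> are
  algebraically independent.\<close>

lemma val_ev2:
  fixes U V :: "'r::idom lau"
  assumes U: "U \<noteq> 0" and V: "V \<noteq> 0" and ind: "indep (lexp U) (lexp V)" and H: "H \<noteq> 0"
  shows "ev2 cst U V H \<noteq> 0"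
    and "poly.coeff (poly.coeff H j) i \<noteq> 0 \<Longrightarrow> real i * val U + real j * val V \<le> val (ev2 cst U V H)"
proof -
  define S where "S = {(i, j). poly.coeff (poly.coeff H j) i \<noteq> 0}"
  define g where "g = (\<lambda>(i, j). cst (poly.coeff (poly.coeff H j) i) * U ^ i * V ^ j)"
  have S: "finite S" "ev2 cst U V H = sum g S"
    using ev2_supp(1)[OF rhom_cst, where H = H] ev2_supp(2)[OF rhom_cst, where H = H and u = U and v = V] by (simp_all add: S_def g_def)
  have g0: "g s \<noteq> 0" if "s \<in> S" for s
    using that U V by (auto simp: S_def g_def) (metis lookup_single_eq lookup_zero)+
  have vg: "val (g (i, j)) = real i * val U + real j * val V" if "(i, j) \<in> S" for i j
  proof -
    define c where "c = cst (poly.coeff (poly.coeff H j) i)"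
    have c: "c \<noteq> 0" "val c = 0"
      using that g0[OF that] by (auto simp: S_def g_def c_def val_cst)
    have "g (i, j) = c * (U ^ i * V ^ j)" by (simp add: g_def c_def mult.assoc)
    then show ?thesis
      using c U V by (simp add: val_mult val_power)
  qed
  have inj: "inj_on (\<lambda>s. val (g s)) S"
  proof (rule inj_onI, clarify)
    fix i j i' j' assume s: "(i, j) \<in> S" "(i', j') \<in> S" "val (g (i, j)) = val (g (i', j'))"
    then have "of_int (int i) * wt (lexp U) + of_int (int j) * wt (lexp V) =
        of_int (int i') * wt (lexp U) + of_int (int j') * wt (lexp V)"
      using vg by (simp add: val_def)
    from indep_inj[OF ind this] show "i = i' \<and> j = j'" by simp
  qed
  obtain j where "poly.coeff H j \<noteq> 0" using H by (metis leading_coeff_0_iff)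
  then obtain i where "poly.coeff (poly.coeff H j) i \<noteq> 0" by (metis leading_coeff_0_iff)
  then have "S \<noteq> {}" by (auto simp: S_def)
  from val_sum_distinct[OF S(1) this g0 inj] have
    *: "sum g S \<noteq> 0" "\<And>s. s \<in> S \<Longrightarrow> val (g s) \<le> val (sum g S)" by auto
  show "ev2 cst U V H \<noteq> 0" using * S(2) by simp
  show "poly.coeff (poly.coeff H j) i \<noteq> 0 \<Longrightarrow> real i * val U + real j * val V \<le> val (ev2 cst U V H)" for i j
    using *(2)[of "(i, j)"] vg[of i j] by (simp add: S(2) S_def)
qed

subsection \<open>The logarithmic Poisson bracket\<close>

text \<open>With \<open>w = fx\<close> and \<open>w = fy\<close> these are the Euler derivations x
  d/dx and y d/dy.\<close>

definition D :: "(zz \<Rightarrow> int) \<Rightarrow> 'r::comm_ring_1 lau \<Rightarrow> 'r lau" where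
  "D w f = Poly_Mapping.mapp (\<lambda>k c. of_int (w k) * c) f"

lemma lookup_D: "lookup (D w f) e = of_int (w e) * lookup f e"
  by (auto simp: D_def lookup_mapp when_def in_keys_iff)

lemma D_add: "D w (f + g) = D w f + D w g"
  by (rule poly_mapping_eqI) (simp add: lookup_D lookup_add algebra_simps)

lemma D_0: "D w 0 = 0"
  by (rule poly_mapping_eqI) (simp add: lookup_D)

lemma D_mono: "D w (mono a c) = mono a (of_int (w a) * c)"
  by (rule poly_mapping_eqI) (simp add: lookup_D lookup_single when_def)

lemma D_mult:
  assumes w: "\<And>a b. w (a + b) = w a + w b"
  shows "D w (f * g) = D w f * g + f * D w g"
proof (induction f rule: lau_induct)
  case (add a c f)
  have "D w (mono a c * g) = D w (mono a c) * g + mono a c * D w g"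
  proof (rule poly_mapping_eqI)
    fix e
    have "w e = w a + w (e - a)" using w[of a "e - a"] by simp
    then show "lookup (D w (mono a c * g)) e = lookup (D w (mono a c) * g + mono a c * D w g) e"
      by (simp add: lookup_D lookup_add lookup_mono_mult D_mono distrib_right distrib_left mult.assoc mult.left_commute)
  qed
  then show ?case using add by (simp add: D_add algebra_simps)
qed (simp add: D_0)

text \<open>The Poisson bracket with {x, y} = xy. Divided by \<open>f g\<close> it is the Jacobian
  of log f and log g with respect to log x and log y.\<close>

definition pb :: "'r::comm_ring_1 lau \<Rightarrow> 'r lau \<Rightarrow> 'r lau" where
  "pb f g = D fx f * D fy g - D fy f * D fx g"

lemma pb_simps:
  "pb f f = 0" "pb (f + g) h = pb f h + pb g h"
  "pb (f * g) h = f * pb g h + g * pb f h" "pb (cst c) h = 0" "pb 0 h = 0"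
  by (simp_all add: pb_def D_add D_mult D_mono D_0 algebra_simps)

lemma pb_swap: "pb g f = - pb f g"
  by (simp add: pb_def)

text \<open>The sum of the leading exponents bounds the support of the bracket, and the coefficient
  there carries the determinant of \<open>indep\<close>. So independence follows once this
  coefficient is known not to vanish.\<close>

lemma lookup_pb:
  assumes "f \<noteq> 0" "g \<noteq> (0 :: 'r::comm_ring_1 lau)"
  shows "lookup (pb f g) (lexp f + lexp g) =
      of_int (fx (lexp f) * fy (lexp g) - fy (lexp f) * fx (lexp g)) *
      (lookup f (lexp f) * lookup g (lexp g))"
    and "e \<in> keys (pb f g) \<Longrightarrow> e \<le> lexp f + lexp g"
proof -
  have k: "e \<in> keys (D w h) \<Longrightarrow> e \<le> lexp h" for w h and e
    by (rule lexp_ge) (auto simp: in_keys_iff lookup_D)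
  show "lookup (pb f g) (lexp f + lexp g) =
      of_int (fx (lexp f) * fy (lexp g) - fy (lexp f) * fx (lexp g)) *
      (lookup f (lexp f) * lookup g (lexp g))"
  proof -
    have m: "lookup (D w f * D w' g) (lexp f + lexp g) =
        lookup (D w f) (lexp f) * lookup (D w' g) (lexp g)" for w w'
      by (rule lookup_mult_max) (erule k)+
    show ?thesis unfolding pb_def lookup_minus m lookup_D by (simp add: algebra_simps)
  qed
  show "e \<in> keys (pb f g) \<Longrightarrow> e \<le> lexp f + lexp g"
  proof -
    assume "e \<in> keys (pb f g)"
    then have "e \<in> keys (D fx f * D fy g) \<union> keys (D fy f * D fx g)"
      unfolding pb_def by (rule subsetD[OF keys_diff])
    then show "e \<le> lexp f + lexp g"
      by (elim UnE) (erule keys_mult_le[OF k k, rotated 2]; assumption)+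
  qed
qed



section \<open>The surfaces\<close>

text \<open>A pair \<open>p\<close> stands for the cubic with coefficients \<open>1, fst p, snd p, 1\<close>.\<close>

definition qd :: "('a \<Rightarrow> 'b::comm_ring_1) \<Rightarrow> 'a \<times> 'a \<Rightarrow> 'b \<Rightarrow> 'b" where
  "qd h p u = u\<^sup>2 + h (snd p) * u + h (fst p)"

definition cub :: "('a \<Rightarrow> 'b::comm_ring_1) \<Rightarrow> 'a \<times> 'a \<Rightarrow> 'b \<Rightarrow> 'b" where
  "cub h p u = u * qd h p u + 1"

definition rel :: "('a \<Rightarrow> 'b::comm_ring_1) \<Rightarrow> 'a \<times> 'a \<Rightarrow> 'a \<times> 'a \<Rightarrow> 'b \<Rightarrow> 'b \<Rightarrow> 'b \<Rightarrow> bool" where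
  "rel h p q u v w \<longleftrightarrow> u * v * w = cub h p u + cub h q v - 1"

definition srf :: "'r::comm_ring_1 \<times> 'r \<Rightarrow> 'r \<times> 'r \<Rightarrow> 'r poly3" where
  "srf p q = vx * vy * vz - (cub const3 p vx + cub const3 q vy - 1)"

lemma qd_hom: "rhom g \<Longrightarrow> g (qd h p u) = qd (\<lambda>c. g (h c)) p (g u)"
  and cub_hom: "rhom g \<Longrightarrow> g (cub h p u) = cub (\<lambda>c. g (h c)) p (g u)"
  by (simp_all add: cub_def qd_def rhomD)

lemma srf_hom: "rhom g \<Longrightarrow> g (srf p q) =
    g vx * g vy * g vz - (cub (\<lambda>c. g (const3 c)) p (g vx) + cub (\<lambda>c. g (const3 c)) q (g vy) - 1)"
  by (simp add: srf_def cub_hom rhomD)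

lemma ev3_srf: "rhom h \<Longrightarrow> ev3 h u v w (srf p q) = u * v * w - (cub h p u + cub h q v - 1)"
  by (simp add: srf_hom[OF rhom_ev3] ev3_gens)

lemma rel_iff: "rhom h \<Longrightarrow> rel h p q u v w \<longleftrightarrow> ev3 h u v w (srf p q) = 0"
  by (auto simp: rel_def ev3_srf)

lemma rel_swap: "rel h p q u v w \<longleftrightarrow> rel h q p v u w"
  by (simp add: rel_def ac_simps)

text \<open>The first coordinate of \<open>sigma_y\<close>, and the partner of \<open>u\<close> in
  the exchange relation \<open>mutx_mult\<close>: up to division it is
  \<open>cub h q v / u\<close>.\<close>

definition mutx :: "('a \<Rightarrow> 'b::comm_ring_1) \<Rightarrow> 'a \<times> 'a \<Rightarrow> 'b \<Rightarrow> 'b \<Rightarrow> 'b \<Rightarrow> 'b" where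
  "mutx h p u v w = v * w - qd h p u"

lemma mutx_mult: "rel h p q u v w \<Longrightarrow> u * mutx h p u v w = cub h q v"
  by (simp add: rel_def mutx_def cub_def algebra_simps)

text \<open>Replaces an induction over three polynomial layers whenever a property of all regular
  functions is checked on generators.\<close>

lemma ev3_closed:
  assumes h: "rhom h" and c: "\<And>c. h c \<in> S" and g: "u \<in> S" "v \<in> S" "w \<in> S"
    and add: "\<And>f g. f \<in> S \<Longrightarrow> g \<in> S \<Longrightarrow> f + g \<in> S"
    and mult: "\<And>f g. f \<in> S \<Longrightarrow> g \<in> S \<Longrightarrow> f * g \<in> S"
  shows "ev3 h u v w P \<in> S"
proof -
  have z: "0 \<in> S" using c[of 0] rhomD(1)[OF h] by simp
  have 1: "ev1 h u p \<in> S" for p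
    by (induction p) (auto simp: ev1_0 ev1_pCons[OF h] z intro!: add mult c g)
  have 2: "ev2 h u v p \<in> S" for p
    unfolding ev2_def
    by (induction p) (auto simp: ev1_0 ev1_pCons[OF rhom_ev1[OF h]] z intro!: add mult 1 g)
  show ?thesis
    unfolding ev3_def
    by (induction P) (auto simp: ev1_0 ev1_pCons[OF rhom_ev2[OF h]] z intro!: add mult 2 g)
qed

lemma ev1_cong_dvd:
  assumes "rhom h" "rhom h'" "\<And>a. d dvd h a - h' a" "d dvd u - u'"
  shows "d dvd ev1 h u p - ev1 h' u' p"
proof (induction p)
  case (pCons a p)
  have "d dvd (h a - h' a) + (u - u') * ev1 h u p + u' * (ev1 h u p - ev1 h' u' p)"
    by (intro dvd_add assms dvd_mult pCons.IH dvd_mult2)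
  also have "\<dots> = ev1 h u (pCons a p) - ev1 h' u' (pCons a p)"
    using assms by (simp add: ev1_pCons algebra_simps)
  finally show ?case .
qed (simp add: ev1_0)

lemma ev3_cong_dvd:
  assumes "rhom h" "d dvd u - u'" "d dvd v - v'" "d dvd w - w'"
  shows "d dvd ev3 h u v w P - ev3 h u' v' w' P"
  unfolding ev3_def ev2_def using assms
  by (intro ev1_cong_dvd rhom_ev1) auto

section \<open>Elimination of \<open>z\<close> and the embedding of the coordinate ring\<close>

lemma vx_dvd_iff: "vx dvd P \<longleftrightarrow> ev3 const3 0 vy vz P = 0"
proof
  assume "vx dvd P"
  from ev3_dvd[OF rhom_const3 this, of 0 vy vz] show "ev3 const3 0 vy vz P = 0"
    by (simp add: ev3_gens[OF rhom_const3])
next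
  assume "ev3 const3 0 vy vz P = 0"
  then show "vx dvd P"
    using ev3_cong_dvd[OF rhom_const3, of vx vx 0 vy vy vz vz P] by (simp add: ev3_id)
qed

lemma vy_dvd_iff: "vy dvd P \<longleftrightarrow> ev3 const3 vx 0 vz P = 0"
proof
  assume "vy dvd P"
  from ev3_dvd[OF rhom_const3 this, of vx 0 vz] show "ev3 const3 vx 0 vz P = 0"
    by (simp add: ev3_gens[OF rhom_const3])
next
  assume "ev3 const3 vx 0 vz P = 0"
  then show "vy dvd P"
    using ev3_cong_dvd[OF rhom_const3, of vy vx vx vy 0 vz vz P] by (simp add: ev3_id)
qed

lemma cub_var_nonzero: "cub const3 q vx \<noteq> 0" "cub const3 q vy \<noteq> 0"
  for q :: "'r::idom \<times> 'r"
proof -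
  have "ev3 const3 0 0 0 (cub const3 q vx) = 1" "ev3 const3 0 0 0 (cub const3 q vy) = 1"
    by (simp_all add: cub_hom[OF rhom_ev3[OF rhom_const3]] ev3_gens[OF rhom_const3])
       (simp_all add: cub_def)
  then show "cub const3 q vx \<noteq> 0" "cub const3 q vy \<noteq> 0"
    by (auto simp: rhomD[OF rhom_ev3[OF rhom_const3]])
qed

text \<open>At \<open>x = 0\<close> the equation becomes \<open>- cub q y\<close>, a nonzero
  polynomial because the cubic has constant term 1; hence \<open>x\<close> divides the cofactor and
  can be cancelled. The argument for \<open>y\<close> is symmetric.\<close>

lemma srf_dvd_cancel:
  fixes P :: "'r::idom poly3"
  shows "srf p q dvd vx * P \<Longrightarrow> srf p q dvd P" "srf p q dvd vy * P \<Longrightarrow> srf p q dvd P"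
proof -
  note r = rhomD[OF rhom_ev3[OF rhom_const3]] and s = ev3_srf[OF rhom_const3]
    and g = ev3_gens[OF rhom_const3]
  have v: "vx \<noteq> (0::'r poly3)" "vy \<noteq> (0::'r poly3)" by (simp_all add: vx_def vy_def)
  show "srf p q dvd P" if d: "srf p q dvd vx * P"
  proof -
    obtain Q where Q: "vx * P = srf p q * Q" using d by (rule dvdE)
    have "ev3 const3 0 vy vz (srf p q * Q) = 0" unfolding Q[symmetric] by (simp add: r g)
    then have "vx dvd Q" unfolding vx_dvd_iff
      using cub_var_nonzero[of q] by (simp add: r s) (simp add: cub_def add.commute)
    then show ?thesis using Q v by (auto simp: dvd_def mult.left_commute)
  qed
  show "srf p q dvd P" if d: "srf p q dvd vy * P"
  proof -
    obtain Q where Q: "vy * P = srf p q * Q" using d by (rule dvdE)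
    have "ev3 const3 vx 0 vz (srf p q * Q) = 0" unfolding Q[symmetric] by (simp add: r g)
    then have "vy dvd Q" unfolding vy_dvd_iff
      using cub_var_nonzero[of p] by (simp add: r s) (simp add: cub_def add.commute)
    then show ?thesis using Q v by (auto simp: dvd_def mult.left_commute)
  qed
qed

lemma srf_dvd_cancel_power:
  fixes P :: "'r::idom poly3"
  assumes "srf p q dvd (vx * vy) ^ N * P"
  shows "srf p q dvd P"
  using assms
proof (induction N)
  case (Suc N)
  then have "srf p q dvd vx * (vy * ((vx * vy) ^ N * P))" by (simp add: mult.assoc)
  then show ?case using Suc.IH srf_dvd_cancel by blast
qed simp

text \<open>On the surface \<open>x y z\<close> is a polynomial in \<open>x\<close> and
  \<open>y\<close>, so each factor \<open>x y\<close> removes one power of \<open>z\<close>.\<close>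

lemma clear_z: "\<exists>N Q H. (vx * vy) ^ N * P = srf p q * Q + [:H:]"
proof (induction P)
  case 0
  have "(vx * vy) ^ 0 * 0 = srf p q * 0 + [:0:]" by simp
  then show ?case by blast
next
  case (pCons c P)
  note k = rhom_const_poly
  obtain N Q H where P: "(vx * vy) ^ N * P = srf p q * Q + [:H:]" using pCons by blast
  define M :: "'a poly poly" where "M = [:[:0, 1:]:] * [:0, 1:]"
  define G :: "'a poly poly" where
    "G = cub (\<lambda>c. [:[:c:]:]) p [:[:0, 1:]:] + cub (\<lambda>c. [:[:c:]:]) q [:0, 1:] - 1"
  have M: "vx * vy = [:M:]" by (simp add: vx_def vy_def M_def)
  have "[:G:] = cub const3 p vx + cub const3 q vy - 1"
    unfolding G_def const3_def vx_def vy_def by (simp only: rhomD[OF k] cub_hom[OF k])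
  then have G: "vz * (vx * vy) = srf p q + [:G:]" by (simp add: srf_def algebra_simps)
  have "pCons c P = [:c:] + vz * P" by (simp add: vz_def)
  then have "(vx * vy) ^ Suc N * pCons c P =
      (vx * vy) ^ Suc N * [:c:] + vz * (vx * vy) * ((vx * vy) ^ N * P)"
    by (simp add: algebra_simps)
  also have "\<dots> = (vx * vy) ^ Suc N * [:c:] + (srf p q + [:G:]) * (srf p q * Q + [:H:])"
    unfolding G P ..
  also have "\<dots> = srf p q * ((srf p q + [:G:]) * Q + [:H:]) + ([:M:] ^ Suc N * [:c:] + [:G:] * [:H:])"
    unfolding M by (simp only: algebra_simps)
  also have "[:M:] ^ Suc N * [:c:] + [:G:] * [:H:] = [:M ^ Suc N * c + G * H:]"
    by (simp only: rhomD[OF k])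
  finally show ?case by blast
qed

lemma ev3_const: "rhom h \<Longrightarrow> ev3 h u v w [:H:] = ev2 h u v H"
  unfolding ev3_def by (intro ev1_const rhom_ev2)

lemma clear_z_ev:
  fixes p q :: "'r::comm_ring_1 \<times> 'r"
  shows "\<exists>N H. \<forall>u v w. rel cst p q u v w \<longrightarrow> (u * v) ^ N * ev3 cst u v w P = ev2 cst u v H"
proof -
  obtain N Q H where *: "(vx * vy) ^ N * P = srf p q * Q + [:H:]" using clear_z by blast
  have "(u * v) ^ N * ev3 cst u v w P = ev2 cst u v H" if "rel cst p q u v w" for u v w
  proof -
    note r = rhomD[OF rhom_ev3[OF rhom_cst], of u v w]
    have "ev3 cst u v w ((vx * vy) ^ N * P) = ev3 cst u v w (srf p q * Q + [:H:])" unfolding * ..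
    then show ?thesis using that
      by (simp add: r ev3_gens[OF rhom_cst] ev3_const[OF rhom_cst] rel_iff[OF rhom_cst])
  qed
  then show ?thesis by blast
qed

definition lx :: "'r::comm_ring_1 lau" where "lx = mono (ZZ 1 0) 1"
definition ly :: "'r::comm_ring_1 lau" where "ly = mono (ZZ 0 1) 1"
definition lz :: "'r::comm_ring_1 \<times> 'r \<Rightarrow> 'r \<times> 'r \<Rightarrow> 'r lau" where
  "lz p q = mono (ZZ (-1) (-1)) 1 * (cub cst p lx + cub cst q ly - 1)"

lemma mono_eq_0_iff [simp]: "mono e c = 0 \<longleftrightarrow> c = 0"
  by (metis lookup_single_eq lookup_zero single_zero)

lemma lx_ly: "lx * ly * mono (ZZ (-1) (-1)) 1 = 1" "lx \<noteq> 0" "ly \<noteq> 0"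
  "lexp lx = ZZ 1 0" "lexp ly = ZZ 0 1" "val lx = sqrt 5" "val ly = 2" "indep (lexp lx) (lexp ly)"
proof -
  have "ZZ 1 0 + ZZ 0 1 + ZZ (-1) (-1) = 0" by (simp add: zz_eq_iff)
  then show "lx * ly * mono (ZZ (-1) (-1)) 1 = 1" unfolding lx_def ly_def mult_single by simp
qed (simp_all add: lx_def ly_def lexp_mono val_mono wt_def indep_def)

lemma rel_base: "rel cst p q lx ly (lz p q)"
proof -
  have "lx * ly * lz p q = (lx * ly * mono (ZZ (-1) (-1)) 1) * (cub cst p lx + cub cst q ly - 1)"
    by (simp add: lz_def mult.assoc)
  then show ?thesis unfolding rel_def lx_ly(1) by simp
qed

abbreviation evb :: "'r::comm_ring_1 \<times> 'r \<Rightarrow> 'r \<times> 'r \<Rightarrow> 'r poly3 \<Rightarrow> 'r lau" where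
  "evb p q \<equiv> ev3 cst lx ly (lz p q)"

text \<open>After clearing \<open>z\<close>, a function that vanishes in the Laurent ring has
  \<open>H = 0\<close> by the algebraic independence of \<open>lx\<close> and \<open>ly\<close>, and
  the power of \<open>x y\<close> can be cancelled. Henceforth the coordinate ring is the range of
  \<open>evb\<close>.\<close>

lemma evb_kernel:
  fixes P :: "'r::idom poly3"
  shows "evb p q P = 0 \<longleftrightarrow> srf p q dvd P"
proof
  assume P: "evb p q P = 0"
  obtain N Q H where *: "(vx * vy) ^ N * P = srf p q * Q + [:H:]" using clear_z by blast
  note r = rhomD[OF rhom_ev3[OF rhom_cst], of lx ly "lz p q"]
  have "evb p q ((vx * vy) ^ N * P) = evb p q (srf p q * Q + [:H:])" unfolding * ..
  then have "ev2 cst lx ly H = 0" using rel_base[of p q] P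
    by (simp add: r ev3_const[OF rhom_cst] rel_iff[OF rhom_cst])
  then have "H = 0" using val_ev2(1)[OF lx_ly(2,3,8)] by blast
  then have "srf p q dvd (vx * vy) ^ N * P" unfolding * by simp
  then show "srf p q dvd P" by (rule srf_dvd_cancel_power)
next
  assume "srf p q dvd P"
  from ev3_dvd[OF rhom_cst this, of lx ly "lz p q"] rel_base[of p q] show "evb p q P = 0"
    by (simp add: rel_iff[OF rhom_cst])
qed

section \<open>The Jacobian of an automorphism\<close>

text \<open>Gauss's lemma for a monic linear factor, without unique factorization: take the highest
  coefficient of \<open>g\<close> that \<open>B\<close> does not divide and look at the next
  coefficient of the product.\<close>

lemma dvd_mult_monic_linear:
  fixes g :: "'a::idom poly"
  assumes "[:B:] dvd [:t, 1:] * g"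
  shows "[:B:] dvd g"
proof (rule ccontr)
  assume "\<not> [:B:] dvd g"
  then have "\<exists>k. \<not> B dvd poly.coeff g k" by (simp add: const_poly_dvd_iff)
  moreover have "\<forall>k. \<not> B dvd poly.coeff g k \<longrightarrow> k \<le> Polynomial.degree g"
    using le_degree by (metis dvd_0_right)
  ultimately obtain k where k: "\<not> B dvd poly.coeff g k" "\<And>j. j > k \<Longrightarrow> B dvd poly.coeff g j"
    using Nat.ex_has_greatest_nat[of "\<lambda>k. \<not> B dvd poly.coeff g k" _ "Polynomial.degree g"]
    by (metis linorder_not_le)
  have "B dvd poly.coeff ([:t, 1:] * g) (Suc k)"
    using assms unfolding const_poly_dvd_iff by blast
  moreover have "poly.coeff ([:t, 1:] * g) (Suc k) = t * poly.coeff g (Suc k) + poly.coeff g k"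
    by (simp add: coeff_pCons)
  ultimately have "B dvd poly.coeff g k"
    using k(2)[of "Suc k"] by (simp add: dvd_add_right_iff)
  then show False using k(1) by simp
qed

text \<open>On the curve \<open>x = 0\<close> of the surface, where \<open>cub q y = 0\<close>, the function \<open>y\<close> is invertible, so
  the function \<open>y z - fst p\<close> is there, up to a unit, monic in \<open>z\<close>.\<close>

lemma mutx_nonzerodivisor_poly3:
  fixes G H :: "'r::idom poly3"
  assumes "srf p q dvd mutx const3 p vx vy vz * G - vx * H"
  shows "\<exists>K. srf p q dvd G - vx * K"
proof -
  define e :: "'r poly3 \<Rightarrow> 'r poly3" where "e = ev3 const3 0 vy vz"
  have e: "rhom e" unfolding e_def by (intro rhom_ev3 rhom_const3)
  have eg: "e vx = 0" "e vy = vy" "e vz = vz" "\<And>c. e (const3 c) = const3 c"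
    unfolding e_def by (simp_all add: ev3_gens[OF rhom_const3])
  define b where "b = cub const3 q vy"
  define s where "s = qd const3 q vy"
  have b: "b = vy * s + 1" by (simp add: b_def s_def cub_def)
  have "e (srf p q) = - b"
    by (simp add: srf_hom[OF e] eg b_def) (simp add: cub_def)
  moreover have "e (mutx const3 p vx vy vz * G - vx * H) = (vy * vz - const3 (fst p)) * e G"
    by (simp add: mutx_def qd_hom[OF e] rhomD[OF e] eg) (simp add: qd_def)
  moreover have "e (srf p q) dvd e (mutx const3 p vx vy vz * G - vx * H)"
    using assms by (elim dvdE) (metis rhomD(4)[OF e] dvd_triv_left)
  ultimately have bd: "b dvd (vy * vz - const3 (fst p)) * e G" by simp
  \<comment> \<open>Modulo \<open>b = vy * s + 1\<close> the inverse of \<open>y\<close> is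
    \<open>- s\<close>; multiplying by it makes the factor monic in \<open>z\<close>.\<close>
  have "b dvd b * (vz * e G) - s * ((vy * vz - const3 (fst p)) * e G)"
    by (rule dvd_diff[OF dvd_triv_left dvd_mult[OF bd]])
  also have "\<dots> = (vz + s * const3 (fst p)) * e G" by (simp add: b algebra_simps)
  finally have d: "b dvd (vz + s * const3 (fst p)) * e G" .
  note k = rhom_const_poly
  define B :: "'r poly poly" where "B = cub (\<lambda>c. [:[:c:]:]) q [:0, 1:]"
  define t :: "'r poly poly" where "t = qd (\<lambda>c. [:[:c:]:]) q [:0, 1:] * [:[:fst p:]:]"
  have "b = [:B:]" unfolding b_def B_def const3_def vy_def by (simp only: cub_hom[OF k])
  moreover have "s * const3 (fst p) = [:t:]"
    unfolding s_def t_def const3_def vy_def by (simp only: qd_hom[OF k] rhomD[OF k])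
  ultimately have "[:B:] dvd [:t, 1:] * e G" using d by (simp add: vz_def)
  then have "b dvd e G" using dvd_mult_monic_linear \<open>b = [:B:]\<close> by blast
  then obtain K2 where K2: "e G = b * K2" by (rule dvdE)
  have "vx dvd G - e G"
    using ev3_cong_dvd[OF rhom_const3, of vx vx 0 vy vy vz vz G] by (simp add: ev3_id e_def)
  then obtain K1 where K1: "G - e G = vx * K1" by (rule dvdE)
  \<comment> \<open>The equation \<open>srf p q\<close> equals
    \<open>vx * mutx const3 p vx vy vz - b\<close>, so on the surface a multiple of \<open>b\<close>
    is a multiple of \<open>x\<close>.\<close>
  have "G - vx * (K1 + mutx const3 p vx vy vz * K2) = srf p q * (- K2)"
    using K1 K2 by (simp add: srf_def mutx_def b_def cub_def algebra_simps)
  then show ?thesis by (metis dvd_triv_left)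
qed

lemma pb_1: "pb 1 h = 0"
  using pb_simps(4)[of 1 h] by simp

text \<open>The images of the coordinates under an isomorphism of the coordinate ring onto
  \<open>A\<close>: the assumption \<open>ker\<close> is injectivity on the quotient, the other one
  is surjectivity.\<close>

locale triple =
  fixes p q :: "'r::{idom,ring_char_0} \<times> 'r" and U V W :: "'r lau" and A :: "'r lau set"
  assumes ker: "ev3 cst U V W P = 0 \<longleftrightarrow> srf p q dvd P"
    and A: "A = range (ev3 cst U V W)"
begin

lemmas r = rhomD[OF rhom_ev3[OF rhom_cst], of U V W]
lemmas g = ev3_gens[OF rhom_cst, of U V W]

lemma relation: "rel cst p q U V W"
  unfolding rel_iff[OF rhom_cst] ker by simp

lemma in_A: "U \<in> A" "V \<in> A" "W \<in> A" "cst c \<in> A"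
  unfolding A using g[symmetric] by (metis rangeI)+

lemma A_closed: "f \<in> A \<Longrightarrow> h \<in> A \<Longrightarrow> f + h \<in> A" "f \<in> A \<Longrightarrow> h \<in> A \<Longrightarrow> f * h \<in> A"
  "f \<in> A \<Longrightarrow> - f \<in> A" "f \<in> A \<Longrightarrow> h \<in> A \<Longrightarrow> f - h \<in> A"
  unfolding A by (auto simp flip: r)

lemma qd_A: "f \<in> A \<Longrightarrow> qd cst p' f \<in> A"
  by (simp add: qd_def power2_eq_square A_closed in_A)

lemma mutx_A: "mutx cst p U V W \<in> A"
  by (simp add: mutx_def A_closed in_A qd_A)

lemma U_nonzero: "U \<noteq> 0"
proof
  assume "U = 0"
  then have "ev3 cst U V W vx = 0" using g(1) by metis
  then have "srf p q dvd vx" unfolding ker .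
  then have "evb p q vx = 0" unfolding evb_kernel .
  then show False by (simp add: ev3_gens[OF rhom_cst] lx_ly)
qed

lemma swap: "triple q p V U W A"
proof
  have sw: "rhom (ev3 const3 vy vx vz :: 'r poly3 \<Rightarrow> _)" by (intro rhom_ev3 rhom_const3)
  have 1: "ev3 cst U V W (ev3 const3 vy vx vz P) = ev3 cst V U W P" for P
    using ev3_comp[OF rhom_ev3[OF rhom_cst, of U V W] rhom_const3, of vy vx vz P] by (simp add: g)
  have 2: "ev3 const3 vy vx vz (ev3 const3 vy vx vz P) = P" for P :: "'r poly3"
    using ev3_comp[OF sw rhom_const3, of vy vx vz P] by (simp add: ev3_gens[OF rhom_const3] ev3_id)
  have 3: "ev3 const3 vy vx vz (srf p q) = srf q p" "ev3 const3 vy vx vz (srf q p) = srf p q"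
    by (simp_all only: ev3_srf[OF rhom_const3]) (simp_all add: srf_def algebra_simps)
  show "ev3 cst V U W P = 0 \<longleftrightarrow> srf q p dvd P" for P
    unfolding 1[symmetric] ker
    using ev3_dvd[OF rhom_const3, of "srf p q" "ev3 const3 vy vx vz P" vy vx vz]
      ev3_dvd[OF rhom_const3, of "srf q p" P vy vx vz] by (auto simp: 2 3)
  have "range (ev3 cst U V W) = range (ev3 cst V U W)"
  proof (intro equalityI subsetI)
    fix f assume "f \<in> range (ev3 cst V U W)"
    then show "f \<in> range (ev3 cst U V W)" by (auto simp flip: 1)
  next
    fix f assume "f \<in> range (ev3 cst U V W)"
    then obtain P where "f = ev3 cst U V W P" by blast
    then have "f = ev3 cst V U W (ev3 const3 vy vx vz P)" using 1 2 by metis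
    then show "f \<in> range (ev3 cst V U W)" by blast
  qed
  then show "A = range (ev3 cst V U W)" using A by simp
qed

lemma mutx_nonzerodivisor:
  assumes "f \<in> A" "h \<in> A" "mutx cst p U V W * f = U * h"
  shows "\<exists>k\<in>A. f = U * k"
proof -
  obtain G H where GH: "f = ev3 cst U V W G" "h = ev3 cst U V W H" using assms A by blast
  have "ev3 cst U V W (mutx const3 p vx vy vz * G - vx * H) = mutx cst p U V W * f - U * h"
    by (simp add: r g mutx_def qd_hom[OF rhom_ev3[OF rhom_cst]] GH)
  then have "srf p q dvd mutx const3 p vx vy vz * G - vx * H"
    unfolding ker[symmetric] using assms(3) by simp
  then obtain K where "srf p q dvd G - vx * K" using mutx_nonzerodivisor_poly3 by blast
  then have "ev3 cst U V W (G - vx * K) = 0" unfolding ker .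
  then have "f = U * ev3 cst U V W K" by (simp add: r g GH)
  then show ?thesis using A by blast
qed

lemma pb_cub: "pb (cub cst p' f) f = 0"
  by (simp add: cub_def qd_def power2_eq_square pb_simps pb_1)

text \<open>\<open>U\<close> times its mutation is a polynomial in \<open>V\<close>, so its bracket
  with \<open>V\<close> is zero. The product rule moves \<open>U\<close> to the other side, and the
  mutation can be cancelled modulo \<open>U\<close>.\<close>

lemma U_dvd_pb:
  assumes pbA: "\<And>f h. f \<in> A \<Longrightarrow> h \<in> A \<Longrightarrow> pb f h \<in> A"
  shows "\<exists>k\<in>A. pb U V = U * k"
proof -
  let ?M = "mutx cst p U V W"
  have "pb (U * ?M) V = 0" unfolding mutx_mult[OF relation] by (rule pb_cub)
  then have e: "?M * pb U V = U * (- pb ?M V)" by (simp add: pb_simps algebra_simps eq_neg_iff_add_eq_0)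
  show ?thesis
    by (rule mutx_nonzerodivisor[OF _ _ e]) (intro pbA in_A mutx_A A_closed)+
qed

lemma UV_dvd_pb:
  assumes pbA: "\<And>f h. f \<in> A \<Longrightarrow> h \<in> A \<Longrightarrow> pb f h \<in> A"
  shows "\<exists>k\<in>A. pb U V = U * V * k"
proof -
  interpret s: triple q p V U W A by (rule swap)
  obtain k1 where k1: "k1 \<in> A" "pb U V = U * k1" using U_dvd_pb[OF pbA] by blast
  obtain k2 where k2: "k2 \<in> A" "pb V U = V * k2" using s.U_dvd_pb[OF pbA] by blast
  have e: "U * k1 = - V * k2" using k1 k2 pb_swap[of U V] by simp
  \<comment> \<open>\<open>U\<close> and \<open>V\<close> generate the unit ideal, because 1 =
    cub(U) - U qd(U) and \<open>V\<close> divides cub(U). Hence divisibility by both gives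
    divisibility by the product.\<close>
  have "k1 = cub cst p U * k1 - qd cst p U * (U * k1)" by (simp add: cub_def algebra_simps)
  also have "\<dots> = V * (mutx cst q V U W * k1 + qd cst p U * k2)"
    unfolding e by (simp add: mutx_mult[OF s.relation, symmetric] algebra_simps)
  finally show ?thesis using k1 k2 A_closed s.mutx_A qd_A in_A by (metis mult.assoc)
qed

text \<open>If {U, V} were zero, the relation and cancellation of \<open>U V\<close> would make all
  brackets of generators vanish, hence the bracket on all of \<open>A\<close>.\<close>

lemma pb_UV_nonzero:
  assumes "f \<in> A" "h \<in> A" "pb f h \<noteq> 0"
  shows "pb U V \<noteq> 0"
proof
  interpret s: triple q p V U W A by (rule swap)
  assume z0: "pb U V = 0"
  then have z0': "pb V U = 0" using pb_swap[of V U] by simp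
  have c: "pb (cub cst p' f) h = 0" if "pb f h = 0" for p' f h
    using that by (simp add: cub_def qd_def power2_eq_square pb_simps pb_1)
  have pm: "pb (f - h) k = pb f k - pb h k" for f h k
    using pb_simps(2)[of "f - h" h k] by simp
  have "pb (U * V * W) h = 0" if "pb U h = 0" "pb V h = 0" for h
    using relation that unfolding rel_def by (simp add: pb_simps pm c pb_1)
  then have "pb W h = 0" if "pb U h = 0" "pb V h = 0" for h
    using that U_nonzero s.U_nonzero by (simp add: pb_simps)
  then have 1: "pb W U = 0" "pb W V = 0" using z0 z0' pb_simps(1) by auto
  then have 2: "pb U W = 0" "pb V W = 0" using pb_swap[of U W] pb_swap[of V W] by simp_all
  have z: "ev3 cst U V W P \<in> {f. pb f U = 0 \<and> pb f V = 0 \<and> pb f W = 0}" for P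
    by (rule ev3_closed[OF rhom_cst]) (use z0 z0' 1 2 in \<open>auto simp: pb_simps\<close>)
  have "ev3 cst U V W P \<in> {k. pb k f = 0}" for P
    by (rule ev3_closed[OF rhom_cst])
       (use z assms(1) A pb_swap[of U f] pb_swap[of V f] pb_swap[of W f] in \<open>auto simp: pb_simps\<close>)
  then have "pb h f = 0" using assms(2) A by blast
  then show False using assms(3) pb_swap[of h f] by simp
qed

lemma pb_closed_gens:
  assumes xy: "pb U V \<in> A" and zx: "pb W U \<in> A" and zy: "pb W V \<in> A"
    and f: "f \<in> A" and h: "h \<in> A"
  shows "pb f h \<in> A"
proof -
  have sw: "pb f h \<in> A \<Longrightarrow> pb h f \<in> A" for f h
    using A_closed(3)[of "pb f h"] pb_swap[of h f] by simp
  have z0: "0 \<in> A" using in_A(4)[of 0] by simp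
  have 1: "ev3 cst U V W P \<in> {f. f \<in> A \<and> pb f U \<in> A \<and> pb f V \<in> A \<and> pb f W \<in> A}" for P
    by (rule ev3_closed[OF rhom_cst])
       (simp_all add: pb_simps A_closed in_A xy zx zy sw[OF xy] sw[OF zx] sw[OF zy] z0)
  obtain P where P: "f = ev3 cst U V W P" using f unfolding A by (rule imageE)
  obtain Q where Q: "h = ev3 cst U V W Q" using h unfolding A by (rule imageE)
  have "pb f U \<in> A" "pb f V \<in> A" "pb f W \<in> A" using 1[of P] unfolding P by simp_all
  then have f': "pb U f \<in> A" "pb V f \<in> A" "pb W f \<in> A" by (simp_all add: sw)
  have "ev3 cst U V W P \<in> {k. k \<in> A \<and> pb k f \<in> A}" for P
    by (rule ev3_closed[OF rhom_cst]) (auto simp only: pb_simps mem_Collect_eq intro!: A_closed in_A z0 f')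
  then have "pb h f \<in> A" unfolding Q by simp
  then show ?thesis by (rule sw)
qed

end

lemma triple_base: "triple p q lx ly (lz p q) (range (evb p q))"
  by unfold_locales (simp_all add: evb_kernel)

text \<open>This is the Jacobian Poisson bracket of the equation F of the surface: {x, y} = F_z =
  xy, {z, x} = F_y and {y, z} = F_x are regular. The last two come from bracketing the relation with
  a coordinate and cancelling \<open>x y\<close>.\<close>

lemma pb_closed:
  fixes p q :: "'r::{idom,ring_char_0} \<times> 'r"
  assumes "f \<in> range (evb p q)" "h \<in> range (evb p q)"
  shows "pb f h \<in> range (evb p q)"
proof -
  interpret triple p q lx ly "lz p q" "range (evb p q)" by (rule triple_base)
  let ?A = "range (evb p q)" let ?z = "lz p q"
  have D: "D fx lx = lx" "D fy lx = 0" "D fx ly = 0" "D fy ly = (ly :: 'r lau)"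
    by (simp_all add: lx_def ly_def D_mono)
  have xy: "pb lx ly = lx * (ly :: 'r lau)" by (simp add: pb_def D)
  have nx: "lx \<noteq> (0 :: 'r lau)" "ly \<noteq> (0 :: 'r lau)" by (simp_all add: lx_ly)
  have pm: "pb (f - h) k = pb f k - pb h k" for f h k :: "'r lau"
    using pb_simps(2)[of "f - h" h k] by simp
  have c: "\<exists>k\<in>?A. pb (cub cst p' f) h = k * pb f h" if "f \<in> ?A" for p' f h
  proof
    show "pb (cub cst p' f) h = (f * (f + f + cst (snd p')) + qd cst p' f) * pb f h"
      by (simp add: cub_def qd_def power2_eq_square pb_simps pb_1 algebra_simps)
    show "f * (f + f + cst (snd p')) + qd cst p' f \<in> ?A" using that by (intro A_closed qd_A in_A)
  qed
  have R: "lx * ly * ?z = cub cst p lx + cub cst q ly - 1" using relation by (simp add: rel_def)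
  have zx: "pb ?z lx \<in> ?A"
  proof -
    obtain k where k: "k \<in> ?A" "pb (cub cst q ly) lx = k * pb ly lx" using c[OF in_A(2)] by blast
    have "pb (lx * ly * ?z) lx = k * pb ly lx"
      unfolding R pm pb_simps(2) k pb_1 pb_cub by simp
    then have "lx * ly * pb ?z lx = lx * ly * (lx * ?z - k)"
      by (simp add: pb_simps pb_swap[of ly lx] xy algebra_simps)
    then have "pb ?z lx = lx * ?z - k" using nx by simp
    then show ?thesis using k in_A A_closed by metis
  qed
  have zy: "pb ?z ly \<in> ?A"
  proof -
    obtain k where k: "k \<in> ?A" "pb (cub cst p lx) ly = k * pb lx ly" using c[OF in_A(1)] by blast
    have "pb (lx * ly * ?z) ly = k * pb lx ly"
      unfolding R pm pb_simps(2) k pb_1 pb_cub by simp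
    then have "lx * ly * pb ?z ly = lx * ly * (k - ly * ?z)"
      by (simp add: pb_simps xy algebra_simps)
    then have "pb ?z ly = k - ly * ?z" using nx by simp
    then show ?thesis using k in_A A_closed by metis
  qed
  have xyA: "pb lx ly \<in> ?A" unfolding xy by (intro A_closed in_A)
  show ?thesis by (rule pb_closed_gens[OF xyA zx zy assms])
qed



section \<open>Supports of regular functions\<close>

text \<open>The filtration by degree in \<open>x, y, z\<close>. Adding one monomial at a time turns
  each statement about a level into an induction over monomials.\<close>

inductive_set fil :: "'r::comm_ring_1 \<times> 'r \<Rightarrow> 'r \<times> 'r \<Rightarrow> nat \<Rightarrow> 'r lau set" for p q d where
  fil_zero: "0 \<in> fil p q d"
| fil_step: "f \<in> fil p q d \<Longrightarrow> i + j + k \<le> d \<Longrightarrow> f + cst c * (lx ^ i * ly ^ j * lz p q ^ k) \<in> fil p q d"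

lemma fil_monom: "i + j + k \<le> d \<Longrightarrow> cst c * (lx ^ i * ly ^ j * lz p q ^ k) \<in> fil p q d"
  using fil_step[OF fil_zero, of i j k d c p q] by simp

lemma fil_add:
  assumes "f \<in> fil p q d" "g \<in> fil p q d"
  shows "f + g \<in> fil p q d"
  using assms(2)
proof (induction g rule: fil.induct)
  case (fil_step g i j k c)
  then show ?case
    using fil.fil_step[of "f + g" p q d i j k c] by (simp add: add.assoc)
qed (simp add: assms(1))

lemma fil_mono: "f \<in> fil p q d \<Longrightarrow> d \<le> d' \<Longrightarrow> f \<in> fil p q d'"
  by (induction f rule: fil.induct) (auto intro: fil.intros)

lemma fil_mult:
  assumes "f \<in> fil p q d" "g \<in> fil p q d'"
  shows "f * g \<in> fil p q (d + d')"
  using assms(1)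
proof (induction f rule: fil.induct)
  case (fil_step f i j k c)
  have "cst c * (lx ^ i * ly ^ j * lz p q ^ k) * g \<in> fil p q (d + d')"
    using assms(2)
  proof (induction g rule: fil.induct)
    case (fil_step g i' j' k' c')
    have "cst c * (lx ^ i * ly ^ j * lz p q ^ k) * (cst c' * (lx ^ i' * ly ^ j' * lz p q ^ k')) =
        cst c * cst c' * (lx ^ (i + i') * ly ^ (j + j') * lz p q ^ (k + k'))"
      by (simp only: power_add ac_simps)
    also have "\<dots> \<in> fil p q (d + d')"
      unfolding mult_single using fil_step \<open>i + j + k \<le> d\<close> by (simp only: add_0_right) (rule fil_monom, simp)
    finally show ?case using fil_step by (simp only: distrib_left) (rule fil_add)
  qed (simp add: fil_zero)
  then show ?case using fil_step by (simp only: distrib_right) (rule fil_add)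
qed (simp add: fil_zero)

lemma fil_cst: "cst c \<in> fil p q d"
  using fil_monom[of 0 0 0 d c p q] by simp

lemma fil_gens: "lx \<in> fil p q 1" "ly \<in> fil p q 1" "lz p q \<in> fil p q 1"
  using fil_monom[of 1 0 0 1 1 p q] fil_monom[of 0 1 0 1 1 p q] fil_monom[of 0 0 1 1 1 p q] by simp_all

lemma evb_fil: "\<exists>d. evb p q P \<in> fil p q d"
proof -
  have "evb p q P \<in> {f. \<exists>d. f \<in> fil p q d}"
  proof (rule ev3_closed[OF rhom_cst]; unfold mem_Collect_eq)
    show "\<exists>d. cst c \<in> fil p q d" for c by (rule exI, rule fil_cst)
    show "\<exists>d. lx \<in> fil p q d" "\<exists>d. ly \<in> fil p q d" "\<exists>d. lz p q \<in> fil p q d"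
      by (rule exI, rule fil_gens)+
    fix f g assume "\<exists>d. f \<in> fil p q d" "\<exists>d. g \<in> fil p q d"
    then obtain d d' where d: "f \<in> fil p q d" "g \<in> fil p q d'" by (elim exE)
    show "\<exists>d. f * g \<in> fil p q d" by (rule exI, rule fil_mult[OF d])
    have "f \<in> fil p q (d + d')" by (rule fil_mono[OF d(1)]) simp
    moreover have "g \<in> fil p q (d + d')" by (rule fil_mono[OF d(2)]) simp
    ultimately show "\<exists>d. f + g \<in> fil p q d" by (intro exI, rule fil_add)
  qed
  then show ?thesis by simp
qed

lemma fil_0: "f \<in> fil p q 0 \<Longrightarrow> \<exists>c. f = cst c"
proof (induction f rule: fil.induct)
  case (fil_step f i j k c)
  then obtain c' where "f = cst c'" by blast
  then have "f + cst c * (lx ^ i * ly ^ j * lz p q ^ k) = cst (c' + c)"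
    using fil_step by (simp add: single_add)
  then show ?case by blast
qed (metis single_zero)

lemma fil_1: "f \<in> fil p q 1 \<Longrightarrow>
  \<exists>c0 c1 c2 c3. f = cst c0 + cst c1 * lx + cst c2 * ly + cst c3 * lz p q"
proof (induction f rule: fil.induct)
  case fil_zero
  have "0 = cst 0 + cst 0 * lx + cst 0 * ly + cst 0 * lz p q" by simp
  then show ?case by blast
next
  case (fil_step f i j k c)
  then obtain c0 c1 c2 c3 where f: "f = cst c0 + cst c1 * lx + cst c2 * ly + cst c3 * lz p q" by blast
  consider "i = 0" "j = 0" "k = 0" | "i = 1" "j = 0" "k = 0" | "i = 0" "j = 1" "k = 0"
    | "i = 0" "j = 0" "k = 1" using fil_step by linarith
  then have "f + cst c * (lx ^ i * ly ^ j * lz p q ^ k) =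
      cst (c0 + (if i + j + k = 0 then c else 0)) + cst (c1 + (if i = 1 then c else 0)) * lx +
      cst (c2 + (if j = 1 then c else 0)) * ly + cst (c3 + (if k = 1 then c else 0)) * lz p q"
    by cases (simp_all add: f single_add algebra_simps)
  then show ?case by blast
qed

section \<open>Total degree, and the top-degree part x^2/y + y^2/x of \<open>z\<close>\<close>

definition lrem :: "'r::comm_ring_1 \<times> 'r \<Rightarrow> 'r \<times> 'r \<Rightarrow> 'r lau" where
  "lrem p q = mono (ZZ 1 (-1)) (snd p) + mono (ZZ 0 (-1)) (fst p) + mono (ZZ (-1) 1) (snd q) +
    mono (ZZ (-1) 0) (fst q) + mono (ZZ (-1) (-1)) 1"

lemma zz_add: "ZZ a b + ZZ c d = ZZ (a + c) (b + d)"
  by (simp add: zz_eq_iff)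

lemma lx_power: "lx ^ i = mono (ZZ (int i) 0) 1" and ly_power: "ly ^ i = mono (ZZ 0 (int i)) 1"
  by (induction i) (simp_all add: lx_def ly_def mult_single zz_add flip: zero_zz_def single_one)

lemma mono_zero: "cst c = mono (ZZ 0 0) c" "1 = mono (ZZ 0 0) 1"
  by (simp_all flip: zero_zz_def)

lemma lz_expand: "lz p q = mono (ZZ 2 (-1)) 1 + mono (ZZ (-1) 2) 1 + lrem p q"
proof -
  have "cub cst p lx + cub cst q ly - 1 = mono (ZZ 3 0) 1 + mono (ZZ 2 0) (snd p) + mono (ZZ 1 0) (fst p)
      + mono (ZZ 0 3) 1 + mono (ZZ 0 2) (snd q) + mono (ZZ 0 1) (fst q) + mono (ZZ 0 0) 1"
    unfolding cub_def qd_def lx_power ly_power lx_def ly_def mono_zero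
    by (simp add: distrib_left mult_single zz_add power2_eq_square)
  then show ?thesis
    unfolding lz_def lrem_def by (simp add: distrib_left mult_single zz_add)
qed

definition dg :: "zz \<Rightarrow> int" where "dg e = fx e + fy e"

lemma keys_lrem: "e \<in> keys (lrem p q) \<Longrightarrow> dg e \<le> 0 \<and> \<bar>fx e\<bar> \<le> 1 \<and> \<bar>fy e\<bar> \<le> 1"
  by (auto simp: lrem_def in_keys_iff lookup_add lookup_single when_def dg_def split: if_splits)

text \<open>The top-degree part of \<open>z^k\<close> is the k-th power of x^2/y + y^2/x, and its
  two extreme monomials arise in only one way. The rest of \<open>z\<close> has degree at most 0 and
  contributes nothing there.\<close>

lemma lz_power:
  shows "e \<in> keys (lz p q ^ k) \<Longrightarrow> dg e \<le> int k \<and> (dg e = int k \<longrightarrow> - int k \<le> fx e \<and> fx e \<le> 2 * int k)"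
    and "lookup (lz p q ^ k) (ZZ (2 * int k) (- int k)) = 1"
    and "lookup (lz p q ^ k) (ZZ (- int k) (2 * int k)) = 1"
proof (induction k arbitrary: e)
  case 0
  show "dg e \<le> int 0 \<and> (dg e = int 0 \<longrightarrow> - int 0 \<le> fx e \<and> fx e \<le> 2 * int 0)"
    if "e \<in> keys (lz p q ^ 0)" for e
    using that by (simp add: dg_def)
  show "lookup (lz p q ^ 0) (ZZ (2 * int 0) (- int 0)) = 1"
    "lookup (lz p q ^ 0) (ZZ (- int 0) (2 * int 0)) = 1"
    by (simp_all flip: zero_zz_def)
next
  case (Suc k)
  let ?f = "lz p q ^ k"
  have R: "dg e \<le> int k" if "e \<in> keys (lrem p q * ?f)" for e
  proof -
    obtain a b where "a \<in> keys (lrem p q)" "b \<in> keys ?f" "e = a + b" using keys_multE[OF \<open>e \<in> _\<close>] .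
    then show ?thesis using keys_lrem[of a p q] Suc.IH(1)[of b] by (simp add: dg_def)
  qed
  have L: "lookup (lz p q ^ Suc k) e = lookup ?f (e - ZZ 2 (-1)) + lookup ?f (e - ZZ (-1) 2) +
      lookup (lrem p q * ?f) e" for e
  proof -
    have "lz p q ^ Suc k = mono (ZZ 2 (-1)) 1 * ?f + mono (ZZ (-1) 2) 1 * ?f + lrem p q * ?f"
      unfolding power_Suc by (subst lz_expand) (simp only: distrib_right)
    then show ?thesis by (simp only: lookup_add lookup_mono_mult mult_1)
  qed
  show "dg e \<le> int (Suc k) \<and> (dg e = int (Suc k) \<longrightarrow> - int (Suc k) \<le> fx e \<and> fx e \<le> 2 * int (Suc k))"
    if e: "e \<in> keys (lz p q ^ Suc k)" for e
  proof -
    consider "e - ZZ 2 (-1) \<in> keys ?f" | "e - ZZ (-1) 2 \<in> keys ?f" | "e \<in> keys (lrem p q * ?f)"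
      using e unfolding in_keys_iff L by (metis add.right_neutral)
    then show ?thesis
    proof cases
      case 1
      then show ?thesis using Suc.IH(1)[OF 1] by (auto simp: dg_def)
    next
      case 2
      then show ?thesis using Suc.IH(1)[OF 2] by (auto simp: dg_def)
    next
      case 3
      then show ?thesis using R by force
    qed
  qed
  show "lookup (lz p q ^ Suc k) (ZZ (2 * int (Suc k)) (- int (Suc k))) = 1"
  proof -
    let ?e = "ZZ (2 * int (Suc k)) (- int (Suc k))"
    have "?e - ZZ 2 (-1) = ZZ (2 * int k) (- int k)" by (simp add: zz_eq_iff)
    moreover have "?e - ZZ (-1) 2 \<notin> keys ?f" using Suc.IH(1)[of "?e - ZZ (-1) 2"] by (auto simp: dg_def)
    moreover have "?e \<notin> keys (lrem p q * ?f)" using R[of ?e] by (auto simp: dg_def)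
    ultimately show ?thesis unfolding L using Suc.IH(2) by (simp add: in_keys_iff)
  qed
  show "lookup (lz p q ^ Suc k) (ZZ (- int (Suc k)) (2 * int (Suc k))) = 1"
  proof -
    let ?e = "ZZ (- int (Suc k)) (2 * int (Suc k))"
    have "?e - ZZ (-1) 2 = ZZ (- int k) (2 * int k)" by (simp add: zz_eq_iff)
    moreover have "?e - ZZ 2 (-1) \<notin> keys ?f" using Suc.IH(1)[of "?e - ZZ 2 (-1)"] by (auto simp: dg_def)
    moreover have "?e \<notin> keys (lrem p q * ?f)" using R[of ?e] by (auto simp: dg_def)
    ultimately show ?thesis unfolding L using Suc.IH(3) by (simp add: in_keys_iff)
  qed
qed

lemma lookup_monom_mult: "lookup (lx ^ i * ly ^ j * f) e = lookup f (e - ZZ (int i) (int j))"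
  by (simp add: lx_power ly_power mult_single zz_add lookup_mono_mult)

lemma keys_monom:
  assumes "e \<in> keys (cst c * (lx ^ i * ly ^ j * lz p q ^ k))"
  shows "dg e \<le> int (i + j + k)"
    and "dg e = int (i + j + k) \<Longrightarrow> int i - int k \<le> fx e \<and> fx e \<le> int i + 2 * int k"
proof -
  have "e - ZZ (int i) (int j) \<in> keys (lz p q ^ k)"
    using assms by (auto simp: in_keys_iff lookup_mono_mult lookup_monom_mult)
  from lz_power(1)[OF this] show "dg e \<le> int (i + j + k)"
    "dg e = int (i + j + k) \<Longrightarrow> int i - int k \<le> fx e \<and> fx e \<le> int i + 2 * int k"
    by (auto simp: dg_def)
qed

lemma fil_dg: "f \<in> fil p q d \<Longrightarrow> e \<in> keys f \<Longrightarrow> dg e \<le> int d"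
proof (induction f rule: fil.induct)
  case (fil_step f i j k c)
  then show ?case
    using keys_add[of f "cst c * (lx ^ i * ly ^ j * lz p q ^ k)"] keys_monom(1)[of e c i j p q k] by force
qed simp

definition box :: "nat \<Rightarrow> zz set" where
  "box d = {e. \<bar>fx e\<bar> \<le> 2 * int d \<and> \<bar>fy e\<bar> \<le> 2 * int d}"

lemma finite_box: "finite (box d)"
proof -
  have "box d \<subseteq> (\<lambda>(a, b). ZZ a b) ` ({- 2 * int d..2 * int d} \<times> {- 2 * int d..2 * int d})"
  proof
    fix e assume "e \<in> box d"
    then have "e = (\<lambda>(a, b). ZZ a b) (fx e, fy e)"
      "(fx e, fy e) \<in> {- 2 * int d..2 * int d} \<times> {- 2 * int d..2 * int d}" by (auto simp: box_def)
    then show "e \<in> (\<lambda>(a, b). ZZ a b) ` ({- 2 * int d..2 * int d} \<times> {- 2 * int d..2 * int d})" by blast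
  qed
  then show ?thesis by (rule finite_subset) simp
qed

lemma box_mono: "d \<le> d' \<Longrightarrow> box d \<subseteq> box d'"
  by (auto simp: box_def)

lemma keys_lz: "keys (lz p q) \<subseteq> box 1"
proof
  fix e assume "e \<in> keys (lz p q)"
  then have "e \<in> {ZZ 2 (-1)} \<union> {ZZ (-1) 2} \<union> keys (lrem p q)"
    unfolding lz_expand
    using keys_add[of "mono (ZZ 2 (-1)) 1 + mono (ZZ (-1) 2) 1" "lrem p q"]
      keys_add[of "mono (ZZ 2 (-1)) (1::'a)" "mono (ZZ (-1) 2) 1"]
    by auto
  then show "e \<in> box 1" using keys_lrem[of e p q] by (auto simp: box_def)
qed

lemma keys_lz_power: "keys (lz p q ^ k) \<subseteq> box k"
proof (induction k)
  case (Suc k)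
  show ?case
  proof
    fix e assume "e \<in> keys (lz p q ^ Suc k)"
    then obtain a b where "a \<in> keys (lz p q)" "b \<in> keys (lz p q ^ k)" "e = a + b"
      using keys_multE by (metis power_Suc)
    then have "a \<in> box 1" "b \<in> box k" "e = a + b" using Suc keys_lz by blast+
    then show "e \<in> box (Suc k)" by (auto simp: box_def)
  qed
qed (auto simp: box_def)

lemma fil_box: "f \<in> fil p q d \<Longrightarrow> keys f \<subseteq> box d"
proof (induction f rule: fil.induct)
  case (fil_step f i j k c)
  have "keys (cst c * (lx ^ i * ly ^ j * lz p q ^ k)) \<subseteq> box d"
  proof
    fix e assume "e \<in> keys (cst c * (lx ^ i * ly ^ j * lz p q ^ k))"
    then have "e - ZZ (int i) (int j) \<in> keys (lz p q ^ k)"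
      by (auto simp: in_keys_iff lookup_mono_mult lookup_monom_mult)
    then have "e - ZZ (int i) (int j) \<in> box k" using keys_lz_power by blast
    then show "e \<in> box d" using \<open>i + j + k \<le> d\<close> by (auto simp: box_def)
  qed
  then show ?case using keys_add[of f "cst c * (lx ^ i * ly ^ j * lz p q ^ k)"] fil_step by blast
qed simp

text \<open>Representatives of a basis of \<open>fil n / fil (n - 1)\<close>, indexed by an exponent \<open>e\<close> such that
  \<open>x\<^sup>e y\<^bsup>n - e\<^esup>\<close> occurs with coefficient \<open>1\<close>.\<close>

definition tb :: "'r::comm_ring_1 \<times> 'r \<Rightarrow> 'r \<times> 'r \<Rightarrow> nat \<Rightarrow> int \<Rightarrow> 'r lau" where
  "tb p q n e = (if e < 0 then lx ^ 0 * ly ^ nat (int n + e) * lz p q ^ nat (- e)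
     else if e \<le> int n then lx ^ nat e * ly ^ nat (int n - e) * lz p q ^ 0
     else lx ^ nat (2 * int n - e) * ly ^ 0 * lz p q ^ nat (e - int n))"

text \<open>The index set starts at \<open>- int d\<close>, one above the negative of the degree
  \<open>Suc d\<close>, because the power of \<open>z\<close> alone already appears at the other end
  \<open>2 * int (Suc d)\<close>.\<close>

definition topr :: "'r::comm_ring_1 \<times> 'r \<Rightarrow> 'r \<times> 'r \<Rightarrow> nat \<Rightarrow> 'r lau set" where
  "topr p q d = {f. \<exists>c. f - (\<Sum>e\<in>{- int d..2 * int (Suc d)}. cst (c e) * tb p q (Suc d) e) \<in> fil p q d}"

lemma topr_add:
  assumes "f \<in> topr p q d" "g \<in> topr p q d"
  shows "f + g \<in> topr p q d"
proof -
  let ?I = "{- int d..2 * int (Suc d)}" let ?t = "tb p q (Suc d)"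
  obtain c c' where "f - (\<Sum>e\<in>?I. cst (c e) * ?t e) \<in> fil p q d"
    "g - (\<Sum>e\<in>?I. cst (c' e) * ?t e) \<in> fil p q d" using assms by (auto simp: topr_def)
  then have "f - (\<Sum>e\<in>?I. cst (c e) * ?t e) + (g - (\<Sum>e\<in>?I. cst (c' e) * ?t e)) \<in> fil p q d"
    by (rule fil_add)
  also have "f - (\<Sum>e\<in>?I. cst (c e) * ?t e) + (g - (\<Sum>e\<in>?I. cst (c' e) * ?t e)) =
      f + g - (\<Sum>e\<in>?I. cst (c e + c' e) * ?t e)"
    by (simp add: single_add distrib_right sum.distrib)
  finally show ?thesis by (auto simp: topr_def)
qed

lemma topr_fil: "f \<in> fil p q d \<Longrightarrow> f \<in> topr p q d"
  by (auto simp: topr_def intro!: exI[of _ "\<lambda>_. 0"])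

lemma topr_tb:
  assumes "- int d \<le> e" "e \<le> 2 * int (Suc d)"
  shows "cst c * tb p q (Suc d) e \<in> topr p q d"
proof -
  have "(\<Sum>e'\<in>{- int d..2 * int (Suc d)}. cst (if e' = e then c else 0) * tb p q (Suc d) e') =
      (\<Sum>e'\<in>{- int d..2 * int (Suc d)}. if e' = e then cst c * tb p q (Suc d) e' else 0)"
    by (intro sum.cong) auto
  also have "\<dots> = cst c * tb p q (Suc d) e" using assms by simp
  finally show ?thesis
    by (auto simp: topr_def fil_zero intro!: exI[of _ "\<lambda>e'. if e' = e then c else 0"])
qed

lemma topr_monom: "i + j + k = Suc d \<Longrightarrow> cst c * (lx ^ i * ly ^ j * lz p q ^ k) \<in> topr p q d"
proof (induction k arbitrary: i j c rule: less_induct)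
  case (less k)
  consider "k = 0" | "k > 0" "i = 0" "j > 0" | "k > 0" "j = 0" | "k > 0" "i > 0" "j > 0" by fastforce
  then show ?case
  proof cases
    case 1
    then have "tb p q (Suc d) (int i) = lx ^ i * ly ^ j * lz p q ^ k"
      using less.prems by (simp add: tb_def nat_diff_distrib' flip: of_nat_Suc)
         (metis add_diff_cancel_left')
    then show ?thesis using topr_tb[of d "int i" c p q] less.prems by simp
  next
    case 2
    then have "nat (int (Suc d) + - int k) = j" using less.prems by simp
    then have "tb p q (Suc d) (- int k) = lx ^ i * ly ^ j * lz p q ^ k"
      using 2 by (simp add: tb_def)
    then show ?thesis using topr_tb[of d "- int k" c p q] less.prems 2 by simp
  next
    case 3
    then have "nat (2 * int (Suc d) - int (Suc d + k)) = i" using less.prems by simp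
    then have "tb p q (Suc d) (int (Suc d + k)) = lx ^ i * ly ^ j * lz p q ^ k"
      using 3 by (simp add: tb_def)
    then show ?thesis using topr_tb[of d "int (Suc d + k)" c p q] less.prems 3 by simp
  next
    case 4
    then obtain i' j' k' where ijk: "i = Suc i'" "j = Suc j'" "k = Suc k'" by (meson gr0_implies_Suc)
    then have d: "i' + j' + k' + 2 = d" using less.prems by simp
    let ?m = "lx ^ i' * ly ^ j' * lz p q ^ k'"
    \<comment> \<open>\<open>x y z\<close> is x^3 + y^3 plus this part of degree at most 2. The
      cubes have a smaller exponent of \<open>z\<close>, and the remainder falls into
      \<open>fil p q d\<close>.\<close>
    let ?l = "cst (snd p) * lx\<^sup>2 + cst (fst p) * lx + cst (snd q) * ly\<^sup>2 + cst (fst q) * ly + 1"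
    have "lx ^ i * ly ^ j * lz p q ^ k = ?m * (lx * ly * lz p q)"
      by (simp add: ijk algebra_simps)
    also have "lx * ly * lz p q = lx ^ 3 + ly ^ 3 + ?l"
      using rel_base[of p q] unfolding rel_def cub_def qd_def
      by (simp add: algebra_simps power3_eq_cube power2_eq_square)
    finally have "cst c * (lx ^ i * ly ^ j * lz p q ^ k) =
        cst c * (lx ^ (i' + 3) * ly ^ j' * lz p q ^ k') + cst c * (lx ^ i' * ly ^ (j' + 3) * lz p q ^ k')
        + cst c * ?m * ?l"
      by (simp add: algebra_simps power_add)
    moreover have "cst c * (lx ^ (i' + 3) * ly ^ j' * lz p q ^ k') \<in> topr p q d"
      "cst c * (lx ^ i' * ly ^ (j' + 3) * lz p q ^ k') \<in> topr p q d"
      using less.IH ijk d by simp_all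
    moreover have "cst c * ?m * ?l \<in> topr p q d"
    proof (rule topr_fil)
      have sq: "lx\<^sup>2 \<in> fil p q 2" "ly\<^sup>2 \<in> fil p q 2"
        using fil_monom[of 2 0 0 2 1 p q] fil_monom[of 0 2 0 2 1 p q] by simp_all
      have one: "lx \<in> fil p q 2" "ly \<in> fil p q 2" "1 \<in> fil p q 2"
        using fil_mono[OF fil_gens(1), of 2 p q] fil_mono[OF fil_gens(2), of 2 p q] fil_cst[of 1 p q 2]
        by simp_all
      have c: "cst a * f \<in> fil p q 2" if "f \<in> fil p q 2" for a f
        using fil_mult[OF fil_cst[of a p q 0] that] by (simp only: add_0)
      have "?l \<in> fil p q 2" by (intro fil_add c sq one)
      moreover have "cst c * ?m \<in> fil p q (i' + j' + k')" by (rule fil_monom) simp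
      ultimately have "cst c * ?m * ?l \<in> fil p q (i' + j' + k' + 2)" by (rule fil_mult[rotated])
      then show "cst c * ?m * ?l \<in> fil p q d" unfolding d .
    qed
    ultimately show ?thesis by (auto intro: topr_add)
  qed
qed

lemma fil_topr: "f \<in> fil p q (Suc d) \<Longrightarrow> f \<in> topr p q d"
proof (induction f rule: fil.induct)
  case (fil_step f i j k c)
  have "cst c * (lx ^ i * ly ^ j * lz p q ^ k) \<in> topr p q d"
    using fil_step(2) topr_monom topr_fil[OF fil_monom] by (metis le_SucE)
  then show ?case using fil_step topr_add by blast
qed (auto intro: topr_fil fil_zero)

lemma tb_lead:
  assumes "- int n < e" "e \<le> 2 * int n"
  shows "lookup (tb p q n e) (ZZ e (int n - e)) = 1"
proof -
  consider "e < 0" | "0 \<le> e" "e \<le> int n" | "e > int n" by linarith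
  then show ?thesis
  proof cases
    case 1
    then have "ZZ e (int n - e) - ZZ (int 0) (int (nat (int n + e))) =
        ZZ (- int (nat (- e))) (2 * int (nat (- e)))" using assms by (simp add: zz_eq_iff)
    then show ?thesis using 1 by (simp only: tb_def if_True lookup_monom_mult lz_power(3))
  next
    case 2
    then have "ZZ e (int n - e) - ZZ (int (nat e)) (int (nat (int n - e))) =
        0" by (simp add: zz_eq_iff)
    then show ?thesis using 2 by (simp add: tb_def lookup_monom_mult[of _ _ 1, simplified])
  next
    case 3
    then have "ZZ e (int n - e) - ZZ (int (nat (2 * int n - e))) (int 0) =
        ZZ (2 * int (nat (e - int n))) (- int (nat (e - int n)))" using assms by (simp add: zz_eq_iff)
    then show ?thesis using 3 lz_power(2)[of p q "nat (e - int n)"] assms(2)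
      by (simp add: tb_def lookup_monom_mult[of _ 0, simplified])
  qed
qed

text \<open>Twice the exponent of \<open>z\<close> in the basis element, plus one for those of the
  form x^i z^k with k > 0. For this rank the basis is triangular: an element meets the leading
  monomials of other elements only at smaller rank.\<close>

definition tbk :: "nat \<Rightarrow> int \<Rightarrow> nat" where
  "tbk n e = (if e < 0 then nat (- 2 * e) else if e \<le> int n then 0 else nat (2 * (e - int n) + 1))"

lemma tb_other:
  assumes e: "- int n < e" "e \<le> 2 * int n" and e': "- int n < e'" "e' \<le> 2 * int n"
    and "e' \<noteq> e" "tbk n e' \<le> tbk n e"
  shows "lookup (cst c * tb p q n e') (ZZ e (int n - e)) = 0"
proof (rule ccontr)
  assume "lookup (cst c * tb p q n e') (ZZ e (int n - e)) \<noteq> 0"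
  then have k: "ZZ e (int n - e) \<in> keys (cst c * tb p q n e')" by (simp add: in_keys_iff)
  consider "e' < 0" | "0 \<le> e'" "e' \<le> int n" | "e' > int n" by linarith
  then show False
  proof cases
    case 1
    then have "0 - int (nat (- e')) \<le> e \<and> e \<le> 0 + 2 * int (nat (- e'))"
      using keys_monom(2)[of "ZZ e (int n - e)" c 0 "nat (int n + e')" p q "nat (- e')"] k e' by (simp add: tb_def dg_def)
    then show False using 1 assms by (auto simp: tbk_def split: if_splits)
  next
    case 2
    then have "int (nat e') - 0 \<le> e \<and> e \<le> int (nat e') + 2 * 0"
      using keys_monom(2)[of "ZZ e (int n - e)" c "nat e'" "nat (int n - e')" p q 0] k e' by (simp add: tb_def dg_def)
    then show False using 2 assms by simp
  next
    case 3
    then have "int (nat (2 * int n - e')) - int (nat (e' - int n)) \<le> e \<and>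
        e \<le> int (nat (2 * int n - e')) + 2 * int (nat (e' - int n))"
      using keys_monom(2)[of "ZZ e (int n - e)" c "nat (2 * int n - e')" 0 p q "nat (e' - int n)"] k e'
      by (simp add: tb_def dg_def)
    then show False using 3 assms by (auto simp: tbk_def split: if_splits)
  qed
qed

text \<open>On the top degree part the plane triangle of exponents is too large by one vertex: the
  function \<open>z\<^sup>n\<close> contains both of the monomials \<open>x\<^bsup>2 n\<^esup> y\<^bsup>- n\<^esup>\<close> and \<open>x\<^bsup>- n\<^esup> y\<^bsup>2 n\<^esup>\<close>.  This is the node of the
  cubic curve at infinity.\<close>

lemma fil_support:
  assumes "f \<in> fil p q (Suc d)"
  shows "f \<in> fil p q d \<or> (\<exists>e\<in>keys f. dg e = int (Suc d) \<and> - int d \<le> fx e)"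
proof -
  let ?I = "{- int d..2 * int (Suc d)}" and ?t = "tb p q (Suc d)"
  obtain c where c: "f - (\<Sum>e\<in>?I. cst (c e) * ?t e) \<in> fil p q d"
    using fil_topr[OF assms] by (auto simp: topr_def)
  define S where "S = {e \<in> ?I. c e \<noteq> 0}"
  show ?thesis
  proof (cases "S = {}")
    case True
    then have "(\<Sum>e\<in>?I. cst (c e) * ?t e) = 0" by (intro sum.neutral) (auto simp: S_def)
    then show ?thesis using c by simp
  next
    case False
    have fS: "finite S" by (rule finite_subset[of S ?I]) (auto simp: S_def)
    \<comment> \<open>At the leading monomial of a term of maximal rank no other term contributes,
      by \<open>tb_other\<close>, and the remainder has smaller degree. So this monomial survives in
      \<open>f\<close>.\<close>
    define e where "e = (ARG_MAX (tbk (Suc d)) e. e \<in> S)"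
    have e: "e \<in> S" "\<And>e'. e' \<in> S \<Longrightarrow> tbk (Suc d) e' \<le> tbk (Suc d) e"
    proof -
      obtain e0 where "e0 \<in> S" using False by blast
      moreover have "\<forall>y. y \<in> S \<longrightarrow> tbk (Suc d) y < Suc (Max (tbk (Suc d) ` S))"
        using fS by (simp add: le_imp_less_Suc)
      ultimately show "e \<in> S" "\<And>e'. e' \<in> S \<Longrightarrow> tbk (Suc d) e' \<le> tbk (Suc d) e"
        unfolding e_def using arg_max_nat_lemma[of "\<lambda>e. e \<in> S" e0 "tbk (Suc d)"] by blast+
    qed
    let ?x = "ZZ e (int (Suc d) - e)"
    have eI: "- int (Suc d) < e" "e \<le> 2 * int (Suc d)" "c e \<noteq> 0" using e(1) by (auto simp: S_def)
    have other: "lookup (cst (c e') * ?t e') ?x = 0" if "e' \<in> ?I" "e' \<noteq> e" for e'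
    proof (cases "c e' = 0")
      case False
      then have "e' \<in> S" using that by (simp add: S_def)
      then show ?thesis using that e(2) by (intro tb_other eI) auto
    qed simp
    have "lookup (\<Sum>e\<in>?I. cst (c e) * ?t e) ?x = (\<Sum>e'\<in>?I. lookup (cst (c e') * ?t e') ?x)"
      by (rule lookup_sum)
    also have "\<dots> = (\<Sum>e'\<in>?I. if e' = e then c e else 0)"
    proof (rule sum.cong)
      fix e' assume e': "e' \<in> ?I"
      show "lookup (cst (c e') * ?t e') ?x = (if e' = e then c e else 0)"
      proof (cases "e' = e")
        case True
        then show ?thesis using tb_lead[OF eI(1,2), of p q] by (simp add: lookup_mono_mult)
      qed (use other e' in simp)
    qed simp
    also have "\<dots> = c e" using e(1) by (simp add: S_def)
    finally have "lookup (\<Sum>e\<in>?I. cst (c e) * ?t e) ?x \<noteq> 0" using eI by simp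
    moreover have "?x \<notin> keys (f - (\<Sum>e\<in>?I. cst (c e) * ?t e))"
      using fil_dg[OF c, of ?x] by (auto simp: dg_def)
    ultimately have "?x \<in> keys f" by (auto simp: in_keys_iff lookup_minus)
    moreover have "dg ?x = int (Suc d)" "- int d \<le> fx ?x" using e(1) by (auto simp: dg_def S_def)
    ultimately show ?thesis by blast
  qed
qed

text \<open>The level \<open>d\<close> is chosen minimal. The lower bound on \<open>fx e\<close>
  matters because, when \<open>val V < val U\<close>, the value belonging to an exponent of fixed
  degree decreases with its x-part.\<close>

lemma regular_support:
  obtains (scalar) c where "evb p q P = cst c"
  | (nonscalar) d e where "d \<ge> 1" "evb p q P \<in> fil p q d" "e \<in> keys (evb p q P)" "dg e = int d" "1 - int d \<le> fx e"
proof -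
  define d where "d = (LEAST d. evb p q P \<in> fil p q d)"
  have d: "evb p q P \<in> fil p q d" unfolding d_def using evb_fil by (rule LeastI_ex)
  have m: "evb p q P \<notin> fil p q d'" if "d' < d" for d' using that unfolding d_def by (rule not_less_Least)
  show thesis
  proof (cases d)
    case 0
    then show thesis using fil_0 d scalar by blast
  next
    case (Suc d')
    then obtain e where "e \<in> keys (evb p q P)" "dg e = int (Suc d')" "- int d' \<le> fx e"
      using fil_support[of _ p q d'] d m[of d'] by blast
    then show thesis using d Suc by (intro nonscalar[of d e]) auto
  qed
qed



section \<open>Values of regular functions\<close>

lemma keys_sum: "e \<in> keys (sum g S) \<Longrightarrow> \<exists>s\<in>S. e \<in> keys (g s)"
  for g :: "'i \<Rightarrow> 'r::comm_ring_1 lau"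
  by (metis (no_types, lifting) in_keys_iff lookup_sum sum.neutral)

lemma keys_ev2:
  assumes "e \<in> keys (ev2 cst lx ly H)"
  shows "\<exists>i j. e = ZZ (int i) (int j) \<and> poly.coeff (poly.coeff H j) i \<noteq> 0"
proof -
  let ?S = "{(i, j). poly.coeff (poly.coeff H j) i \<noteq> 0}"
  obtain i j where "(i, j) \<in> ?S" "e \<in> keys (cst (poly.coeff (poly.coeff H j) i) * lx ^ i * ly ^ j)"
    using keys_sum[OF assms[unfolded ev2_supp(2)[OF rhom_cst]]] by auto
  then have "e = ZZ (int i) (int j) \<and> poly.coeff (poly.coeff H j) i \<noteq> 0"
    by (simp add: lx_power ly_power mult_single zz_add split: if_splits)
  then show ?thesis by blast
qed

text \<open>The invariant of the descent: mutations preserve it, and the independence makes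
  \<open>val_ev2\<close> available for \<open>U\<close> and \<open>V\<close>.\<close>

definition good :: "'r::{idom,ring_char_0} lau set \<Rightarrow> 'r \<times> 'r \<Rightarrow> 'r \<times> 'r \<Rightarrow>
    'r lau \<Rightarrow> 'r lau \<Rightarrow> 'r lau \<Rightarrow> bool" where
  "good A p q U V W \<longleftrightarrow> rel cst p q U V W \<and> A = range (ev3 cst U V W) \<and> U \<noteq> 0 \<and> V \<noteq> 0 \<and>
     indep (lexp U) (lexp V)"

text \<open>An identity at the standard triple holds modulo the equation of the surface, hence at
  every point of the surface.\<close>

lemma transfer_eq:
  assumes "rel cst p q U V W" "evb p q P = evb p q Q"
  shows "ev3 cst U V W P = ev3 cst U V W (Q :: 'r::idom poly3)"
proof -
  have "evb p q (P - Q) = 0" using assms(2) by (simp add: rhomD[OF rhom_ev3[OF rhom_cst]])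
  then have "srf p q dvd P - Q" unfolding evb_kernel .
  from ev3_dvd[OF rhom_cst this, of U V W] show ?thesis
    using assms(1) by (simp add: rel_iff[OF rhom_cst] rhomD[OF rhom_ev3[OF rhom_cst]])
qed

text \<open>Because the leading exponents of \<open>U\<close> and \<open>V\<close> are independent, the valuation is monomial with
  respect to the Laurent polynomial ring in \<open>U\<close> and \<open>V\<close>.\<close>

lemma transfer_val:
  assumes g: "good A p q U V W" and e: "e \<in> keys (evb p q P)"
  shows "ev3 cst U V W P \<noteq> 0"
    and "of_int (fx e) * val U + of_int (fy e) * val V \<le> val (ev3 cst U V W P)"
proof -
  \<comment> \<open>The same \<open>H\<close> is read twice: at \<open>lx\<close> and
    \<open>ly\<close> its monomials are found from the support, at \<open>U\<close> and
    \<open>V\<close> they bound the value.\<close>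
  obtain N H where NH: "\<And>u v w. rel cst p q u v w \<Longrightarrow> (u * v) ^ N * ev3 cst u v w P = ev2 cst u v H"
    using clear_z_ev[of p q P] by blast
  let ?f = "ev3 cst U V W P"
  have "lookup ((lx * ly) ^ N * evb p q P) (e + ZZ (int N) (int N)) = lookup (evb p q P) e"
    by (simp add: power_mult_distrib lookup_monom_mult)
  then have "e + ZZ (int N) (int N) \<in> keys (ev2 cst lx ly H)"
    using e unfolding NH[OF rel_base] by (simp add: in_keys_iff)
  then obtain i j where ij: "e + ZZ (int N) (int N) = ZZ (int i) (int j)"
    "poly.coeff (poly.coeff H j) i \<noteq> 0" using keys_ev2 by blast
  then have i: "int i = fx e + int N" "int j = fy e + int N" by (simp_all add: zz_eq_iff)
  have UV: "U \<noteq> 0" "V \<noteq> 0" "indep (lexp U) (lexp V)" and r: "rel cst p q U V W"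
    using g by (auto simp: good_def)
  have "H \<noteq> 0" using ij(2) by auto
  note v = val_ev2[OF UV this]
  have "(U * V) ^ N * ?f \<noteq> 0" unfolding NH[OF r] by (rule v(1))
  then show f: "?f \<noteq> 0" by auto
  have "real i * val U + real j * val V \<le> val ((U * V) ^ N * ?f)" unfolding NH[OF r] by (rule v(2)[OF ij(2)])
  also have "\<dots> = real N * (val U + val V) + val ?f" using UV f by (simp add: val_mult val_power)
  finally have *: "real i * val U + real j * val V \<le> real N * (val U + val V) + val ?f" .
  have "real i = of_int (fx e) + real N" "real j = of_int (fy e) + real N"
    using i by (metis of_int_add of_int_of_nat_eq)+
  then show "of_int (fx e) * val U + of_int (fy e) * val V \<le> val ?f"
    using * by (simp add: algebra_simps)
qed

lemma val_scale: "f = 0 \<or> val f \<le> B \<Longrightarrow> cst c * f = 0 \<or> val (cst c * f) \<le> B"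
  for f :: "'r::idom lau"
  by (cases "c = 0"; cases "f = 0") (auto simp: val_mult val_cst)

lemma cst_bound: "0 \<le> B \<Longrightarrow> cst c = 0 \<or> val (cst c) \<le> B"
  by (cases "c = 0") (simp_all add: val_cst)

lemma cub_lead:
  fixes U :: "'r::idom lau"
  assumes "U \<noteq> 0" "val U > 0"
  shows "cub cst p U \<noteq> 0" "lexp (cub cst p U) = lexp U + lexp U + lexp U" "val (cub cst p U) = 3 * val U"
proof -
  have U3: "U ^ 3 \<noteq> 0" "lexp (U ^ 3) = lexp U + lexp U + lexp U" "val (U ^ 3) = 3 * val U"
    using assms by (simp_all add: val_power power3_eq_cube lexp_mult) (simp add: val_mult)
  let ?l = "cst (snd p) * U\<^sup>2 + cst (fst p) * U + 1"
  have "?l = 0 \<or> val ?l \<le> 2 * val U"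
    using assms by (intro val_add_le val_scale) (simp_all add: val_power)
  then have l: "?l = 0 \<or> val ?l < val (U ^ 3)" using U3 assms by auto
  have c: "cub cst p U = U ^ 3 + ?l"
    by (simp add: cub_def qd_def algebra_simps power2_eq_square power3_eq_cube)
  show "cub cst p U \<noteq> 0" "lexp (cub cst p U) = lexp U + lexp U + lexp U" "val (cub cst p U) = 3 * val U"
    unfolding c using lexp_add[OF U3(1) l] val_add[OF U3(1) l] U3 by simp_all
qed

text \<open>In the quotient of the right side of the relation by \<open>U V\<close> the cube of
  \<open>U\<close> dominates, so \<open>W\<close> behaves like U^2 / V.\<close>

lemma val_W:
  assumes g: "good A p q U V W" and v: "0 < val V" "val V < val U"
  shows "W \<noteq> 0" "val W = 2 * val U - val V"
proof -
  have UV: "U \<noteq> 0" "V \<noteq> 0" and r: "U * V * W = cub cst p U + cub cst q V - 1"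
    using g by (auto simp: good_def rel_def)
  have p: "cub cst p U \<noteq> 0" "val (cub cst p U) = 3 * val U"
    and q: "val (cub cst q V) = 3 * val V"
    using cub_lead[OF UV(1)] cub_lead[OF UV(2)] v by auto
  have "cub cst q V + (- 1) = 0 \<or> val (cub cst q V + (- 1)) \<le> 3 * val V"
    using v q val_cst[of "- 1 :: 'a"] by (intro val_add_le) (auto simp: single_uminus)
  then have "cub cst q V + (- 1) = 0 \<or> val (cub cst q V + (- 1)) < val (cub cst p U)"
    using p v by auto
  from val_add[OF p(1) this] have s: "U * V * W \<noteq> 0" "val (U * V * W) = 3 * val U"
    unfolding r using p by (simp_all add: algebra_simps)
  then show "W \<noteq> 0" by auto
  then have "val (U * V * W) = val U + val V + val W" using UV by (simp add: val_mult)
  then show "val W = 2 * val U - val V" using s by simp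
qed

text \<open>Functions of degree one are linear in \<open>U\<close>, \<open>V\<close>,
  \<open>W\<close>, whose values differ. In degree \<open>d >= 2\<close> the support bound is (d -
  1)(2 val V - val U) + val V; its first factor is positive when multiplied out, so it is least at
  \<open>d = 2\<close>.\<close>

lemma regular_values:
  assumes g: "good A p q U V W" and v: "val V < val U" "2 * val U < 3 * val V" and f: "f \<in> A"
  obtains (const) c where "f = cst c"
  | (one) c0 c2 where "f = cst c0 + cst c2 * V" "c2 \<noteq> 0" "val f = val V"
  | (two) c0 c1 c2 where "f = cst c0 + cst c1 * U + cst c2 * V" "c1 \<noteq> 0" "val f = val U"
  | (three) c0 c1 c2 c3 where "f = cst c0 + cst c1 * U + cst c2 * V + cst c3 * W" "c3 \<noteq> 0"
      "val f = 2 * val U - val V"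
  | (high) "f \<noteq> 0" "3 * val V - val U \<le> val f"
proof -
  have v0: "0 < val V" "0 < val U" using v by linarith+
  have UV: "U \<noteq> 0" "V \<noteq> 0" and r: "rel cst p q U V W" using g by (auto simp: good_def)
  note W = val_W[OF g v0(1) v(1)]
  have "f \<in> range (ev3 cst U V W)" using f g by (simp add: good_def)
  then obtain P where P: "f = ev3 cst U V W P" by (rule imageE)
  note e3 = rhomD[OF rhom_ev3[OF rhom_cst]] ev3_gens[OF rhom_cst]
  show thesis
  proof (cases rule: regular_support[of p q P])
    case (scalar c)
    then have "evb p q P = evb p q (const3 c)" by (simp add: e3)
    from transfer_eq[OF r this] show thesis using const P by (simp add: e3)
  next
    case (nonscalar d e)
    show thesis
    proof (cases "d = 1")
      case True
      then obtain c0 c1 c2 c3 where "evb p q P = cst c0 + cst c1 * lx + cst c2 * ly + cst c3 * lz p q"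
        using fil_1 nonscalar(2) by blast
      then have "evb p q P = evb p q (const3 c0 + const3 c1 * vx + const3 c2 * vy + const3 c3 * vz)"
        by (simp add: e3)
      from transfer_eq[OF r this] have F: "f = cst c0 + cst c1 * U + cst c2 * V + cst c3 * W"
        using P by (simp add: e3)
      show thesis
      proof (cases "c3 = 0")
        case False
        have 3: "cst c3 * W \<noteq> 0" "val (cst c3 * W) = 2 * val U - val V"
          using False W by (simp_all add: val_mult val_cst)
        have "cst c0 + cst c1 * U + cst c2 * V = 0 \<or> val (cst c0 + cst c1 * U + cst c2 * V) \<le> val U"
          using v v0 by (intro val_add_le val_scale cst_bound) auto
        then have "cst c0 + cst c1 * U + cst c2 * V = 0 \<or>
            val (cst c0 + cst c1 * U + cst c2 * V) < val (cst c3 * W)" using 3 v by auto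
        from val_add[OF 3(1) this] show thesis using three[OF F False] 3 F by (simp add: add.commute)
      next
        case c3: True
        show thesis
        proof (cases "c1 = 0")
          case False
          have 3: "cst c1 * U \<noteq> 0" "val (cst c1 * U) = val U"
            using False UV by (simp_all add: val_mult val_cst)
          have "cst c0 + cst c2 * V = 0 \<or> val (cst c0 + cst c2 * V) \<le> val V"
            using v v0 by (intro val_add_le val_scale cst_bound) auto
          then have "cst c0 + cst c2 * V = 0 \<or> val (cst c0 + cst c2 * V) < val (cst c1 * U)"
            using 3 v by auto
          from val_add[OF 3(1) this] show thesis using two[OF _ False, of c0 c2] 3 F c3
            by (simp add: ac_simps)
        next
          case c1: True
          show thesis
          proof (cases "c2 = 0")
            case False
            have 3: "cst c2 * V \<noteq> 0" "val (cst c2 * V) = val V"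
              using False UV by (simp_all add: val_mult val_cst)
            have "cst c0 = 0 \<or> val (cst c0) < val (cst c2 * V)" using 3 v0 cst_bound[of 0 c0] by auto
            from val_add[OF 3(1) this] show thesis using one[OF _ False, of c0] 3 F c3 c1
              by (simp add: ac_simps)
          next
            case True
            then show thesis using const F c1 c3 by simp
          qed
        qed
      qed
    next
      case False
      then have d: "2 \<le> d" using nonscalar by simp
      note t = transfer_val[OF g nonscalar(3)]
      have "3 * val V - val U = 1 * (2 * val V - val U) + val V" by simp
      also have "\<dots> \<le> (real d - 1) * (2 * val V - val U) + val V"
        using d v v0 by (intro add_right_mono mult_right_mono) auto
      also have "\<dots> = real d * val V - (real d - 1) * (val U - val V)" by (simp add: algebra_simps)
      also have "\<dots> \<le> real d * val V + of_int (fx e) * (val U - val V)"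
      proof -
        have "1 - real d \<le> of_int (fx e)" using nonscalar(5)
          by (metis of_int_1 of_int_diff of_int_le_iff of_int_of_nat_eq)
        then have "(1 - real d) * (val U - val V) \<le> of_int (fx e) * (val U - val V)"
          using v by (intro mult_right_mono) auto
        then show ?thesis by (simp add: algebra_simps)
      qed
      also have "\<dots> = of_int (fx e) * val U + of_int (fy e) * val V"
      proof -
        have "real d = of_int (fx e) + of_int (fy e)" using nonscalar(4) unfolding dg_def
          by (metis of_int_add of_int_of_nat_eq)
        then show ?thesis by (simp add: algebra_simps)
      qed
      finally have "3 * val V - val U \<le> val f" using t(2) P by simp
      then show thesis using high t(1) P by simp
    qed
  qed
qed

lemma sqrt5: "2 < sqrt 5" "sqrt 5 < 5 / 2"
proof -
  show "2 < sqrt 5" by (rule real_less_rsqrt) simp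
  show "sqrt 5 < 5 / 2" by (rule real_less_lsqrt) (simp_all add: power2_eq_square)
qed

lemma good_base: "good (range (evb p q)) p q lx ly (lz p q)"
  by (simp add: good_def rel_base lx_ly indep_def)

lemma base_reduced: "val ly < val (lx :: 'r::comm_ring_1 lau)" "2 * val (lx :: 'r lau) < 3 * val (ly :: 'r lau)"
  using sqrt5 by (simp_all add: lx_ly)

text \<open>Forces a regular function of value at most 0 to be constant. This is applied to the
  logarithmic Jacobian, and it makes the coordinates of every good triple positive.\<close>

lemma regular_pos:
  fixes p q :: "'r::{idom,ring_char_0} \<times> 'r"
  assumes "f \<in> range (evb p q)"
  shows "(\<exists>c. f = cst c) \<or> val f \<ge> 2"
  by (cases rule: regular_values[OF good_base base_reduced assms(1)]) (use sqrt5 in \<open>auto simp: lx_ly\<close>)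

text \<open>Since \<open>sqrt 5 - 2 < 1\<close>, the exponent from \<open>regular_support\<close>
  weighs at least \<open>d\<close>. So a value at most \<open>B\<close> bounds the degree, and the
  leading exponent lies in a finite box; 0 is added for the constants.\<close>

lemma finite_values: "finite {v. \<exists>f\<in>range (evb p q). f \<noteq> 0 \<and> v = val f \<and> v \<le> B}"
proof (rule finite_subset)
  show "{v. \<exists>f\<in>range (evb p q). f \<noteq> 0 \<and> v = val f \<and> v \<le> B} \<subseteq> insert 0 (wt ` box (nat \<lfloor>B\<rfloor>))"
  proof (clarify, simp only: image_iff)
    fix P assume P: "evb p q P \<noteq> 0" "val (evb p q P) \<le> B" "\<not> (\<exists>e\<in>box (nat \<lfloor>B\<rfloor>). val (evb p q P) = wt e)"
    show "val (evb p q P) = 0"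
    proof (cases rule: regular_support[of p q P])
      case (scalar c)
      then show ?thesis using P(1) val_cst[of c] by auto
    next
      case (nonscalar d e)
      have "1 - real d \<le> of_int (fx e)" using nonscalar(5)
        by (metis of_int_1 of_int_diff of_int_le_iff of_int_of_nat_eq)
      then have "(1 - real d) * (sqrt 5 - 2) \<le> of_int (fx e) * (sqrt 5 - 2)"
        using sqrt5 by (intro mult_right_mono) auto
      moreover have "(real d - 1) * (sqrt 5 - 2) \<le> (real d - 1) * 1"
        using sqrt5 nonscalar(1) by (intro mult_left_mono) auto
      moreover have "real d = of_int (fx e) + of_int (fy e)" using nonscalar(4) unfolding dg_def
        by (metis of_int_add of_int_of_nat_eq)
      ultimately have "real d \<le> wt e" by (simp add: wt_def algebra_simps)
      also have "\<dots> \<le> val (evb p q P)" using nonscalar(3) by (rule val_ge)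
      finally have "d \<le> nat \<lfloor>B\<rfloor>" using P(2) by linarith
      then have "lexp (evb p q P) \<in> box (nat \<lfloor>B\<rfloor>)"
        using lexp_in[OF P(1)] fil_box[OF nonscalar(2)] box_mono by blast
      then show ?thesis using P(3) by (auto simp: val_def)
    qed
  qed
  show "finite (insert 0 (wt ` box (nat \<lfloor>B\<rfloor>)))" using finite_box by simp
qed

section \<open>Linear coordinate changes\<close>

lemma cub_expand:
  "cub cst p (cst l * lx) = mono (ZZ 3 0) (l ^ 3) + mono (ZZ 2 0) (snd p * l\<^sup>2) +
     mono (ZZ 1 0) (fst p * l) + mono (ZZ 0 0) 1"
  "cub cst p (cst l * ly) = mono (ZZ 0 3) (l ^ 3) + mono (ZZ 0 2) (snd p * l\<^sup>2) +
     mono (ZZ 0 1) (fst p * l) + mono (ZZ 0 0) 1"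
  unfolding cub_def qd_def lx_def ly_def mono_zero
  by (simp_all add: distrib_left mult_single zz_add power2_eq_square power3_eq_cube ac_simps)

text \<open>Comparison of coefficients after multiplying out. The monomials xy, x^2 y and x y^2
  occur on one side only, and the constant term gives the product of the three scalars.\<close>

lemma rel_linear_aux:
  fixes l m n :: "'r::idom"
  assumes "rel cst p' q' (cst l * lx) (cst m * ly) (cst n0 + cst n1 * lx + cst n2 * ly + cst n * lz p q)"
    and lm: "l \<noteq> 0" "m \<noteq> 0"
  shows "n0 = 0" "n1 = 0" "n2 = 0" "l * m * n = 1" "l ^ 3 = 1" "m ^ 3 = 1"
    "snd p = l\<^sup>2 * snd p'" "fst p = l * fst p'" "snd q = m\<^sup>2 * snd q'" "fst q = m * fst q'"
proof -
  have b: "lx * ly * lz p q = cub cst p (cst 1 * lx) + cub cst q (cst 1 * ly) - 1"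
    using rel_base[of p q] by (simp add: rel_def)
  have "cst l * lx * (cst m * ly) * (cst n0 + cst n1 * lx + cst n2 * ly + cst n * lz p q) =
      cst (l * m) * (lx * ly) * (cst n0 + cst n1 * lx + cst n2 * ly) + cst (l * m * n) * (lx * ly * lz p q)"
    by (simp add: algebra_simps mult_single)
  also have "\<dots> = mono (ZZ 1 1) (l * m * n0) + mono (ZZ 2 1) (l * m * n1) + mono (ZZ 1 2) (l * m * n2) +
      cst (l * m * n) * (cub cst p (cst 1 * lx) + cub cst q (cst 1 * ly) - 1)"
    unfolding b unfolding lx_def ly_def mono_zero by (simp add: distrib_left mult_single zz_add)
  finally have eq: "mono (ZZ 1 1) (l * m * n0) + mono (ZZ 2 1) (l * m * n1) + mono (ZZ 1 2) (l * m * n2) +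
      cst (l * m * n) * (cub cst p (cst 1 * lx) + cub cst q (cst 1 * ly) - 1) =
      cub cst p' (cst l * lx) + cub cst q' (cst m * ly) - 1"
    using assms(1) by (simp add: rel_def)
  have L: "lookup (mono (ZZ 1 1) (l * m * n0) + mono (ZZ 2 1) (l * m * n1) + mono (ZZ 1 2) (l * m * n2) +
      cst (l * m * n) * (cub cst p (cst 1 * lx) + cub cst q (cst 1 * ly) - 1)) e =
      lookup (cub cst p' (cst l * lx) + cub cst q' (cst m * ly) - 1) e" for e
    unfolding eq ..
  note L = L[unfolded cub_expand mono_zero(2) lookup_add lookup_minus lookup_mono_mult lookup_single, simplified]
  show "n0 = 0" using L[of "ZZ 1 1"] lm by simp
  show "n1 = 0" using L[of "ZZ 2 1"] lm by simp
  show "n2 = 0" using L[of "ZZ 1 2"] lm by simp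
  show k: "l * m * n = 1" using L[of "ZZ 0 0"] by simp
  show l: "l ^ 3 = 1" using L[of "ZZ 3 0"] k by simp
  show m: "m ^ 3 = 1" using L[of "ZZ 0 3"] k by simp
  have "(l * m * n) * snd p = l\<^sup>2 * snd p'" "(l * m * n) * fst p = l * fst p'"
    "(l * m * n) * snd q = m\<^sup>2 * snd q'" "(l * m * n) * fst q = m * fst q'"
    using L[of "ZZ 2 0"] L[of "ZZ 1 0"] L[of "ZZ 0 2"] L[of "ZZ 0 1"] by (simp_all add: mult.commute)
  then show "snd p = l\<^sup>2 * snd p'" "fst p = l * fst p'" "snd q = m\<^sup>2 * snd q'" "fst q = m * fst q'"
    unfolding k by simp_all
qed

text \<open>The subring of polynomials inside the Laurent polynomials, used to detect poles along
  the axes.\<close>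

definition nn :: "'r::comm_ring_1 lau set" where
  "nn = {f. \<forall>e\<in>keys f. 0 \<le> fx e \<and> 0 \<le> fy e}"

lemma nn_closed: "f \<in> nn \<Longrightarrow> g \<in> nn \<Longrightarrow> f + g \<in> nn" "f \<in> nn \<Longrightarrow> g \<in> nn \<Longrightarrow> f - g \<in> nn"
  "f \<in> nn \<Longrightarrow> g \<in> nn \<Longrightarrow> f * g \<in> nn" "cst c \<in> nn" "1 \<in> nn" "lx \<in> nn" "ly \<in> nn"
proof -
  show "f \<in> nn \<Longrightarrow> g \<in> nn \<Longrightarrow> f + g \<in> nn" unfolding nn_def using keys_add[of f g] by blast
  show "f \<in> nn \<Longrightarrow> g \<in> nn \<Longrightarrow> f - g \<in> nn" unfolding nn_def using keys_diff[of f g] by blast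
  show "f * g \<in> nn" if "f \<in> nn" "g \<in> nn"
    unfolding nn_def
  proof (clarify)
    fix e assume "e \<in> keys (f * g)"
    then obtain a b where "a \<in> keys f" "b \<in> keys g" "e = a + b" by (rule keys_multE)
    then show "0 \<le> fx e \<and> 0 \<le> fy e" using that by (auto simp: nn_def)
  qed
qed (auto simp: nn_def lx_def ly_def split: if_splits)

lemma nn_cub: "f \<in> nn \<Longrightarrow> cub cst p f \<in> nn"
  by (simp add: cub_def qd_def power2_eq_square nn_closed)

text \<open>The product of the three forms is a polynomial in \<open>x\<close> and \<open>y\<close>,
  and so are its parts other than \<open>?T * lz p q\<close>. Hence the poles x^2/y and y^2/x of
  \<open>z\<close> must be absorbed, which makes coefficients of \<open>?T\<close> vanish.\<close>

lemma linear_forms: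
  fixes c1 d2 e3 :: "'r::idom"
  assumes r: "rel cst p' q' (cst c0 + cst c1 * lx + cst c2 * ly) (cst d0 + cst d2 * ly)
      (cst e0 + cst e1 * lx + cst e2 * ly + cst e3 * lz p q)"
    and nz: "c1 \<noteq> 0" "d2 \<noteq> 0" "e3 \<noteq> 0"
  shows "c0 = 0" "c2 = 0" "d0 = 0"
proof -
  let ?U = "cst c0 + cst c1 * lx + cst c2 * ly" and ?V = "cst d0 + cst d2 * ly"
    and ?L = "cst e0 + cst e1 * lx + cst e2 * ly"
  let ?T = "cst e3 * (cst (c0 * d0) + cst (c1 * d0) * lx + cst (c2 * d0 + c0 * d2) * ly
      + cst (c2 * d2) * (ly * ly))"
  have "?T * lz p q = ?U * ?V * (?L + cst e3 * lz p q) - ?U * ?V * ?L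
      - cst (e3 * (c1 * d2)) * (lx * ly * lz p q)"
    by (simp only: rhomD(3,4)[OF rhom_cst]) (simp add: algebra_simps)
  also have "\<dots> \<in> nn"
  proof -
    have U: "?U \<in> nn" "?V \<in> nn" "?L \<in> nn" by (intro nn_closed)+
    have "lx * ly * lz p q \<in> nn" using rel_base[of p q] unfolding rel_def
      by (simp add: nn_closed nn_cub)
    moreover have "?U * ?V * (?L + cst e3 * lz p q) \<in> nn" using r U unfolding rel_def
      by (simp only: nn_closed nn_cub)
    ultimately show ?thesis
      by (rule nn_closed(2)[OF nn_closed(2)[OF _ nn_closed(3)[OF nn_closed(3)[OF U(1,2)] U(3)]] nn_closed(3)[OF nn_closed(4)], rotated])
  qed
  finally have T: "?T * lz p q \<in> nn" .
  have T2: "?T * lz p q = mono (ZZ 0 0) (e3 * (c0 * d0)) * lz p q + mono (ZZ 1 0) (e3 * (c1 * d0)) * lz p q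
      + mono (ZZ 0 1) (e3 * (c2 * d0 + c0 * d2)) * lz p q + mono (ZZ 0 2) (e3 * (c2 * d2)) * lz p q"
    unfolding lx_def ly_def mono_zero by (simp add: distrib_left distrib_right mult_single zz_add)
  have lz1: "lookup (lz p q) (ZZ 2 (-1)) = 1" "lookup (lz p q) (ZZ (-1) 2) = 1"
    using lz_power(2,3)[of p q 1] by simp_all
  have lz0: "lookup (lz p q) (ZZ a b) = 0" if "\<bar>a\<bar> > 2 \<or> \<bar>b\<bar> > 2 \<or> a + b > 1" for a b
  proof -
    have "ZZ a b \<notin> keys (lz p q)"
    proof
      assume k: "ZZ a b \<in> keys (lz p q)"
      then have "ZZ a b \<in> box 1" using keys_lz by blast
      moreover have "a + b \<le> 1" using k lz_power(1)[of "ZZ a b" p q 1] by (simp add: dg_def)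
      ultimately show False using that by (simp add: box_def)
    qed
    then show "lookup (lz p q) (ZZ a b) = 0" by (simp add: in_keys_iff)
  qed
  have diff: "ZZ a b - ZZ a' b' = ZZ (a - a') (b - b')" for a b a' b' by (simp add: zz_eq_iff)
  have nn: "lookup (?T * lz p q) (ZZ a b) = 0" if "a < 0 \<or> b < 0" for a b
    using T that by (force simp: nn_def in_keys_iff)
  note L = nn[unfolded T2 lookup_add lookup_mono_mult diff]
  \<comment> \<open>The exponents tested here and below belong to y^2, x and y in \<open>?T\<close>
    times a polar term of \<open>z\<close>.\<close>
  have "e3 * (c2 * d2) = 0" using L[of "-1" 4] lz0 lz1 by simp
  then show c2: "c2 = 0" using nz by simp
  have "e3 * (c1 * d0) = 0" using L[of 3 "-1"] lz0 lz1 by simp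
  then show d0: "d0 = 0" using nz by simp
  have "e3 * (c0 * d2) = 0" using L[of "-1" 3] lz0 lz1 c2 by simp
  then show "c0 = 0" using nz by simp
qed

text \<open>The standard triple and the given one are both reduced, so \<open>regular_values\<close>
  describes the values on one and the same ring in two ways. Their two smallest nonconstant values
  agree, and functions with these values are affine linear forms.\<close>

lemma reduced_linear:
  fixes p q :: "'r::{idom,ring_char_0} \<times> 'r"
  assumes g: "good (range (evb p q)) p' q' U V W" and v: "val V < val U" "2 * val U < 3 * val V"
  obtains l m n where "U = cst l * lx" "V = cst m * ly" "W = cst n * lz p q" "l \<noteq> 0" "m \<noteq> 0"
proof -
  let ?A = "range (evb p q)"
  note rb = regular_values[OF good_base[of p q] base_reduced] and rs = regular_values[OF g v]
  have v0: "0 < val V" "0 < val U" using v by linarith+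
  have r: "rel cst p' q' U V W" and UV: "U \<noteq> 0" "V \<noteq> 0" and A: "?A = range (ev3 cst U V W)"
    using g by (auto simp: good_def)
  have inA: "U \<in> ?A" "V \<in> ?A" "W \<in> ?A"
    unfolding A using ev3_gens[OF rhom_cst, of U V W, symmetric] by (metis rangeI)+
  have lA: "lx \<in> ?A" "ly \<in> ?A"
    using ev3_gens[OF rhom_cst, of lx ly "lz p q", symmetric] by (metis rangeI)+
  note W = val_W[OF g v0(1) v(1)]
  have nc: "f \<noteq> cst c" if "f \<noteq> 0" "val f > 0" for f :: "'r lau" and c
    using that val_cst[of c] by (cases "c = 0") auto
  have ly: "ly \<noteq> (0 :: 'r lau)" "val (ly :: 'r lau) = 2" "lx \<noteq> (0 :: 'r lau)" "val (lx :: 'r lau) = sqrt 5"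
    by (simp_all add: lx_ly)
  have "2 \<le> val V"
    by (cases rule: rb[OF inA(2)]) (use nc[OF UV(2) v0(1)] sqrt5 ly in auto)
  moreover have "val V \<le> 2"
    by (cases rule: rs[OF lA(2)]) (use nc[OF ly(1)] v ly in auto)
  ultimately have vV: "val V = 2" by simp
  have "sqrt 5 \<le> val U"
    by (cases rule: rb[OF inA(1)]) (use nc[OF UV(1) v0(2)] v vV sqrt5 ly in auto)
  moreover have "val U \<le> sqrt 5"
    by (cases rule: rs[OF lA(1)]) (use nc[OF ly(3)] v vV sqrt5 ly in auto)
  ultimately have vU: "val U = sqrt 5" by simp
  have vW: "val W = 2 * sqrt 5 - 2" using W vU vV by simp
  obtain d0 d2 where V: "V = cst d0 + cst d2 * ly" "d2 \<noteq> 0"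
    by (cases rule: rb[OF inA(2)]) (use that nc[OF UV(2) v0(1)] vV sqrt5 ly in auto)
  obtain c0 c1 c2 where U: "U = cst c0 + cst c1 * lx + cst c2 * ly" "c1 \<noteq> 0"
    by (cases rule: rb[OF inA(1)]) (use that nc[OF UV(1) v0(2)] vU sqrt5 ly in auto)
  \<comment> \<open>The slope below 4/3 is used here: 3 sqrt 5 < 8 puts 2 sqrt 5 - 2 below 6 - sqrt
    5, where degree two begins, so \<open>W\<close> has degree one as well.\<close>
  obtain e0 e1 e2 e3 where We: "W = cst e0 + cst e1 * lx + cst e2 * ly + cst e3 * lz p q" "e3 \<noteq> 0"
    by (cases rule: rb[OF inA(3)]) (use that nc[OF W(1)] vW sqrt5 ly in auto)
  have z: "c0 = 0" "c2 = 0" "d0 = 0"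
    using linear_forms[OF r[unfolded U V We] U(2) V(2) We(2)] by auto
  have U': "U = cst c1 * lx" "V = cst d2 * ly" using U V z by simp_all
  have "e0 = 0" "e1 = 0" "e2 = 0"
    using rel_linear_aux(1-3)[OF r[unfolded U' We] U(2) V(2)] by auto
  then have "W = cst e3 * lz p q" using We by simp
  then show thesis using that U' U(2) V(2) by blast
qed



section \<open>Mutations\<close>

definition mutz :: "('a \<Rightarrow> 'b::comm_ring_1) \<Rightarrow> 'a \<times> 'a \<Rightarrow> 'a \<times> 'a \<Rightarrow> 'b \<Rightarrow> 'b \<Rightarrow> 'b \<Rightarrow> 'b" where
  "mutz h p q u v w = w * mutx h p u v w - (u + h (snd p)) * qd h q v"

text \<open>Modulo \<open>v\<close> the functions \<open>u\<close> and \<open>mutx\<close> are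
  inverse to each other, so \<open>mutx\<close> is a root of the reciprocal cubic; hence the swapped
  pair. \<open>mutz\<close> is the quotient by \<open>v\<close> that expresses this.\<close>

lemma mutz_mult:
  assumes "rel h p q u v w"
  shows "v * mutz h p q u v w = qd h (prod.swap p) (mutx h p u v w) + u"
proof -
  let ?m = "mutx h p u v w"
  have 1: "v * w = ?m + qd h p u" by (simp add: mutx_def)
  have 2: "v * qd h q v = u * ?m - 1" unfolding mutx_mult[OF assms] by (simp add: cub_def)
  have "v * mutz h p q u v w = (v * w) * ?m - (u + h (snd p)) * (v * qd h q v)"
    by (simp add: mutz_def algebra_simps)
  also have "\<dots> = qd h (prod.swap p) ?m + u"
    unfolding 1 2 by (simp add: qd_def algebra_simps power2_eq_square)
  finally show ?thesis .
qed

lemma rel_mut: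
  assumes "rel h p q u v w"
  shows "rel h (prod.swap p) q (mutx h p u v w) v (mutz h p q u v w)"
proof -
  let ?m = "mutx h p u v w"
  have "?m * v * mutz h p q u v w = ?m * (v * mutz h p q u v w)" by (simp add: ac_simps)
  also have "\<dots> = ?m * qd h (prod.swap p) ?m + u * ?m"
    unfolding mutz_mult[OF assms] by (simp add: algebra_simps)
  finally show ?thesis unfolding rel_def mutx_mult[OF assms] by (simp add: cub_def)
qed

lemma mutx_mut: "rel h p q u v w \<Longrightarrow> mutx h (prod.swap p) (mutx h p u v w) v (mutz h p q u v w) = u"
  using mutz_mult[of h p q u v w] by (simp add: mutx_def[of h "prod.swap p"])

lemma mutz_mut:
  assumes "rel h p q u v w"
  shows "mutz h (prod.swap p) q (mutx h p u v w) v (mutz h p q u v w) = w"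
proof -
  let ?m = "mutx h p u v w"
  have 1: "v * w = ?m + qd h p u" by (simp add: mutx_def)
  have "mutz h (prod.swap p) q ?m v (mutz h p q u v w) =
      w * (u * ?m) - (u * (u + h (snd p)) + ?m + h (fst p)) * qd h q v"
    unfolding mutz_def[of h "prod.swap p"] mutx_mut[OF assms] by (simp add: mutz_def algebra_simps)
  also have "\<dots> = w + (v * w - qd h p u - ?m) * qd h q v"
    unfolding mutx_mult[OF assms] by (simp add: cub_def qd_def[of h p] algebra_simps power2_eq_square)
  also have "\<dots> = w" by (simp add: 1)
  finally show ?thesis .
qed

type_synonym ('a, 'b) state = "('a \<times> 'a) \<times> ('a \<times> 'a) \<times> 'b \<times> 'b \<times> 'b"

text \<open>\<open>sigma_y\<close> acting on a surface together with a point of it. Conjugation with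
  the exchange of coordinates gives \<open>mx\<close>, which is \<open>sigma_x\<close>.\<close>

fun my :: "('a \<Rightarrow> 'b::comm_ring_1) \<Rightarrow> ('a, 'b) state \<Rightarrow> ('a, 'b) state" where
  "my h (p, q, u, v, w) = (prod.swap p, q, mutx h p u v w, v, mutz h p q u v w)"

fun sw :: "('a, 'b) state \<Rightarrow> ('a, 'b) state" where
  "sw (p, q, u, v, w) = (q, p, v, u, w)"

definition mx :: "('a \<Rightarrow> 'b::comm_ring_1) \<Rightarrow> ('a, 'b) state \<Rightarrow> ('a, 'b) state" where
  "mx h s = sw (my h (sw s))"

fun relS :: "('a \<Rightarrow> 'b::comm_ring_1) \<Rightarrow> ('a, 'b) state \<Rightarrow> bool" where
  "relS h (p, q, u, v, w) \<longleftrightarrow> rel h p q u v w"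

lemma sw_sw [simp]: "sw (sw s) = s" by (cases s) simp

lemma relS_mut: "relS h (sw s) \<longleftrightarrow> relS h s" "relS h s \<Longrightarrow> relS h (my h s)" "relS h s \<Longrightarrow> relS h (mx h s)"
  "relS h s \<Longrightarrow> my h (my h s) = s" "relS h s \<Longrightarrow> mx h (mx h s) = s"
proof -
  show 1: "relS h (sw s) \<longleftrightarrow> relS h s" for s by (cases s) (auto simp: rel_swap)
  show 2: "relS h s \<Longrightarrow> relS h (my h s)" for s by (cases s) (auto intro: rel_mut)
  show 3: "relS h s \<Longrightarrow> my h (my h s) = s" for s by (cases s) (auto simp: mutx_mut mutz_mut)
  show "relS h s \<Longrightarrow> relS h (mx h s)" "relS h s \<Longrightarrow> mx h (mx h s) = s"
    using 1 2[of "sw s"] 3[of "sw s"] by (simp_all add: mx_def)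
qed

inductive_set orb :: "('a \<Rightarrow> 'b::comm_ring_1) \<Rightarrow> ('a, 'b) state \<Rightarrow> ('a, 'b) state set" for h s where
  orb_refl: "s \<in> orb h s"
| orb_my: "t \<in> orb h s \<Longrightarrow> my h t \<in> orb h s"
| orb_mx: "t \<in> orb h s \<Longrightarrow> mx h t \<in> orb h s"

lemma orb_trans: "t \<in> orb h s \<Longrightarrow> r \<in> orb h t \<Longrightarrow> r \<in> orb h s"
  by (rotate_tac, induction r rule: orb.induct) (auto intro: orb.intros)

lemma orb_rel: "t \<in> orb h s \<Longrightarrow> relS h s \<Longrightarrow> relS h t"
  by (induction t rule: orb.induct) (auto intro: relS_mut)

lemma orb_sym: "t \<in> orb h s \<Longrightarrow> relS h s \<Longrightarrow> s \<in> orb h t"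
proof (induction t rule: orb.induct)
  case (orb_my t)
  have "t \<in> orb h (my h t)"
    using orb.orb_my[OF orb_refl, of h "my h t"] relS_mut(4)[OF orb_rel[OF orb_my(1,3)]] by simp
  then show ?case using orb_my orb_trans by blast
next
  case (orb_mx t)
  have "t \<in> orb h (mx h t)"
    using orb.orb_mx[OF orb_refl, of h "mx h t"] relS_mut(5)[OF orb_rel[OF orb_mx(1,3)]] by simp
  then show ?case using orb_mx orb_trans by blast
qed (rule orb_refl)

definition pars :: "('a, 'b) state \<Rightarrow> ('a \<times> 'a) \<times> ('a \<times> 'a)" where
  "pars s = (fst s, fst (snd s))"

lemma pars_simps: "pars (p, q, u, v, w) = (p, q)"
  "pars (my h s) = (prod.swap (fst (pars s)), snd (pars s))"
  "pars (mx h s) = (fst (pars s), prod.swap (snd (pars s)))"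
  by (cases s; simp add: pars_def mx_def)+

lemma orb_pars:
  "t \<in> orb h s \<Longrightarrow> fst (pars t) \<in> {fst (pars s), prod.swap (fst (pars s))} \<and>
     snd (pars t) \<in> {snd (pars s), prod.swap (snd (pars s))}"
proof (induction t rule: orb.induct)
  case (orb_my t)
  then show ?case by (simp only: pars_simps fst_conv snd_conv insert_iff empty_iff) (metis swap_swap)
next
  case (orb_mx t)
  then show ?case by (simp only: pars_simps fst_conv snd_conv insert_iff empty_iff) (metis swap_swap)
qed simp

subsection \<open>The chain of mutations\<close>

primrec chain :: "bool \<Rightarrow> ('a \<Rightarrow> 'b::comm_ring_1) \<Rightarrow> ('a, 'b) state \<Rightarrow> nat \<Rightarrow> ('a, 'b) state" where
  "chain b h s 0 = s"
| "chain b h s (Suc n) = (if even n = b then my h (chain b h s n) else mx h (chain b h s n))"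

text \<open>The orbit of two involutions is a line indexed by the integers. Positive indices begin
  with \<open>my\<close> and negative ones with \<open>mx\<close>, so that the step from
  \<open>k\<close> to \<open>k + 1\<close> depends only on the parity of \<open>k\<close>, also
  across 0.\<close>

definition st :: "('a \<Rightarrow> 'b::comm_ring_1) \<Rightarrow> ('a, 'b) state \<Rightarrow> int \<Rightarrow> ('a, 'b) state" where
  "st h s k = (if 0 \<le> k then chain True h s (nat k) else chain False h s (nat (- k)))"

lemma st_0 [simp]: "st h s 0 = s" by (simp add: st_def)

lemma chain_rel: "relS h s \<Longrightarrow> relS h (chain b h s n)"
  by (induction n) (auto intro: relS_mut)

lemma st_rel: "relS h s \<Longrightarrow> relS h (st h s k)"
  by (simp add: st_def chain_rel)

lemma st_succ:
  assumes "relS h s"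
  shows "st h s (k + 1) = (if even k then my h (st h s k) else mx h (st h s k))"
proof (cases "0 \<le> k")
  case True
  then have "nat (k + 1) = Suc (nat k)" "even (nat k) = even k" by (simp_all add: nat_add_distrib even_nat_iff)
  then show ?thesis using True by (simp add: st_def)
next
  case False
  then obtain n where n: "k = - int (Suc n)" by (metis not_le negD less_eq_int_code(1) linorder_not_le)
  have e: "even k \<longleftrightarrow> odd n" unfolding n by simp
  have s: "st h s k = chain False h s (Suc n)" unfolding n by (simp add: st_def nat_add_distrib)
  have s': "st h s (k + 1) = chain False h s n" unfolding n by (cases n) (simp_all add: st_def nat_add_distrib)
  show ?thesis
    unfolding s s' e using relS_mut(4,5)[OF chain_rel[OF assms, of False n]] by simp
qed

lemma st_pred:
  assumes "relS h s"
  shows "st h s (k - 1) = (if even k then mx h (st h s k) else my h (st h s k))"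
  using st_succ[OF assms, of "k - 1"] relS_mut(4,5)[OF st_rel[OF assms, of "k - 1"]] by auto

lemma orb_st:
  assumes "relS h s" "t \<in> orb h s"
  shows "\<exists>k. t = st h s k"
  using assms(2)
proof (induction t rule: orb.induct)
  case orb_refl
  then show ?case by (metis st_0)
next
  case (orb_my t)
  then show ?case using st_succ[OF assms(1)] st_pred[OF assms(1)] by metis
next
  case (orb_mx t)
  then show ?case using st_succ[OF assms(1)] st_pred[OF assms(1)] by metis
qed

text \<open>The parameters run with period 4 through the surfaces in the definition of
  \<open>sigma\<close>.\<close>

lemma st_pars:
  assumes "relS h s"
  shows "pars (st h s k) =
    ((if k mod 4 \<in> {1, 2} then prod.swap (fst (pars s)) else fst (pars s)),
     (if k mod 4 \<in> {2, 3} then prod.swap (snd (pars s)) else snd (pars s)))"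
proof (induction k rule: int_induct[where k = 0])
  case base
  then show ?case by simp
next
  case (step1 k)
  have "k mod 4 = 0 \<and> (k + 1) mod 4 = 1 \<and> even k \<or> k mod 4 = 1 \<and> (k + 1) mod 4 = 2 \<and> odd k \<or>
      k mod 4 = 2 \<and> (k + 1) mod 4 = 3 \<and> even k \<or> k mod 4 = 3 \<and> (k + 1) mod 4 = 0 \<and> odd k"
    by presburger
  then show ?case using step1 by (elim disjE) (simp_all add: st_succ[OF assms] pars_simps)
next
  case (step2 k)
  have "k mod 4 = 0 \<and> (k - 1) mod 4 = 3 \<and> even k \<or> k mod 4 = 1 \<and> (k - 1) mod 4 = 0 \<and> odd k \<or>
      k mod 4 = 2 \<and> (k - 1) mod 4 = 1 \<and> even k \<or> k mod 4 = 3 \<and> (k - 1) mod 4 = 2 \<and> odd k"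
    by presburger
  then show ?case using step2 by (elim disjE) (simp_all add: st_pred[OF assms] pars_simps)
qed

section \<open>Descent\<close>

fun goodS :: "'r::{idom,ring_char_0} lau set \<Rightarrow> ('r, 'r lau) state \<Rightarrow> bool" where
  "goodS A (p, q, U, V, W) = good A p q U V W"

fun vu :: "('r::zero, 'r lau) state \<Rightarrow> real" where "vu (p, q, U, V, W) = val U"
fun vv :: "('r::zero, 'r lau) state \<Rightarrow> real" where "vv (p, q, U, V, W) = val V"

lemma goodS_rel: "goodS A s \<Longrightarrow> relS cst s"
  by (cases s) (simp add: good_def)

lemma ev3_range_subset:
  assumes "u' \<in> range (ev3 cst u v w)" "v' \<in> range (ev3 cst u v w)" "w' \<in> range (ev3 cst u v w)"
  shows "range (ev3 cst u' v' w') \<subseteq> range (ev3 cst u v (w :: 'r::comm_ring_1 lau))"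
proof -
  note r = rhomD[OF rhom_ev3[OF rhom_cst], of u v w, symmetric]
  have c: "cst c \<in> range (ev3 cst u v w)" for c :: 'r
    using ev3_gens(4)[OF rhom_cst, of u v w c, symmetric] by (rule range_eqI)
  have a: "f + g \<in> range (ev3 cst u v w)" "f * g \<in> range (ev3 cst u v w)"
    if "f \<in> range (ev3 cst u v w)" "g \<in> range (ev3 cst u v w)" for f g
    using that by (auto simp: r)
  have "ev3 cst u' v' w' P \<in> range (ev3 cst u v w)" for P
    by (rule ev3_closed[OF rhom_cst c assms a])
  then show ?thesis by blast
qed

lemma mut_range:
  "mutx cst p u v w \<in> range (ev3 cst u v w)" "v \<in> range (ev3 cst u v w)" "u \<in> range (ev3 cst u v w)"
  "w \<in> range (ev3 cst u v w)" "mutz cst p q u v w \<in> range (ev3 cst u v (w :: 'r::comm_ring_1 lau))"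
proof -
  note r = rhom_ev3[OF rhom_cst, of u v w] and g = ev3_gens[OF rhom_cst, of u v w]
  have m: "mutx cst p u v w = ev3 cst u v w (mutx const3 p vx vy vz)"
    by (simp add: mutx_def rhomD[OF r] qd_hom[OF r] g)
  then show "mutx cst p u v w \<in> range (ev3 cst u v w)" by (rule range_eqI)
  have "mutz cst p q u v w = ev3 cst u v w (mutz const3 p q vx vy vz)"
    unfolding mutz_def m by (simp add: rhomD[OF r] qd_hom[OF r] g)
  then show "mutz cst p q u v w \<in> range (ev3 cst u v w)" by (rule range_eqI)
  show "v \<in> range (ev3 cst u v w)" "u \<in> range (ev3 cst u v w)" "w \<in> range (ev3 cst u v w)"
    by (rule range_eqI, rule g[symmetric])+
qed

lemma good_swap:
  assumes "good A p q U V W"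
  shows "good A q p V U W"
proof -
  have "range (ev3 cst U V W) = range (ev3 cst V U W)"
    by (intro equalityI ev3_range_subset mut_range)
  then show ?thesis using assms by (auto simp: good_def rel_swap indep_def algebra_simps)
qed

text \<open>\<open>U\<close> times its mutation has three times the leading exponent of
  \<open>V\<close>. So the pair of leading exponents changes by an integral matrix of determinant
  -1, and independence persists.\<close>

lemma good_mut:
  assumes g: "good A p q U V W" and v: "val V > 0"
  shows "good A (prod.swap p) q (mutx cst p U V W) V (mutz cst p q U V W)"
    and "val (mutx cst p U V W) = 3 * val V - val U"
proof -
  let ?U = "mutx cst p U V W" and ?W = "mutz cst p q U V W"
  have UV: "U \<noteq> 0" "V \<noteq> 0" and r: "rel cst p q U V W" and i: "indep (lexp U) (lexp V)"
    and A: "A = range (ev3 cst U V W)" using g by (auto simp: good_def)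
  note c = cub_lead[OF UV(2) v, of q]
  have m: "U * ?U = cub cst q V" by (rule mutx_mult[OF r])
  then have U: "?U \<noteq> 0" using c(1) by auto
  have l: "lexp U + lexp ?U = lexp V + lexp V + lexp V"
    using lexp_mult[OF UV(1) U] unfolding m c(2) by simp
  have "val U + val ?U = 3 * val V" using val_mult[OF UV(1) U] unfolding m c(3) by simp
  then show "val ?U = 3 * val V - val U" by simp
  have l': "lexp ?U = lexp V + lexp V + lexp V - lexp U" using l by (simp add: algebra_simps)
  have "indep (lexp ?U) (lexp V)"
    using i unfolding l' indep_def by (simp add: algebra_simps)
  moreover have "range (ev3 cst U V W) = range (ev3 cst ?U V ?W)"
  proof (intro equalityI ev3_range_subset mut_range)
    show "U \<in> range (ev3 cst ?U V ?W)" using mut_range(1)[of "prod.swap p" ?U V ?W] mutx_mut[OF r] by simp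
    show "W \<in> range (ev3 cst ?U V ?W)" using mut_range(5)[of "prod.swap p" q ?U V ?W] mutz_mut[OF r] by simp
  qed
  ultimately show "good A (prod.swap p) q ?U V ?W"
    using UV U rel_mut[OF r] A by (simp add: good_def)
qed

lemma good_pos:
  assumes g: "good (range (evb p0 q0)) p q U V W"
  shows "val U > 0" "val V > 0"
proof -
  have A: "range (evb p0 q0) = range (ev3 cst U V W)" and UV: "U \<noteq> 0" "V \<noteq> 0"
    and i: "indep (lexp U) (lexp V)" using g by (auto simp: good_def)
  have "lexp (cst c) = 0" if "c \<noteq> 0" for c :: 'a using that by (rule lexp_mono)
  then have "U \<noteq> cst c" "V \<noteq> cst c" for c using i UV by (auto simp: indep_def)
  moreover have "U \<in> range (evb p0 q0)" "V \<in> range (evb p0 q0)" unfolding A by (rule mut_range)+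
  ultimately show "val U > 0" "val V > 0" using regular_pos[of U p0 q0] regular_pos[of V p0 q0] by fastforce+
qed

lemma goodS_mut:
  assumes g: "goodS (range (evb p0 q0)) s"
  shows "goodS (range (evb p0 q0)) (my cst s)" "vu (my cst s) = 3 * vv s - vu s" "vv (my cst s) = vv s"
    "goodS (range (evb p0 q0)) (mx cst s)" "vv (mx cst s) = 3 * vu s - vv s" "vu (mx cst s) = vu s"
    "vu s > 0" "vv s > 0"
proof -
  obtain p q U V W where s: "s = (p, q, U, V, W)" by (cases s)
  have g1: "good (range (evb p0 q0)) p q U V W" using g s by simp
  note g2 = good_swap[OF g1] and v = good_pos[OF g1]
  show "goodS (range (evb p0 q0)) (my cst s)" "vu (my cst s) = 3 * vv s - vu s" "vv (my cst s) = vv s"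
    using good_mut[OF g1 v(2)] by (simp_all add: s)
  show "goodS (range (evb p0 q0)) (mx cst s)" "vv (mx cst s) = 3 * vu s - vv s" "vu (mx cst s) = vu s"
    using good_swap[OF good_mut(1)[OF g2 v(1)]] good_mut(2)[OF g2 v(1)] by (simp_all add: s mx_def)
  show "vu s > 0" "vv s > 0" using v s by simp_all
qed

text \<open>The position of a real number in the discrete set of values of regular functions, a
  natural number on which the descent can be based.\<close>

definition rk :: "'r::comm_ring_1 \<times> 'r \<Rightarrow> 'r \<times> 'r \<Rightarrow> real \<Rightarrow> nat" where
  "rk p q B = card {v. \<exists>f\<in>range (evb p q). f \<noteq> 0 \<and> v = val f \<and> v \<le> B}"

lemma rk_less:
  fixes p q :: "'r::{idom,ring_char_0} \<times> 'r"
  assumes "f \<in> range (evb p q)" "f \<noteq> 0" "B < val f"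
  shows "rk p q B < rk p q (val f)"
  unfolding rk_def
proof (rule psubset_card_mono[OF finite_values])
  have "val f \<in> {v. \<exists>g\<in>range (evb p q). g \<noteq> 0 \<and> v = val g \<and> v \<le> val f}"
    using assms(1,2) by (intro CollectI bexI[of _ f]) simp_all
  moreover have "val f \<notin> {v. \<exists>g\<in>range (evb p q). g \<noteq> 0 \<and> v = val g \<and> v \<le> B}" using assms(3) by auto
  moreover have "{v. \<exists>g\<in>range (evb p q). g \<noteq> 0 \<and> v = val g \<and> v \<le> B} \<subseteq>
      {v. \<exists>g\<in>range (evb p q). g \<noteq> 0 \<and> v = val g \<and> v \<le> val f}"
    using assms(3) by (intro Collect_mono impI) (meson less_imp_le order_trans)
  ultimately show "{v. \<exists>g\<in>range (evb p q). g \<noteq> 0 \<and> v = val g \<and> v \<le> B} \<subset>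
      {v. \<exists>g\<in>range (evb p q). g \<noteq> 0 \<and> v = val g \<and> v \<le> val f}" by blast
qed

definition reduced :: "('r::zero, 'r lau) state \<Rightarrow> bool" where
  "reduced s \<longleftrightarrow> vv s < vu s \<and> 2 * vu s < 3 * vv s"

lemma goodS_generic:
  assumes "goodS A s" "of_int i * vu s + of_int j * vv s = of_int i' * vu s + of_int j' * vv s"
  shows "i = i' \<and> j = j'"
proof -
  obtain p q U V W where s: "s = (p, q, U, V, W)" by (cases s)
  then have "indep (lexp U) (lexp V)" using assms(1) by (simp add: good_def)
  from indep_inj[OF this] assms(2) s show ?thesis by (auto simp: val_def)
qed

lemma goodS_rk:
  assumes "goodS (range (evb p0 q0)) s"
  shows "B < vu s \<Longrightarrow> rk p0 q0 B < rk p0 q0 (vu s)" "B < vv s \<Longrightarrow> rk p0 q0 B < rk p0 q0 (vv s)"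
proof -
  obtain p q U V W where s: "s = (p, q, U, V, W)" by (cases s)
  then have A: "range (evb p0 q0) = range (ev3 cst U V W)" and UV: "U \<noteq> 0" "V \<noteq> 0"
    using assms by (auto simp: good_def)
  have "U \<in> range (evb p0 q0)" "V \<in> range (evb p0 q0)" unfolding A by (rule mut_range)+
  then show "B < vu s \<Longrightarrow> rk p0 q0 B < rk p0 q0 (vu s)" "B < vv s \<Longrightarrow> rk p0 q0 B < rk p0 q0 (vv s)"
    using UV by (simp_all add: s rk_less)
qed

lemma descent:
  assumes "goodS (range (evb p0 q0)) s"
  shows "\<exists>t\<in>orb cst s. goodS (range (evb p0 q0)) t \<and> (reduced t \<or> reduced (sw t))"
  using assms
proof (induction "rk p0 q0 (vu s) + rk p0 q0 (vv s)" arbitrary: s rule: less_induct)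
  case less
  note g = goodS_mut[OF less.prems]
  have sw: "vu (sw s) = vv s" "vv (sw s) = vu s" by (cases s; simp)+
  \<comment> \<open>Independence of the leading exponents excludes the borderline ratios 1, 3/2 and
    2/3.\<close>
  have ne: "vu s \<noteq> vv s" "2 * vu s \<noteq> 3 * vv s" "2 * vv s \<noteq> 3 * vu s"
    using goodS_generic[OF less.prems, of 1 0 0 1] goodS_generic[OF less.prems, of 2 0 0 3]
      goodS_generic[OF less.prems, of 0 2 3 0] by auto
  have "reduced s \<or> reduced (sw s) \<or> 3 * vv s < 2 * vu s \<and> vv s < vu s \<or> 3 * vu s < 2 * vv s \<and> vu s < vv s"
    using ne unfolding reduced_def sw by linarith
  then consider "reduced s" | "reduced (sw s)" | "3 * vv s < 2 * vu s" "vv s < vu s" | "3 * vu s < 2 * vv s" "vu s < vv s"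
    by blast
  then show ?case
  proof cases
    case 1
    then show ?thesis using less.prems orb_refl by blast
  next
    case 2
    then show ?thesis using less.prems orb_refl by blast
  next
    case 3
    then have "rk p0 q0 (vu (my cst s)) < rk p0 q0 (vu s)" using g by (intro goodS_rk(1)[OF less.prems]) simp
    then obtain t where "t \<in> orb cst (my cst s)" "goodS (range (evb p0 q0)) t \<and> (reduced t \<or> reduced (sw t))"
      using less.hyps[of "my cst s"] g by auto
    then show ?thesis using orb_trans[OF orb_my[OF orb_refl]] by blast
  next
    case 4
    then have "rk p0 q0 (vv (mx cst s)) < rk p0 q0 (vv s)" using g by (intro goodS_rk(2)[OF less.prems]) simp
    then obtain t where "t \<in> orb cst (mx cst s)" "goodS (range (evb p0 q0)) t \<and> (reduced t \<or> reduced (sw t))"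
      using less.hyps[of "mx cst s"] g by auto
    then show ?thesis using orb_trans[OF orb_mx[OF orb_refl]] by blast
  qed
qed

subsection \<open>Integral coefficients\<close>

definition ip :: "int \<times> int \<Rightarrow> 'r::ring_1 \<times> 'r" where
  "ip p = (of_int (fst p), of_int (snd p))"

lemma ip_eq_iff: "(ip p :: 'r::ring_char_0 \<times> 'r) = ip q \<longleftrightarrow> p = q"
  by (auto simp: ip_def prod_eq_iff)

lemma ip_swap: "prod.swap (ip p) = ip (prod.swap p)"
  by (simp add: ip_def)

lemma int_cube_inject: "a ^ 3 = b ^ 3 \<longleftrightarrow> a = b" for a b :: int
proof
  assume "a ^ 3 = b ^ 3"
  then have "real_of_int a ^ 3 = real_of_int b ^ 3" by (metis of_int_power)
  then show "a = b" by (metis odd_numeral odd_real_root_power_cancel of_int_eq_iff)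
qed simp

text \<open>Cubing removes \<open>l\<close>, and integers are determined by their cubes, so the
  pairs coincide. The two entries differ, hence one is nonzero and gives l = 1 or l^2 = 1; the
  latter also yields l = 1, because l^3 = 1.\<close>

lemma cube_root_trivial:
  fixes l :: "'r::{idom,ring_char_0}"
  assumes l: "l ^ 3 = 1" and p: "snd (ip p) = l\<^sup>2 * snd (ip p')" "fst (ip p) = l * fst (ip p')"
    and ne: "fst p \<noteq> snd p"
  shows "l = 1 \<and> p = p'"
proof -
  have l6: "(l\<^sup>2) ^ 3 = 1" using l by (metis power_commutes power_mult mult.commute power_one)
  have "(of_int (fst p) :: 'r) ^ 3 = of_int (fst p') ^ 3"
    using p(2) l by (simp add: ip_def power_mult_distrib)
  then have 1: "fst p = fst p'" by (metis int_cube_inject of_int_eq_iff of_int_power)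
  have "(of_int (snd p) :: 'r) ^ 3 = of_int (snd p') ^ 3"
    using p(1) l6 by (simp add: ip_def power_mult_distrib)
  then have 2: "snd p = snd p'" by (metis int_cube_inject of_int_eq_iff of_int_power)
  have "l = 1"
  proof (cases "fst p = 0")
    case False
    then show ?thesis using p(2) 1 by (simp add: ip_def)
  next
    case True
    then have "snd p \<noteq> 0" using ne by simp
    then have "l\<^sup>2 = 1" using p(1) 2 by (simp add: ip_def)
    then show ?thesis using l by (simp add: power3_eq_cube power2_eq_square)
  qed
  then show ?thesis using 1 2 by (simp add: prod_eq_iff)
qed

lemma rel_linear_trivial:
  fixes l m n :: "'r::{idom,ring_char_0}"
  assumes r: "rel cst (ip p') (ip q') (cst l * lx) (cst m * ly) (cst n * lz (ip p) (ip q))"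
    and lm: "l \<noteq> 0" "m \<noteq> 0" and ne: "fst p \<noteq> snd p" "fst q \<noteq> snd q"
  shows "l = 1 \<and> m = 1 \<and> n = 1 \<and> p' = p \<and> q' = q"
proof -
  have "rel cst (ip p') (ip q') (cst l * lx) (cst m * ly) (cst 0 + cst 0 * lx + cst 0 * ly + cst n * lz (ip p) (ip q))"
    using r by simp
  note * = rel_linear_aux(4-)[OF this lm]
  show ?thesis
    using cube_root_trivial[OF *(2) *(4,5) ne(1)] cube_root_trivial[OF *(3) *(6,7) ne(2)] *(1) by simp
qed

lemma good_chain:
  fixes p q :: "int \<times> int" and U V W :: "'r::{idom,ring_char_0} lau"
  assumes ne: "fst p \<noteq> snd p" "fst q \<noteq> snd q" "p \<noteq> q" "p \<noteq> prod.swap q"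
    and g: "good (range (evb (ip p) (ip q))) (ip p) (ip q) U V W"
  shows "\<exists>j. (ip p, ip q, U, V, W) = st cst (ip p, ip q, lx, ly, lz (ip p) (ip q)) (4 * j)"
proof -
  let ?A = "range (evb (ip p) (ip q)) :: 'r lau set"
  let ?b = "(ip p, ip q, lx, ly, lz (ip p) (ip q)) :: ('r, 'r lau) state"
  let ?s = "(ip p, ip q, U, V, W)"
  have gs: "goodS ?A ?s" using g by simp
  obtain t where t: "t \<in> orb cst ?s" "goodS ?A t" "reduced t \<or> reduced (sw t)"
    using descent[OF gs] by blast
  obtain P Q U' V' W' where tt: "t = (P, Q, U', V', W')" by (cases t)
  have "P \<in> {ip p, prod.swap (ip p)}" "Q \<in> {ip q, prod.swap (ip q)}"
    using orb_pars[OF t(1)] by (auto simp: tt pars_simps)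
  then obtain p' q' where pq: "P = ip p'" "Q = ip q'" "p' \<in> {p, prod.swap p}" "q' \<in> {q, prod.swap q}"
    unfolding ip_swap by blast
  have "t = ?b"
    using t(3)
  proof
    assume r: "reduced t"
    have gt: "good ?A (ip p') (ip q') U' V' W'" using t(2) tt pq by simp
    obtain l m n where lmn: "U' = cst l * lx" "V' = cst m * ly" "W' = cst n * lz (ip p) (ip q)" "l \<noteq> 0" "m \<noteq> 0"
      using reduced_linear[OF gt] r tt by (auto simp: reduced_def)
    have "rel cst (ip p') (ip q') (cst l * lx) (cst m * ly) (cst n * lz (ip p) (ip q))"
      using gt lmn by (simp add: good_def)
    from rel_linear_trivial[OF this lmn(4,5) ne(1,2)] show ?thesis using tt pq lmn by simp
  next
    \<comment> \<open>In this case \<open>q'\<close> would be \<open>p\<close>; but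
      \<open>q'\<close> is \<open>q\<close> or its swap, which the hypotheses exclude.\<close>
    assume r: "reduced (sw t)"
    have gt: "good ?A (ip q') (ip p') V' U' W'" using good_swap t(2) tt pq by simp
    obtain l m n where lmn: "V' = cst l * lx" "U' = cst m * ly" "W' = cst n * lz (ip p) (ip q)" "l \<noteq> 0" "m \<noteq> 0"
      using reduced_linear[OF gt] r tt by (auto simp: reduced_def)
    have "rel cst (ip q') (ip p') (cst l * lx) (cst m * ly) (cst n * lz (ip p) (ip q))"
      using gt lmn by (simp add: good_def)
    from rel_linear_trivial[OF this lmn(4,5) ne(1,2)] show ?thesis using pq ne by auto
  qed
  then have "?s \<in> orb cst ?b" using orb_sym[OF t(1) goodS_rel[OF gs]] by simp
  have b: "relS cst ?b" by (simp add: rel_base)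
  obtain k where k: "?s = st cst ?b k" using orb_st[OF b \<open>?s \<in> orb cst ?b\<close>] by blast
  have "pars ?s = pars (st cst ?b k)" unfolding k ..
  \<comment> \<open>Neither cubic is palindromic, so the parameters determine the residue of
    \<open>k\<close> modulo 4.\<close>
  moreover have "prod.swap (ip p) \<noteq> (ip p :: 'r \<times> 'r)" "prod.swap (ip q) \<noteq> (ip q :: 'r \<times> 'r)"
    unfolding ip_swap ip_eq_iff using ne by (auto simp: prod_eq_iff)
  ultimately have "k mod 4 \<notin> {1, 2}" "k mod 4 \<notin> {2, 3}"
    unfolding st_pars[OF b] pars_simps by (auto split: if_splits)
  then have "k mod 4 \<noteq> 1" "k mod 4 \<noteq> 2" "k mod 4 \<noteq> 3" by simp_all
  then have "k = 4 * (k div 4)" by presburger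
  then show ?thesis using k by metis
qed

text \<open>After the first step, each step replaces the coordinate of smaller value and makes it
  the larger one. The first step increases the maximum because 6 - sqrt 5 > sqrt 5. Hence no triple
  repeats and \<open>sigma\<close> has infinite order.\<close>

lemma chain_growth:
  fixes p q :: "'r::{idom,ring_char_0} \<times> 'r"
  defines "b \<equiv> (p, q, lx, ly, lz p q)"
  shows "goodS (range (evb p q)) (chain True cst b n)"
    and "max (vu (chain True cst b n)) (vv (chain True cst b n)) <
      max (vu (chain True cst b (Suc n))) (vv (chain True cst b (Suc n)))"
proof -
  let ?A = "range (evb p q)" and ?c = "chain True cst b"
  show g: "goodS ?A (?c n)" for n
    by (induction n) (auto simp: b_def good_base goodS_mut)
  have "n > 0 \<Longrightarrow> (if odd n then vv (?c n) < vu (?c n) else vu (?c n) < vv (?c n))" for n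
  proof (induction n)
    case (Suc n)
    show ?case
    proof (cases "n = 0")
      case True
      then show ?thesis using goodS_mut[OF g[of 0]] sqrt5 by (simp add: b_def lx_ly)
    next
      case False
      then show ?thesis using Suc goodS_mut[OF g[of n]] by (auto split: if_splits)
    qed
  qed simp
  then show "max (vu (?c n)) (vv (?c n)) < max (vu (?c (Suc n))) (vv (?c (Suc n)))"
  proof (cases "n = 0")
    case True
    then show ?thesis using goodS_mut[OF g[of 0]] sqrt5 by (simp add: b_def lx_ly)
  next
    case False
    then show ?thesis
      using \<open>n > 0 \<Longrightarrow> (if odd n then vv (?c n) < vu (?c n) else vu (?c n) < vv (?c n))\<close>
        goodS_mut[OF g[of n]] by (auto split: if_splits)
  qed
qed

lemma chain_inj: "inj (chain True cst (p, q, lx, ly, lz p q))"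
  for p q :: "'r::{idom,ring_char_0} \<times> 'r"
proof -
  let ?c = "chain True cst (p, q, lx, ly, lz p q)"
  have "strict_mono (\<lambda>n. max (vu (?c n)) (vv (?c n)))"
    unfolding strict_mono_Suc_iff using chain_growth(2)[of p q] by blast
  then have "inj (\<lambda>n. max (vu (?c n)) (vv (?c n)))" by (rule strict_mono_imp_inj_on)
  then show ?thesis unfolding inj_def by metis
qed

text \<open>Write {U, V} = U V k with \<open>k\<close> regular. The support bound for brackets gives
  \<open>lexp k \<le> 0\<close>, so \<open>k\<close> is a nonzero constant. Then the bracket attains
  the exponent \<open>lexp U + lexp V\<close>, where the coefficient contains the determinant of
  \<open>indep\<close>.\<close>

lemma triple_good:
  fixes p q :: "'r::{idom,ring_char_0} \<times> 'r"
  assumes "triple p q U V W (range (evb p q))"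
  shows "good (range (evb p q)) p q U V W"
proof -
  interpret triple p q U V W "range (evb p q)" by fact
  interpret s: triple q p V U W "range (evb p q)" by (rule swap)
  obtain k where k: "k \<in> range (evb p q)" "pb U V = U * V * k"
    using UV_dvd_pb[OF pb_closed] by blast
  have l: "lx \<in> range (evb p q)" "ly \<in> range (evb p q)" by (rule mut_range)+
  have "pb lx ly = lx * (ly :: 'r lau)"
    by (simp add: pb_def lx_def ly_def D_mono)
  then have nz: "pb U V \<noteq> 0" using pb_UV_nonzero[OF l] by (simp add: lx_ly)
  then have k0: "k \<noteq> 0" using k by auto
  have lk: "lexp (pb U V) = lexp U + lexp V + lexp k"
    unfolding k(2) using U_nonzero s.U_nonzero k0 by (simp add: lexp_mult)
  have "lexp (pb U V) \<le> lexp U + lexp V"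
    by (rule lookup_pb(2)[OF U_nonzero s.U_nonzero lexp_in[OF nz]])
  then have "lexp k \<le> 0" unfolding lk by (metis add_le_same_cancel1)
  then have "val k \<le> 0" by (simp add: val_def less_eq_zz_def wt_simps)
  then obtain c where "k = cst c" using regular_pos[OF k(1)] by auto
  then have "lexp k = 0" using k0 by (simp add: lexp_mono)
  then have "lexp U + lexp V \<in> keys (pb U V)" using lexp_in[OF nz] unfolding lk by simp
  then have "indep (lexp U) (lexp V)"
    using lookup_pb(1)[OF U_nonzero s.U_nonzero] unfolding in_keys_iff indep_def
    by (metis diff_self mult_zero_left of_int_0)
  then show ?thesis using relation U_nonzero s.U_nonzero A by (simp add: good_def)
qed



section \<open>The automorphism group\<close>

lemma mor_comp_assoc:
  assumes "\<phi> \<in> mor f g" "\<psi> \<in> mor g h" "\<chi> \<in> mor h k"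
  shows "mor_comp k (mor_comp k \<chi> \<psi>) \<phi> = mor_comp k \<chi> (mor_comp h \<psi> \<phi>)"
proof -
  have "\<chi> \<in> coords k \<rightarrow> coords h"
    "\<psi> \<in> coords h \<rightarrow> coords g"
    using assms by (auto simp: mor_def ring_hom_def)
  then show ?thesis by (auto simp: mor_comp_def compose_def fun_eq_iff Pi_def)
qed

lemma cls_srf_eq_iff: "cls (srf p q) P = cls (srf p q) Q \<longleftrightarrow> evb p q P = evb p q Q"
  for P :: "'r::idom poly3"
  using evb_kernel[of p q "P - Q"] by (simp add: cls_eq_iff rhomD[OF rhom_ev3[OF rhom_cst]])

lemma evb_ev3: "evb p q (ev3 const3 P Q T G) = ev3 cst (evb p q P) (evb p q Q) (evb p q T) G"
  using ev3_comp[OF rhom_ev3[OF rhom_cst] rhom_const3, of lx ly "lz p q" P Q T G]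
  by (simp add: ev3_gens[OF rhom_cst])

text \<open>A morphism from the surface of \<open>p\<close> and \<open>q\<close> is encoded by its target and by the images of the
  coordinates in the Laurent polynomial ring.\<close>

fun repS :: "'r::idom \<times> 'r \<Rightarrow> 'r \<times> 'r \<Rightarrow> ('r poly3 set \<Rightarrow> 'r poly3 set) \<Rightarrow> ('r, 'r lau) state \<Rightarrow> bool" where
  "repS p q \<phi> (p', q', U, V, W) \<longleftrightarrow>
     (\<exists>P Q T. rep (srf p q) (srf p' q') \<phi> P Q T \<and> evb p q P = U \<and> evb p q Q = V \<and> evb p q T = W)"

lemma repS_rel: "repS p q \<phi> s \<Longrightarrow> relS cst s"
proof (cases s)
  case (fields p' q' U V W)
  assume "repS p q \<phi> s"
  then obtain P Q T where P: "rep (srf p q) (srf p' q') \<phi> P Q T" "evb p q P = U" "evb p q Q = V" "evb p q T = W"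
    using fields by auto
  from rep_imp_dvd[OF P(1)] have "evb p q (ev3 const3 P Q T (srf p' q')) = 0" unfolding evb_kernel .
  then show ?thesis unfolding evb_ev3 P(2-) using fields by (simp add: rel_iff[OF rhom_cst])
qed

lemma repS_unique: "repS p q \<phi> s \<Longrightarrow> repS p q \<psi> s \<Longrightarrow> \<phi> = \<psi>"
proof (cases s)
  case (fields p' q' U V W)
  assume a: "repS p q \<phi> s" "repS p q \<psi> s"
  obtain P Q T where 1: "rep (srf p q) (srf p' q') \<phi> P Q T" "evb p q P = U" "evb p q Q = V" "evb p q T = W"
    using a(1) unfolding fields repS.simps by (elim exE conjE)
  obtain P' Q' T' where 2: "rep (srf p q) (srf p' q') \<psi> P' Q' T'" "evb p q P' = U" "evb p q Q' = V" "evb p q T' = W"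
    using a(2) unfolding fields repS.simps by (elim exE conjE)
  show "\<phi> = \<psi>"
    by (rule rep_unique[OF 1(1) 2(1)]) (simp_all only: cls_srf_eq_iff 1 2)
qed

lemma repS_mor: "repS p q \<phi> (p', q', U, V, W) \<Longrightarrow> \<phi> \<in> mor (srf p q) (srf p' q')"
  using rep_mor(1) by auto

lemma repS_id: "repS p q (id_mor (srf p q)) (p, q, lx, ly, lz p q)"
  unfolding repS.simps using rep_id[of "srf p q"]
  by (intro exI[of _ vx] exI[of _ vy] exI[of _ vz]) (simp add: ev3_gens[OF rhom_cst])

section \<open>The generating isomorphisms over an arbitrary base\<close>

definition sy :: "'r::comm_ring_1 \<times> 'r \<Rightarrow> 'r \<times> 'r \<Rightarrow> 'r poly3 set \<Rightarrow> 'r poly3 set" where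
  "sy p q = mor_of (srf p q) (srf (prod.swap p) q) (mutx const3 p vx vy vz) vy (mutz const3 p q vx vy vz)"

definition sx :: "'r::comm_ring_1 \<times> 'r \<Rightarrow> 'r \<times> 'r \<Rightarrow> 'r poly3 set \<Rightarrow> 'r poly3 set" where
  "sx p q = mor_of (srf p q) (srf p (prod.swap q)) vx (mutx const3 q vy vx vz) (mutz const3 q p vy vx vz)"

lemma mut_hom:
  assumes "rhom g"
  shows "g (mutx h p u v w) = mutx (\<lambda>c. g (h c)) p (g u) (g v) (g w)"
    "g (mutz h p q u v w) = mutz (\<lambda>c. g (h c)) p q (g u) (g v) (g w)"
  by (simp_all add: mutz_def mutx_def rhomD[OF assms] qd_hom[OF assms])

lemma rep_sy: "rep (srf p q) (srf (prod.swap p) q) (sy p q)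
    (mutx const3 p vx vy vz) vy (mutz const3 p q vx vy vz)"
  and rep_sx: "rep (srf p q) (srf p (prod.swap q)) (sx p q)
    vx (mutx const3 q vy vx vz) (mutz const3 q p vy vx vz)"
  for p q :: "'r::idom \<times> 'r"
proof -
  note m = mut_hom[OF rhom_ev3[OF rhom_cst]] and g = ev3_gens[OF rhom_cst]
  have "evb p q (ev3 const3 (mutx const3 p vx vy vz) vy (mutz const3 p q vx vy vz) (srf (prod.swap p) q)) = 0"
    unfolding evb_ev3 rel_iff[OF rhom_cst, symmetric] using rel_mut[OF rel_base[of p q]] by (simp add: m g)
  then show "rep (srf p q) (srf (prod.swap p) q) (sy p q)
      (mutx const3 p vx vy vz) vy (mutz const3 p q vx vy vz)"
    unfolding sy_def evb_kernel by (rule mor_of_rep)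
  have "evb p q (ev3 const3 vx (mutx const3 q vy vx vz) (mutz const3 q p vy vx vz) (srf p (prod.swap q))) = 0"
    unfolding evb_ev3 rel_iff[OF rhom_cst, symmetric] rel_swap[of _ p]
    using rel_mut[OF rel_base[of p q, unfolded rel_swap[of _ p]]] by (simp add: m g)
  then show "rep (srf p q) (srf p (prod.swap q)) (sx p q)
      vx (mutx const3 q vy vx vz) (mutz const3 q p vy vx vz)"
    unfolding sx_def evb_kernel by (rule mor_of_rep)
qed

lemma repS_sy:
  assumes "repS p q \<phi> (p', q', U, V, W)"
  shows "repS p q (mor_comp (srf (prod.swap p') q') (sy p' q') \<phi>) (my cst (p', q', U, V, W))"
proof -
  obtain P Q T where P: "rep (srf p q) (srf p' q') \<phi> P Q T" "evb p q P = U" "evb p q Q = V" "evb p q T = W"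
    using assms by auto
  note m = mut_hom[OF rhom_ev3[OF rhom_cst]] and g = ev3_gens[OF rhom_cst]
  show ?thesis
    unfolding my.simps repS.simps
    by (rule exI, rule exI, rule exI, rule conjI, rule rep_comp[OF P(1) rep_sy[of p' q']])
       (simp add: evb_ev3 P m g)
qed

lemma repS_sx:
  assumes "repS p q \<phi> (p', q', U, V, W)"
  shows "repS p q (mor_comp (srf p' (prod.swap q')) (sx p' q') \<phi>) (mx cst (p', q', U, V, W))"
proof -
  obtain P Q T where P: "rep (srf p q) (srf p' q') \<phi> P Q T" "evb p q P = U" "evb p q Q = V" "evb p q T = W"
    using assms by auto
  note m = mut_hom[OF rhom_ev3[OF rhom_cst]] and g = ev3_gens[OF rhom_cst]
  show ?thesis
    unfolding mx_def my.simps sw.simps repS.simps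
    by (rule exI, rule exI, rule exI, rule conjI, rule rep_comp[OF P(1) rep_sx[of p' q']])
       (simp add: evb_ev3 P m g)
qed

text \<open>Mutation is an involution on triples and a morphism is determined by its triple, so the
  mutation of the neighbouring surface is the inverse.\<close>

lemma sy_iso: "sy p q \<in> isos (srf p q) (srf (prod.swap p) q)"
  and sx_iso: "sx p q \<in> isos (srf p q) (srf p (prod.swap q))"
  for p q :: "'r::idom \<times> 'r"
proof -
  have m: "sy p q \<in> mor (srf p q) (srf (prod.swap p) q)" "sx p q \<in> mor (srf p q) (srf p (prod.swap q))" for p q :: "'r \<times> 'r"
    using rep_mor(1)[OF rep_sy[of p q]] rep_mor(1)[OF rep_sx[of p q]] by simp_all
  have b: "relS cst (p, q, lx, ly, lz p q)" for p q :: "'r \<times> 'r" by (simp add: rel_base)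
  have y: "mor_comp (srf p q) (sy (prod.swap p) q) (sy p q) = id_mor (srf p q)" for p q :: "'r \<times> 'r"
  proof -
    have "repS p q (sy p q) (my cst (p, q, lx, ly, lz p q))"
      using repS_sy[OF repS_id[of p q]] mor_comp_id(2)[OF m(1)] by simp
    then have "repS p q (mor_comp (srf p q) (sy (prod.swap p) q) (sy p q)) (my cst (my cst (p, q, lx, ly, lz p q)))"
      using repS_sy[of p q "sy p q" "prod.swap p" q] by simp
    then show ?thesis unfolding relS_mut(4)[OF b] by (rule repS_unique[OF _ repS_id])
  qed
  have x: "mor_comp (srf p q) (sx p (prod.swap q)) (sx p q) = id_mor (srf p q)" for p q :: "'r \<times> 'r"
  proof -
    have "repS p q (sx p q) (mx cst (p, q, lx, ly, lz p q))"
      using repS_sx[OF repS_id[of p q]] mor_comp_id(2)[OF m(2)] by simp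
    then have "repS p q (mor_comp (srf p q) (sx p (prod.swap q)) (sx p q)) (mx cst (mx cst (p, q, lx, ly, lz p q)))"
      using repS_sx[of p q "sx p q" p "prod.swap q"] by (simp add: mx_def)
    then show ?thesis unfolding relS_mut(5)[OF b] by (rule repS_unique[OF _ repS_id])
  qed
  show "sy p q \<in> isos (srf p q) (srf (prod.swap p) q)"
    using isosI[OF m(1)[of p q] _ _ y[of p q]] m(1)[of "prod.swap p" q] y[of "prod.swap p" q] by simp
  show "sx p q \<in> isos (srf p q) (srf p (prod.swap q))"
    using isosI[OF m(2)[of p q] _ _ x[of p q]] m(2)[of p "prod.swap q"] x[of p "prod.swap q"] by simp
qed

definition sg :: "'r::comm_ring_1 \<times> 'r \<Rightarrow> 'r \<times> 'r \<Rightarrow> 'r poly3 set \<Rightarrow> 'r poly3 set" where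
  "sg p q = mor_comp (srf p q) (sx p (prod.swap q))
     (mor_comp (srf p (prod.swap q)) (sy (prod.swap p) (prod.swap q))
       (mor_comp (srf (prod.swap p) (prod.swap q)) (sx (prod.swap p) q) (sy p q)))"

lemma sg_steps:
  fixes p q :: "'r::idom \<times> 'r"
  shows "sg p q \<in> isos (srf p q) (srf p q)"
    and "\<phi> \<in> mor f (srf p q) \<Longrightarrow> mor_comp (srf p q) (sg p q) \<phi> =
      mor_comp (srf p q) (sx p (prod.swap q))
        (mor_comp (srf p (prod.swap q)) (sy (prod.swap p) (prod.swap q))
          (mor_comp (srf (prod.swap p) (prod.swap q)) (sx (prod.swap p) q)
            (mor_comp (srf (prod.swap p) q) (sy p q) \<phi>)))"
proof -
  note y = sy_iso[of p q] and x = sx_iso[of "prod.swap p" q] and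
    y' = sy_iso[of "prod.swap p" "prod.swap q", unfolded swap_swap] and
    x' = sx_iso[of p "prod.swap q", unfolded swap_swap]
  note c1 = isos_comp[OF y x] note c2 = isos_comp[OF c1 y']
  have m: "\<phi> \<in> isos f g \<Longrightarrow> \<phi> \<in> mor f g" for f g :: "'r poly3" and \<phi> by (simp add: isos_def)
  show "sg p q \<in> isos (srf p q) (srf p q)" unfolding sg_def by (rule isos_comp[OF c2 x'])
  show "mor_comp (srf p q) (sg p q) \<phi> =
      mor_comp (srf p q) (sx p (prod.swap q))
        (mor_comp (srf p (prod.swap q)) (sy (prod.swap p) (prod.swap q))
          (mor_comp (srf (prod.swap p) (prod.swap q)) (sx (prod.swap p) q)
            (mor_comp (srf (prod.swap p) q) (sy p q) \<phi>)))" if \<phi>: "\<phi> \<in> mor f (srf p q)"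
    unfolding sg_def mor_comp_assoc[OF \<phi> m[OF c2] m[OF x']] mor_comp_assoc[OF \<phi> m[OF c1] m[OF y']]
      mor_comp_assoc[OF \<phi> m[OF y] m[OF x]] ..
qed

text \<open>Composing a mutation after a morphism mutates the triple of the morphism, so
  \<open>sg\<close> advances the chain by four steps.\<close>

lemma repS_sg:
  assumes "repS p q \<phi> (p, q, U, V, W)"
  shows "repS p q (mor_comp (srf p q) (sg p q) \<phi>) (mx cst (my cst (mx cst (my cst (p, q, U, V, W)))))"
proof -
  obtain U1 V1 W1 where 1: "my cst (p, q, U, V, W) = (prod.swap p, q, U1, V1, W1)" by simp
  obtain U2 V2 W2 where 2: "mx cst (prod.swap p, q, U1, V1, W1) = (prod.swap p, prod.swap q, U2, V2, W2)"
    by (simp add: mx_def)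
  obtain U3 V3 W3 where 3: "my cst (prod.swap p, prod.swap q, U2, V2, W2) = (p, prod.swap q, U3, V3, W3)" by simp
  show ?thesis
    unfolding sg_steps(2)[OF repS_mor[OF assms]] 1 2 3
    using repS_sx[OF repS_sy[OF repS_sx[OF repS_sy[OF assms, unfolded 1], unfolded 2], unfolded 3 swap_swap]]
    by (simp only: swap_swap)
qed

text \<open>The integers and the complex numbers are both instances of the type of scalars. An
  \<open>ord\<close> of 0 encodes infinite order; it later separates the powers of the
  generator.\<close>

lemma Aut_infinite_cyclic:
  fixes p q :: "int \<times> int"
  assumes ne: "fst p \<noteq> snd p" "fst q \<noteq> snd q" "p \<noteq> q" "p \<noteq> prod.swap q"
  defines "f \<equiv> srf (ip p) (ip q) :: 'r::{idom,ring_char_0} poly3"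
  shows "infinite_cyclic_gen (Aut f) (sg (ip p) (ip q))"
    and "group.ord (Aut f) (sg (ip p) (ip q)) = 0"
    and "carrier (Aut f) = range (\<lambda>k::int. sg (ip p) (ip q) [^]\<^bsub>Aut f\<^esub> k)"
proof -
  let ?p = "ip p :: 'r \<times> 'r" and ?q = "ip q :: 'r \<times> 'r"
  let ?b = "(?p, ?q, lx, ly, lz ?p ?q)" and ?s = "sg ?p ?q"
  let ?R = "repS ?p ?q"
  interpret group "Aut f" by (rule group_Aut)
  have s: "?s \<in> carrier (Aut f)" using sg_steps(1) by (simp add: f_def)
  have b: "relS cst ?b" by (simp add: rel_base)
  have step: "?R (?s \<otimes>\<^bsub>Aut f\<^esub> \<phi>) (st cst ?b (4 * (j + 1)))" if "?R \<phi> (st cst ?b (4 * j))" for \<phi> j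
  proof -
    have "pars (st cst ?b (4 * j)) = (?p, ?q)" by (simp add: st_pars[OF b] pars_simps)
    then obtain U V W where U: "st cst ?b (4 * j) = (?p, ?q, U, V, W)"
      by (cases "st cst ?b (4 * j)") (simp add: pars_def)
    have "4 * (j + 1) = 4 * j + 1 + 1 + 1 + 1" by simp
    then have "st cst ?b (4 * (j + 1)) = mx cst (my cst (mx cst (my cst (st cst ?b (4 * j)))))"
      by (simp only: st_succ[OF b]) simp
    then show ?thesis using repS_sg that unfolding U by (simp add: f_def)
  qed
  have pow: "?R (?s [^]\<^bsub>Aut f\<^esub> n \<otimes>\<^bsub>Aut f\<^esub> \<phi>) (st cst ?b (4 * (j + int n)))"
    if \<phi>: "\<phi> \<in> carrier (Aut f)" "?R \<phi> (st cst ?b (4 * j))" for \<phi> j and n :: nat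
  proof (induction n)
    case 0
    then show ?case using that by (simp del: Aut_simps)
  next
    case (Suc n)
    have "?s [^]\<^bsub>Aut f\<^esub> Suc n \<otimes>\<^bsub>Aut f\<^esub> \<phi> = ?s \<otimes>\<^bsub>Aut f\<^esub> (?s [^]\<^bsub>Aut f\<^esub> n \<otimes>\<^bsub>Aut f\<^esub> \<phi>)"
      using s \<phi> by (simp only: nat_pow_Suc2 m_assoc nat_pow_closed)
    moreover have "j + int (Suc n) = j + int n + 1" by simp
    ultimately show ?case using step[OF Suc] by (simp only:)
  qed
  have id: "?R \<one>\<^bsub>Aut f\<^esub> (st cst ?b (4 * 0))" using repS_id[of ?p ?q] by (simp add: f_def)
  have pow1: "?R (?s [^]\<^bsub>Aut f\<^esub> n) (chain True cst ?b (4 * n))" for n :: nat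
  proof -
    have "st cst ?b (4 * (0 + int n)) = chain True cst ?b (4 * n)" by (simp add: st_def nat_mult_distrib)
    then show ?thesis using pow[OF one_closed id, of n] s by (simp del: Aut_simps)
  qed
  have inj: "n = m" if "?s [^]\<^bsub>Aut f\<^esub> n = ?s [^]\<^bsub>Aut f\<^esub> m" for n m :: nat
  proof -
    \<comment> \<open>Converse of \<open>repS_unique\<close>: once the parameters are known, a
      morphism determines its triple.\<close>
    have st_eq: "t = t'" if a: "?R \<phi> t" "?R \<phi> t'" "pars t = pars t'" for \<phi> t t'
    proof -
      obtain P Q U V W where t: "t = (P, Q, U, V, W)" by (cases t)
      obtain U' V' W' where t': "t' = (P, Q, U', V', W')" using a(3) t by (cases t') (simp add: pars_def)
      obtain P1 Q1 T1 where 1: "rep (srf ?p ?q) (srf P Q) \<phi> P1 Q1 T1" "evb ?p ?q P1 = U" "evb ?p ?q Q1 = V" "evb ?p ?q T1 = W"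
        using a(1) unfolding t repS.simps by (elim exE conjE)
      obtain P2 Q2 T2 where 2: "rep (srf ?p ?q) (srf P Q) \<phi> P2 Q2 T2" "evb ?p ?q P2 = U'" "evb ?p ?q Q2 = V'" "evb ?p ?q T2 = W'"
        using a(2) unfolding t' repS.simps by (elim exE conjE)
      show ?thesis using rep_mor(2)[OF 1(1)] rep_mor(2)[OF 2(1)] 1 2 t t'
        by (simp add: given_by_def cls_srf_eq_iff)
    qed
    have "pars (chain True cst ?b (4 * n)) = (?p, ?q)" for n
    proof -
      have "chain True cst ?b (4 * n) = st cst ?b (4 * int n)" by (simp add: st_def nat_mult_distrib)
      then show ?thesis by (simp add: st_pars[OF b] pars_simps)
    qed
    then have "chain True cst ?b (4 * n) = chain True cst ?b (4 * m)"
      using st_eq[OF pow1[of n] pow1[of m, folded that]] by simp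
    then have "4 * n = 4 * m" using chain_inj[of ?p ?q] by (auto dest: injD)
    then show ?thesis by simp
  qed
  have ex: "\<exists>k::int. \<phi> = ?s [^]\<^bsub>Aut f\<^esub> k" if \<phi>: "\<phi> \<in> carrier (Aut f)" for \<phi>
  proof -
    have iso: "\<phi> \<in> isos f f" using \<phi> by simp
    then have mor: "\<phi> \<in> mor f f" and bij: "bij_betw \<phi> (coords f) (coords f)"
      by (auto simp: isos_def ring_iso_def)
    obtain P Q T where P: "rep f f \<phi> P Q T" using mor_rep_ex[OF mor] by blast
    define U V W where UVW: "U = evb ?p ?q P" "V = evb ?p ?q Q" "W = evb ?p ?q T"
    have r: "?R \<phi> (?p, ?q, U, V, W)" using P by (auto simp: f_def UVW)
    have e: "evb ?p ?q (ev3 const3 P Q T G) = ev3 cst U V W G" for G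
      unfolding evb_ev3 UVW ..
    have c: "\<phi> (cls f G) = cls f (ev3 const3 P Q T G)" for G using P by (simp add: rep_def)
    \<comment> \<open>Injectivity and surjectivity of the automorphism on classes are the two
      assumptions of the locale.\<close>
    have "triple ?p ?q U V W (range (evb ?p ?q))"
    proof
      fix G
      show "ev3 cst U V W G = 0 \<longleftrightarrow> srf ?p ?q dvd G"
      proof
        assume "ev3 cst U V W G = 0"
        then have "cls f (ev3 const3 P Q T G) = cls f (ev3 const3 P Q T 0)"
          unfolding f_def cls_srf_eq_iff e by (simp add: rhomD[OF rhom_ev3[OF rhom_cst]])
        then have "cls f G = cls f 0"
          unfolding c[symmetric] using bij by (auto simp: bij_betw_def inj_on_def)
        then show "srf ?p ?q dvd G" by (simp add: cls_eq_iff f_def)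
      next
        assume "srf ?p ?q dvd G"
        from ev3_dvd[OF rhom_cst this, of U V W] show "ev3 cst U V W G = 0"
          using repS_rel[OF r] by (simp add: rel_iff[OF rhom_cst])
      qed
    next
      show "range (evb ?p ?q) = range (ev3 cst U V W)"
      proof (intro equalityI subsetI)
        fix x assume "x \<in> range (ev3 cst U V W)"
        then show "x \<in> range (evb ?p ?q)" unfolding e[symmetric] by blast
      next
        fix x assume "x \<in> range (evb ?p ?q)"
        then obtain H where H: "x = evb ?p ?q H" by (rule imageE)
        have "cls f H \<in> \<phi> ` coords f" using bij by (simp add: bij_betw_def)
        then obtain G where "cls f H = \<phi> (cls f G)" by (auto simp: carrier_coord)
        then have "cls f H = cls f (ev3 const3 P Q T G)" unfolding c .
        then have "evb ?p ?q H = ev3 cst U V W G" unfolding f_def cls_srf_eq_iff e .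
        then show "x \<in> range (ev3 cst U V W)" unfolding H by (rule range_eqI)
      qed
    qed
    from good_chain[OF ne triple_good[OF this]] obtain j where "(?p, ?q, U, V, W) = st cst ?b (4 * j)" by blast
    then have j: "?R \<phi> (st cst ?b (4 * j))" using r by simp
    show ?thesis
    proof (cases "0 \<le> j")
      case True
      then obtain n where n: "j = int n" using nonneg_int_cases by blast
      have "st cst ?b (4 * j) = chain True cst ?b (4 * n)" by (simp add: n st_def nat_mult_distrib)
      then have "\<phi> = ?s [^]\<^bsub>Aut f\<^esub> n" using repS_unique[OF j] pow1[of n] by simp
      then show ?thesis by (metis int_pow_int)
    next
      case False
      \<comment> \<open>For negative \<open>j\<close>, composing with the power \<open>- j\<close>
        of the generator leads back to the triple of the identity.\<close>
      then have "st cst ?b (4 * (j + int (nat (- j)))) = st cst ?b (4 * 0)" by simp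
      then have "?s [^]\<^bsub>Aut f\<^esub> nat (- j) \<otimes>\<^bsub>Aut f\<^esub> \<phi> = \<one>\<^bsub>Aut f\<^esub>"
        using repS_unique[OF pow[OF \<phi> j, of "nat (- j)"]] id by simp
      then have "inv\<^bsub>Aut f\<^esub> \<phi> = ?s [^]\<^bsub>Aut f\<^esub> nat (- j)"
        by (rule inv_equality[OF _ \<phi> nat_pow_closed[OF s]])
      then have "\<phi> = inv\<^bsub>Aut f\<^esub> (?s [^]\<^bsub>Aut f\<^esub> nat (- j))" using inv_inv[OF \<phi>] by simp
      then show ?thesis using int_pow_neg_int[OF s, of "nat (- j)"] by metis
    qed
  qed
  show c: "carrier (Aut f) = range (\<lambda>k::int. ?s [^]\<^bsub>Aut f\<^esub> k)"
    using ex int_pow_closed[OF s] by (intro equalityI subsetI) (auto simp del: Aut_simps)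
  show o: "ord ?s = 0" unfolding ord_eq_0[OF s] using inj[of _ 0] by (auto simp del: Aut_simps)
  have "infinite (range (\<lambda>n::nat. ?s [^]\<^bsub>Aut f\<^esub> n))"
    by (rule range_inj_infinite) (use inj in \<open>auto simp: inj_def\<close>)
  moreover have "range (\<lambda>n::nat. ?s [^]\<^bsub>Aut f\<^esub> n) \<subseteq> carrier (Aut f)" using s nat_pow_closed by blast
  ultimately have "infinite (carrier (Aut f))" using finite_subset by blast
  then show "infinite_cyclic_gen (Aut f) ?s"
    unfolding infinite_cyclic_gen_def carrier_subgroup_generated_by_singleton[OF s] using s c is_group by blast
qed

section \<open>Base change\<close>

text \<open>\<open>is_base_change\<close> only relates values on classes of integral polynomials.
  \<open>bc\<close> exhibits one integral lift that represents both morphisms, so composites can be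
  followed.\<close>

definition bc :: "int poly3 \<Rightarrow> int poly3 \<Rightarrow> (int poly3 set \<Rightarrow> int poly3 set) \<Rightarrow>
    (complex poly3 set \<Rightarrow> complex poly3 set) \<Rightarrow> bool" where
  "bc f g \<phi> \<psi> \<longleftrightarrow> (\<exists>P Q T. rep f g \<phi> P Q T \<and> rep (cx f) (cx g) \<psi> (cx P) (cx Q) (cx T))"

lemma cx_ev3: "cx (ev3 const3 P Q T G) = ev3 const3 (cx P) (cx Q) (cx T) (cx G)"
proof -
  have "cx (ev3 const3 P Q T G) = ev3 (\<lambda>c. cx (const3 c)) (cx P) (cx Q) (cx T) G"
    by (rule ev3_comp[OF rhom_cx rhom_const3])
  moreover have "ev3 const3 (cx P) (cx Q) (cx T) (cx G) = ev3 (\<lambda>c. cx (const3 c)) (cx P) (cx Q) (cx T) G"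
    by (rule rhom_rep[OF rhom_comp[OF rhom_ev3[OF rhom_const3] rhom_cx]])
       (simp_all add: cx_gens ev3_gens[OF rhom_const3])
  ultimately show ?thesis by simp
qed

lemma cx_dvd: "f dvd g \<Longrightarrow> cx f dvd cx g"
  by (auto simp: dvd_def rhomD[OF rhom_cx])

lemma cls_cx: "cls f P = cls f Q \<Longrightarrow> cls (cx f) (cx P) = cls (cx f) (cx Q)"
  using cx_dvd[of f "P - Q"] by (simp add: cls_eq_iff rhomD[OF rhom_cx])

lemma bc_base_change:
  assumes "bc f g \<phi> \<psi>"
  shows "is_base_change f g \<phi> \<psi>"
proof -
  obtain P Q T where P: "rep f g \<phi> P Q T" "rep (cx f) (cx g) \<psi> (cx P) (cx Q) (cx T)"
    using assms by (auto simp: bc_def)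
  then show ?thesis
    by (auto simp: is_base_change_def rep_def cx_ev3[symmetric] intro!: cls_cx)
qed

text \<open>A complex morphism is determined by the images of the coordinates, and the coordinates
  are integral.\<close>

lemma base_change_unique:
  assumes "\<phi> \<in> mor f g" "\<psi> \<in> mor (cx f) (cx g)" "\<psi>' \<in> mor (cx f) (cx g)"
    and "is_base_change f g \<phi> \<psi>" "is_base_change f g \<phi> \<psi>'"
  shows "\<psi> = \<psi>'"
proof -
  obtain P Q T where P: "rep f g \<phi> P Q T" using mor_rep_ex[OF assms(1)] by blast
  have "rep (cx f) (cx g) \<chi> (cx P) (cx Q) (cx T)"
    if "\<chi> \<in> mor (cx f) (cx g)" "is_base_change f g \<phi> \<chi>" for \<chi>
  proof (rule mor_rep[OF that(1)])
    show "given_by (cx f) (cx g) \<chi> (cx P) (cx Q) (cx T)"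
      using rep_mor(2)[OF P] that(2) unfolding given_by_def is_base_change_def by (metis cx_gens(1-3))
  qed
  then show ?thesis using assms rep_unique by blast
qed

lemma bc_mor: "bc f g \<phi> \<psi> \<Longrightarrow> \<phi> \<in> mor f g \<and> \<psi> \<in> mor (cx f) (cx g)"
  by (auto simp: bc_def intro: rep_mor(1))

lemma bc_unique: "bc f g \<phi> \<psi> \<Longrightarrow> bc f g \<phi> \<psi>' \<Longrightarrow> \<psi> = \<psi>'"
  using base_change_unique bc_base_change bc_mor by blast

lemma bc_exists:
  assumes "\<phi> \<in> mor f g"
  shows "\<exists>\<psi>. bc f g \<phi> \<psi>"
proof -
  obtain P Q T where P: "rep f g \<phi> P Q T" using mor_rep_ex[OF assms(1)] by blast
  have "cx f dvd ev3 const3 (cx P) (cx Q) (cx T) (cx g)"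
    using cx_dvd[OF rep_imp_dvd[OF P]] by (simp add: cx_ev3)
  from rep_exists[OF this] show ?thesis using P by (auto simp: bc_def)
qed

lemma bc_id: "bc f f (id_mor f) (id_mor (cx f))"
  using rep_id[of f] rep_id[of "cx f"] unfolding bc_def by (metis cx_gens(1-3))

lemma bc_comp:
  assumes "bc f g \<phi> \<psi>" "bc g h \<phi>' \<psi>'"
  shows "bc f h (mor_comp h \<phi>' \<phi>) (mor_comp (cx h) \<psi>' \<psi>)"
proof -
  obtain P Q T where P: "rep f g \<phi> P Q T" "rep (cx f) (cx g) \<psi> (cx P) (cx Q) (cx T)"
    using assms(1) by (auto simp: bc_def)
  obtain P' Q' T' where P': "rep g h \<phi>' P' Q' T'" "rep (cx g) (cx h) \<psi>' (cx P') (cx Q') (cx T')"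
    using assms(2) by (auto simp: bc_def)
  show ?thesis
    unfolding bc_def using rep_comp[OF P(1) P'(1)] rep_comp[OF P(2) P'(2)] by (metis cx_ev3)
qed

lemma bc_isos:
  assumes "bc f g \<phi> \<psi>" "\<phi> \<in> isos f g"
  shows "\<psi> \<in> isos (cx f) (cx g)"
    and "bc g f \<phi>' \<psi>' \<Longrightarrow> mor_comp f \<phi>' \<phi> = id_mor f \<Longrightarrow> mor_comp (cx f) \<psi>' \<psi> = id_mor (cx f)"
proof -
  obtain \<phi>' where 1: "\<phi>' \<in> isos g f" "mor_comp g \<phi> \<phi>' = id_mor g" "mor_comp f \<phi>' \<phi> = id_mor f"
    using isos_inverse[OF assms(2)] by blast
  then have "\<phi>' \<in> mor g f" by (simp add: isos_def)
  then obtain \<psi>' where 2: "bc g f \<phi>' \<psi>'" using bc_exists by blast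
  have 3: "mor_comp (cx g) \<psi> \<psi>' = id_mor (cx g)" "mor_comp (cx f) \<psi>' \<psi> = id_mor (cx f)"
    using bc_comp[OF 2 assms(1)] bc_comp[OF assms(1) 2] bc_id bc_unique 1 by metis+
  show "\<psi> \<in> isos (cx f) (cx g)"
    using isosI[OF _ _ 3] bc_mor[OF assms(1)] bc_mor[OF 2] by blast
  show "bc g f \<phi>' \<psi>' \<Longrightarrow> mor_comp f \<phi>' \<phi> = id_mor f \<Longrightarrow> mor_comp (cx f) \<psi>' \<psi> = id_mor (cx f)" for \<phi>' \<psi>'
    using bc_comp[OF assms(1)] bc_id bc_unique by metis
qed

lemma bc_int_pow:
  assumes s: "bc f f s t" "s \<in> carrier (Aut f)"
  shows "bc f f (s [^]\<^bsub>Aut f\<^esub> (k::int)) (t [^]\<^bsub>Aut (cx f)\<^esub> k)"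
proof -
  interpret G: group "Aut f" by (rule group_Aut)
  interpret H: group "Aut (cx f)" by (rule group_Aut)
  have t: "t \<in> carrier (Aut (cx f))" using bc_isos(1)[OF s(1)] s(2) by simp
  have n: "bc f f (s [^]\<^bsub>Aut f\<^esub> n) (t [^]\<^bsub>Aut (cx f)\<^esub> n)" for n :: nat
    by (induction n) (auto simp: bc_id intro: bc_comp s)
  show ?thesis
  proof (cases k rule: int_cases2)
    case (nonneg m)
    then show ?thesis using n[of m] by (simp add: int_pow_int)
  next
    case (nonpos m)
    let ?x = "s [^]\<^bsub>Aut f\<^esub> m" and ?y = "t [^]\<^bsub>Aut (cx f)\<^esub> m"
    have x: "?x \<in> carrier (Aut f)" "?y \<in> carrier (Aut (cx f))" using s t by (auto simp del: Aut_simps)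
    have i: "inv\<^bsub>Aut f\<^esub> ?x \<in> isos f f" using G.inv_closed[OF x(1)] by simp
    then have "inv\<^bsub>Aut f\<^esub> ?x \<in> mor f f" by (simp add: isos_def)
    then obtain y where y: "bc f f (inv\<^bsub>Aut f\<^esub> ?x) y" using bc_exists by blast
    have "y \<in> carrier (Aut (cx f))" using bc_isos(1)[OF y i] by simp
    \<comment> \<open>The base change of the inverse is a left inverse of the base change; in a
      group this identifies it.\<close>
    moreover have "y \<otimes>\<^bsub>Aut (cx f)\<^esub> ?y = \<one>\<^bsub>Aut (cx f)\<^esub>"
      using bc_isos(2)[OF n _ y, of m] G.l_inv[OF x(1)] x by simp
    ultimately have "y = inv\<^bsub>Aut (cx f)\<^esub> ?y" using H.inv_equality x(2) by metis
    then show ?thesis using y nonpos s(2) t by (simp add: G.int_pow_neg_int H.int_pow_neg_int del: Aut_simps)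
  qed
qed

lemma cx_srf: "cx (srf p q) = srf (ip p) (ip q)"
  by (simp add: srf_hom[OF rhom_cx] cx_gens) (simp add: srf_def cub_def qd_def ip_def)

lemma cx_mut: "cx (mutx const3 p u v w) = mutx const3 (ip p) (cx u) (cx v) (cx w)"
  "cx (mutz const3 p q u v w) = mutz const3 (ip p) (ip q) (cx u) (cx v) (cx w)"
  by (simp_all add: mut_hom[OF rhom_cx] cx_gens) (simp_all add: mutz_def mutx_def qd_def ip_def)

lemma bc_sy: "bc (srf p q) (srf (prod.swap p) q) (sy p q) (sy (ip p) (ip q))"
  and bc_sx: "bc (srf p q) (srf p (prod.swap q)) (sx p q) (sx (ip p) (ip q))"
proof -
  show "bc (srf p q) (srf (prod.swap p) q) (sy p q) (sy (ip p) (ip q))"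
    using rep_sy[of p q] rep_sy[of "ip p :: complex \<times> complex" "ip q"] unfolding bc_def cx_srf ip_swap
    by (metis cx_gens(1-3) cx_mut)
  show "bc (srf p q) (srf p (prod.swap q)) (sx p q) (sx (ip p) (ip q))"
    using rep_sx[of p q] rep_sx[of "ip p :: complex \<times> complex" "ip q"] unfolding bc_def cx_srf ip_swap
    by (metis cx_gens(1-3) cx_mut)
qed

lemma bc_sg: "bc (srf p q) (srf p q) (sg p q) (sg (ip p) (ip q))"
proof -
  note c = bc_comp[OF bc_comp[OF bc_comp[OF bc_sy[of p q] bc_sx] bc_sy] bc_sx]
  show ?thesis using c unfolding sg_def cx_srf ip_swap swap_swap .
qed

lemma ip_int [simp]: "ip p = (p :: int \<times> int)"
  by (simp add: ip_def)

section \<open>Linear isomorphisms\<close>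

text \<open>A linear isomorphism scales the standard triple, possibly after an exchange, and the
  relation of the target makes all scalars 1 by \<open>rel_linear_trivial\<close>. As
  \<open>p \<noteq> q\<close>, the identity and \<open>tau\<close> belong to different
  targets.\<close>

lemma linear_isos_srf:
  fixes p q p' q' :: "int \<times> int"
  assumes ne: "fst p \<noteq> snd p" "fst q \<noteq> snd q" "p \<noteq> q"
  defines "f \<equiv> srf (ip p) (ip q) :: 'r::{idom,ring_char_0} poly3" and "g \<equiv> srf (ip p') (ip q')"
  shows "linear_isos f g = (if (p', q') = (p, q) then {id_mor f}
      else if (p', q') = (q, p) then {tau f g} else {})"
proof -
  note e = rhomD[OF rhom_ev3[OF rhom_cst]] ev3_gens[OF rhom_cst]
  have c1: "const3 1 = (1 :: 'r poly3)" by (rule rhomD(2)[OF rhom_const3])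
  have rel_of: "rel cst (ip p') (ip q') (evb (ip p) (ip q) P) (evb (ip p) (ip q) Q) (evb (ip p) (ip q) T)"
    if "rep f g \<phi> P Q T" for \<phi> P Q T
    using rep_imp_dvd[OF that] unfolding f_def g_def evb_kernel[symmetric] evb_ev3 rel_iff[OF rhom_cst] .
  have 1: "p' = p \<and> q' = q \<and> \<phi> = id_mor f"
    if \<phi>: "\<phi> \<in> isos f g" and lmn: "l dvd 1" "m dvd 1" "n dvd 1"
      and gb: "given_by f g \<phi> (const3 l * vx) (const3 m * vy) (const3 n * vz)" for \<phi> l m n
  proof -
    have r: "rep f g \<phi> (const3 l * vx) (const3 m * vy) (const3 n * vz)"
      using \<phi> gb by (intro mor_rep) (auto simp: isos_def)
    have "l \<noteq> 0" "m \<noteq> 0" using lmn by auto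
    from rel_linear_trivial[OF _ this ne(1,2)] rel_of[OF r]
    have *: "l = 1" "m = 1" "n = 1" "p' = p" "q' = q" by (auto simp: e)
    then have gf: "g = f" by (simp add: f_def g_def)
    from rep_unique[OF r[unfolded * gf] rep_id[of f]] show ?thesis using * by (simp add: c1)
  qed
  have 2: "p' = q \<and> q' = p \<and> \<phi> = tau f g"
    if \<phi>: "\<phi> \<in> isos f g" and lmn: "l dvd 1" "m dvd 1" "n dvd 1"
      and gb: "given_by f g \<phi> (const3 m * vy) (const3 l * vx) (const3 n * vz)" for \<phi> l m n
  proof -
    have r: "rep f g \<phi> (const3 m * vy) (const3 l * vx) (const3 n * vz)"
      using \<phi> gb by (intro mor_rep) (auto simp: isos_def)
    have "l \<noteq> 0" "m \<noteq> 0" using lmn by auto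
    from rel_linear_trivial[OF _ this ne(1,2)] rel_of[OF r]
    have *: "l = 1" "m = 1" "n = 1" "q' = p" "p' = q" by (auto simp: e rel_swap[of _ "ip p'"])
    have r': "rep f g \<phi> vy vx vz" using r unfolding *(1-3) by (simp add: c1)
    from rep_unique[OF r' mor_of_rep[OF rep_imp_dvd[OF r']]] show ?thesis
      using * by (simp add: tau_def)
  qed
  have 3: "id_mor f \<in> linear_isos f f"
    using isos_id[of f] rep_mor(2)[OF rep_id[of f]] unfolding linear_isos_def
    by (auto simp: c1 intro!: exI[of _ 1])
  have 4: "tau f g \<in> linear_isos f g" if "p' = q" "q' = p"
  proof -
    have t: "rep (srf a b) (srf b a) (tau (srf a b) (srf b a)) vy vx vz" for a b :: "'r \<times> 'r"
    proof -
      have "evb a b (ev3 const3 vy vx vz (srf b a)) = 0"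
        unfolding evb_ev3 rel_iff[OF rhom_cst, symmetric] using rel_base[of a b] by (simp add: e rel_swap[of _ b])
      then show ?thesis unfolding tau_def evb_kernel by (rule mor_of_rep)
    qed
    have tt: "mor_comp (srf a b) (tau (srf b a) (srf a b)) (tau (srf a b) (srf b a)) = id_mor (srf a b)" for a b :: "'r \<times> 'r"
      using rep_unique[OF rep_comp[OF t[of a b] t[of b a]] rep_id] by (simp add: ev3_gens[OF rhom_const3])
    have "tau f g \<in> isos f g"
      unfolding f_def g_def that by (rule isosI[OF rep_mor(1)[OF t] rep_mor(1)[OF t] tt tt])
    then show ?thesis
      using rep_mor(2)[OF t[of "ip p" "ip q"]] that unfolding linear_isos_def f_def g_def
      by (auto simp: c1 intro!: exI[of _ 1])
  qed
  have "(p', q') = (p, q) \<and> \<phi> = id_mor f \<or> (p', q') = (q, p) \<and> \<phi> = tau f g"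
    if lin: "\<phi> \<in> linear_isos f g" for \<phi>
  proof -
    have \<phi>: "\<phi> \<in> isos f g" using lin by (simp add: linear_isos_def)
    obtain l m n where u: "l dvd 1" "m dvd 1" "n dvd 1"
      and gb: "given_by f g \<phi> (const3 l * vx) (const3 m * vy) (const3 n * vz) \<or>
        given_by f g \<phi> (const3 m * vy) (const3 l * vx) (const3 n * vz)"
      using lin unfolding linear_isos_def by (elim CollectE conjE exE)
    from gb show ?thesis using 1[OF \<phi> u] 2[OF \<phi> u] by (elim disjE) simp_all
  qed
  moreover have "g = f" if "(p', q') = (p, q)" using that by (simp add: f_def g_def)
  ultimately show ?thesis using 3 4 ne(3) by auto
qed

section \<open>Translation to the polynomials of the statement\<close>

definition cubic :: "int \<times> int \<Rightarrow> int poly" where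
  "cubic p = [:1, fst p, snd p, 1:]"

lemma cubic_eq_iff: "cubic p = cubic q \<longleftrightarrow> p = q"
  by (auto simp: cubic_def prod_eq_iff)

lemma const3_int: "const3 k = of_int k"
  using rhomD(8)[OF rhom_const3[where 'a = int], of k] by simp

lemma poly_cubic: "poly (map_poly of_int (cubic p)) u = cub const3 p u"
  for u :: "int poly3"
  by (simp add: cubic_def cub_def qd_def map_poly_pCons const3_int algebra_simps power2_eq_square)

lemma surf_cubic: "surf (cubic p) (cubic q) = srf p q"
  by (simp add: surf_def srf_def poly_cubic)

lemma bar_cubic: "bar (cubic p) = cubic (prod.swap p)"
  by (simp add: bar_def cubic_def numeral_2_eq_2)

lemma quad_cubic: "quad (cubic p) u = qd const3 p u"
  by (simp add: quad_def cubic_def qd_def const3_int numeral_2_eq_2)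

lemma coeff_cubic: "of_int (poly.coeff (cubic p) 2) = const3 (snd p)"
  by (simp add: cubic_def const3_int numeral_2_eq_2)

lemma sigma_cubic: "sigma_y (cubic p) (cubic q) = sy p q" "sigma_x (cubic p) (cubic q) = sx p q"
  "sigma (cubic p) (cubic q) = sg p q"
proof -
  show y: "sigma_y (cubic p) (cubic q) = sy p q" for p q
    unfolding sigma_y_def sy_def surf_cubic bar_cubic quad_cubic coeff_cubic
    by (simp add: mutx_def mutz_def algebra_simps power2_eq_square)
  show x: "sigma_x (cubic p) (cubic q) = sx p q" for p q
    unfolding sigma_x_def sx_def surf_cubic bar_cubic quad_cubic coeff_cubic
    by (simp add: mutx_def mutz_def algebra_simps power2_eq_square)
  show "sigma (cubic p) (cubic q) = sg p q"
    unfolding sigma_def sg_def bar_cubic surf_cubic x y swap_swap ..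
qed

theorem corollary32:
  fixes a1 a2 b1 b2 :: int
    and a b abar bbar :: "int poly"
    and E :: "(int poly \<times> int poly) set"
  assumes "a = [:1, a1, a2, 1:]" and "b = [:1, b1, b2, 1:]"
    and "abar = [:1, a2, a1, 1:]" and "bbar = [:1, b2, b1, 1:]"
    and "a2 \<noteq> a1" and "b2 \<noteq> b1"
    and "(a2, a1) \<noteq> (b2, b1)" and "(b2, b1) \<noteq> (a1, a2)"
    and "E = {(a, b), (abar, b), (a, bbar), (abar, bbar),
              (b, a), (bbar, a), (b, abar), (bbar, abar)}"
  shows
    "(\<forall>(p, q) \<in> E. \<forall>(p', q') \<in> E.
        linear_isos (surf p q) (surf p' q') =
          (if (p', q') = (p, q) then {id_mor (surf p q)}
           else if (p', q') = (q, p) then {tau (surf p q) (surf q p)}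
           else {}) \<and>
        linear_isos (cx (surf p q)) (cx (surf p' q')) =
          (if (p', q') = (p, q) then {id_mor (cx (surf p q))}
           else if (p', q') = (q, p) then {tau (cx (surf p q)) (cx (surf q p))}
           else {})) \<and>
     (infinite_cyclic_gen (Aut (surf a b)) (sigma a b) \<and>
      (\<exists>s \<in> carrier (Aut (cx (surf a b))). is_base_change (surf a b) (surf a b) (sigma a b) s \<and>
          infinite_cyclic_gen (Aut (cx (surf a b))) s) \<and>
      (\<forall>\<psi> \<in> carrier (Aut (cx (surf a b))).
          \<exists>!\<phi>. \<phi> \<in> carrier (Aut (surf a b)) \<and> is_base_change (surf a b) (surf a b) \<phi> \<psi>) \<and>
      (\<forall>\<phi> \<in> carrier (Aut (surf a b)).
          \<exists>!\<psi>. \<psi> \<in> carrier (Aut (cx (surf a b))) \<and> is_base_change (surf a b) (surf a b) \<phi> \<psi>))"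
proof -
  define pa pb where "pa = (a1, a2)" and "pb = (b1, b2)"
  have ab: "a = cubic pa" "b = cubic pb" "abar = cubic (prod.swap pa)" "bbar = cubic (prod.swap pb)"
    using assms(1-4) by (simp_all add: cubic_def pa_def pb_def)
  have ne: "fst pa \<noteq> snd pa" "fst pb \<noteq> snd pb" "pa \<noteq> pb" "pa \<noteq> prod.swap pb"
    using assms(5-8) by (auto simp: pa_def pb_def)
  have pair: "\<exists>u v. (cubic p, cubic q) = (cubic u, cubic v) \<and> fst u \<noteq> snd u \<and> fst v \<noteq> snd v \<and> u \<noteq> v"
    if "fst p \<noteq> snd p" "fst q \<noteq> snd q" "p \<noteq> q" for p q using that by blast
  \<comment> \<open>Each of the eight pairs consists of two different cubics, neither of them
    palindromic; these are the conditions of \<open>linear_isos_srf\<close> on the source.\<close>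
  have E: "\<exists>p q. e = (cubic p, cubic q) \<and> fst p \<noteq> snd p \<and> fst q \<noteq> snd q \<and> p \<noteq> q" if "e \<in> E" for e
    using that ne unfolding assms(9) ab by (elim insertE emptyE; hypsubst; intro pair) (auto simp: prod_eq_iff)
  have linear: "linear_isos (surf p q) (surf p' q') =
          (if (p', q') = (p, q) then {id_mor (surf p q)}
           else if (p', q') = (q, p) then {tau (surf p q) (surf q p)}
           else {}) \<and>
        linear_isos (cx (surf p q)) (cx (surf p' q')) =
          (if (p', q') = (p, q) then {id_mor (cx (surf p q))}
           else if (p', q') = (q, p) then {tau (cx (surf p q)) (cx (surf q p))}
           else {})" (is "?L p q p' q'") if e: "(p, q) \<in> E" "(p', q') \<in> E" for p q p' q'
  proof -
    obtain u v where u: "p = cubic u" "q = cubic v" "fst u \<noteq> snd u" "fst v \<noteq> snd v" "u \<noteq> v"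
      using E[OF e(1)] by auto
    obtain u' v' where u': "p' = cubic u'" "q' = cubic v'" using E[OF e(2)] by auto
    show ?thesis
      using linear_isos_srf[OF u(3-5), of u' v', where 'r = int]
        linear_isos_srf[OF u(3-5), of u' v', where 'r = complex]
      unfolding u(1,2) u' surf_cubic cx_srf prod.inject cubic_eq_iff by auto
  qed
  let ?f = "srf pa pb" and ?s = "sg pa pb" and ?t = "sg (ip pa) (ip pb) :: complex poly3 set \<Rightarrow> _"
  have f: "surf a b = ?f" "sigma a b = ?s" by (simp_all add: ab surf_cubic sigma_cubic)
  note Z = Aut_infinite_cyclic[OF ne, where 'r = int, unfolded ip_int]
  note C = Aut_infinite_cyclic[OF ne, where 'r = complex, folded cx_srf]
  interpret G: group "Aut ?f" by (rule group_Aut)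
  interpret H: group "Aut (cx ?f)" by (rule group_Aut)
  have s: "?s \<in> carrier (Aut ?f)" and t: "?t \<in> carrier (Aut (cx ?f))"
    using Z(1) C(1) by (auto simp: infinite_cyclic_gen_def)
  have bc: "bc ?f ?f (?s [^]\<^bsub>Aut ?f\<^esub> k) (?t [^]\<^bsub>Aut (cx ?f)\<^esub> k)" for k :: int
    by (rule bc_int_pow[OF bc_sg s])
  have mor: "\<phi> \<in> carrier (Aut g) \<Longrightarrow> \<phi> \<in> mor g g" for \<phi> and g :: "'r::comm_ring_1 poly3"
    by (simp add: isos_def)
  have u: "\<psi> = ?t [^]\<^bsub>Aut (cx ?f)\<^esub> k"
    if "\<psi> \<in> carrier (Aut (cx ?f))" "is_base_change ?f ?f (?s [^]\<^bsub>Aut ?f\<^esub> k) \<psi>" for k :: int and \<psi>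
    using base_change_unique[OF _ _ _ that(2) bc_base_change[OF bc]] bc_mor[OF bc] that(1)
    by (auto simp: isos_def)
  \<comment> \<open>Over both rings the automorphisms are the powers of the generator, and base
    change respects powers. The integral form is unique because the complex generator has infinite
    order.\<close>
  have 3: "\<exists>!\<phi>. \<phi> \<in> carrier (Aut ?f) \<and> is_base_change ?f ?f \<phi> \<psi>" if \<psi>: "\<psi> \<in> carrier (Aut (cx ?f))" for \<psi>
  proof -
    obtain k :: int where k: "\<psi> = ?t [^]\<^bsub>Aut (cx ?f)\<^esub> k" using \<psi> unfolding C(3) by (rule rangeE)
    show ?thesis
    proof (rule ex1I)
      show "?s [^]\<^bsub>Aut ?f\<^esub> k \<in> carrier (Aut ?f) \<and> is_base_change ?f ?f (?s [^]\<^bsub>Aut ?f\<^esub> k) \<psi>"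
        using G.int_pow_closed[OF s] bc_base_change[OF bc] k by blast
      fix \<phi> assume \<phi>: "\<phi> \<in> carrier (Aut ?f) \<and> is_base_change ?f ?f \<phi> \<psi>"
      then have "\<phi> \<in> carrier (Aut ?f)" ..
      then obtain l :: int where l: "\<phi> = ?s [^]\<^bsub>Aut ?f\<^esub> l" unfolding Z(3) by (rule rangeE)
      have "?t [^]\<^bsub>Aut (cx ?f)\<^esub> k = ?t [^]\<^bsub>Aut (cx ?f)\<^esub> l" using u[OF \<psi>] \<phi> k l by metis
      then have "k = l" using H.int_pow_eq[OF t] C(2) by simp
      then show "\<phi> = ?s [^]\<^bsub>Aut ?f\<^esub> k" using l by simp
    qed
  qed
  have 4: "\<exists>!\<psi>. \<psi> \<in> carrier (Aut (cx ?f)) \<and> is_base_change ?f ?f \<phi> \<psi>" if \<phi>: "\<phi> \<in> carrier (Aut ?f)" for \<phi>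
  proof -
    obtain k :: int where k: "\<phi> = ?s [^]\<^bsub>Aut ?f\<^esub> k" using \<phi> unfolding Z(3) by (rule rangeE)
    show ?thesis
      using u H.int_pow_closed[OF t] bc_base_change[OF bc] unfolding k by blast
  qed
  have 2: "\<exists>s\<in>carrier (Aut (cx ?f)). is_base_change ?f ?f ?s s \<and> infinite_cyclic_gen (Aut (cx ?f)) s"
    using t bc_base_change[OF bc_sg] C(1) by blast
  have 1: "\<forall>(p, q)\<in>E. \<forall>(p', q')\<in>E. ?L p q p' q'"
    by (intro ballI case_prodI2) (rule linear; simp only:)
  show ?thesis
    unfolding f by (intro conjI 1 Z(1) 2 ballI 3 4)
qed

end
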